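(* Let $n\ge1$, $\alpha\in(0,1)$ and $p\in\left[1,\frac{n}{1-\alpha}\right)$. There exists a constant $c_n>0$, depending on the dimension $n$ only, such that $$\int_{\mathbb{R}^n}|(I_{1-\alpha}f)^\star|\,d\mu\le c_n\,\|\mu\|_{n-1}\,|D^\alpha f|(\mathbb{R}^n)$$ for all $f\in BV^{\alpha,p}(\mathbb{R}^n)$ and all non-negative locally finite Borel (Radon) measures $\mu$ on $\mathbb{R}^n$.
   Context: Let $\mu_{n,\alpha}=2^{\alpha}\pi^{-n/2}\,\Gamma\left(\frac{n+\alpha+1}{2}\right)/\Gamma\left(\frac{1-\alpha}{2}\right)$. For $\varphi\in \mathrm{Lip}_c(\mathbb{R}^n;\mathbb{R}^n)$ (compactly supported Lipschitz), the fractional $\alpha$-divergence is $$\mathrm{div}^\alpha\varphi(x)=\mu_{n,\alpha}\int_{\mathbb{R}^n}\frac{(y-x)\cdot(\varphi(y)-\varphi(x))}{|y-x|^{n+\alpha+1}}\,dy,\quad x\in\mathbb{R}^n.$$ For $p\in[1,+\infty]$ and $f\in L^p(\mathbb{R}^n)$ let $$|D^\alpha f|(\mathbb{R}^n)=\sup\left\{\int_{\mathbb{R}^n} f\,\mathrm{div}^\alpha\varphi\,dx:\varphi\in C^\infty_c(\mathbb{R}^n;\mathbb{R}^n),\ \|\varphi\|_{L^\infty(\mathbb{R}^n;\mathbb{R}^n)}\le1\right\},$$ and $BV^{\alpha,p}(\mathbb{R}^n)=\{f\in L^p(\mathbb{R}^n):|D^\alpha f|(\mathbb{R}^n)<+\infty\}$.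 For $s\in(0,n)$, the Riesz potential of order $s$ is $$I_sf(x)=2^{-s}\pi^{-n/2}\frac{\Gamma\left(\frac{n-s}{2}\right)}{\Gamma\left(\frac{s}{2}\right)}\int_{\mathbb{R}^n}\frac{f(y)}{|x-y|^{n-s}}\,dy.$$ The precise representative of $u\in L^1_{\mathrm{loc}}(\mathbb{R}^n)$ is $u^\star(x)=\lim_{r\to0^+}\frac{1}{|B_r(x)|}\int_{B_r(x)}u(y)\,dy$ if the limit exists, and $u^\star(x)=0$ otherwise. For $s\in[0,n]$ and a non-negative locally finite measure $\mu$, $\|\mu\|_s=\sup_{x\in\mathbb{R}^n,\,r>0}\frac{\mu(B_r(x))}{r^s}\in[0,+\infty]$. *)

theory Defs
  imports "HOL-Analysis.Analysis"
begin

text \<open>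
  The space \<open>\<real>\<^sup>n\<close> is a Euclidean space \<open>'a\<close> with \<open>n = DIM('a)\<close>; integrals over it are Bochner
  integrals with respect to Lebesgue measure. Elements of \<open>L\<^sup>p\<close> are represented by functions;
  the variation and the Riesz potential of \<open>f\<close> depend only on its almost-everywhere class. Only finite
  exponents \<open>p\<close> are covered.
\<close>

definition mem_Lp :: "real \<Rightarrow> ('a::euclidean_space \<Rightarrow> real) \<Rightarrow> bool" where
  "mem_Lp p f \<longleftrightarrow>
     f \<in> borel_measurable lebesgue \<and> integrable lebesgue (\<lambda>x. \<bar>f x\<bar> powr p)"

text \<open>
  \<open>Ck k\<close> is the class \<open>C\<^sup>k\<close> on the whole space, by recursion on \<open>k\<close> over directional derivatives.
\<close>

primrec Ck :: "nat \<Rightarrow> ('a::real_normed_vector \<Rightarrow> 'b::real_normed_vector) \<Rightarrow> bool" where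
  "Ck 0 f \<longleftrightarrow> continuous_on UNIV f"
| "Ck (Suc k) f \<longleftrightarrow>
     (\<forall>x. f differentiable (at x)) \<and> (\<forall>v. Ck k (\<lambda>x. frechet_derivative f (at x) v))"

definition Cinf_c :: "('a::real_normed_vector \<Rightarrow> 'b::real_normed_vector) \<Rightarrow> bool" where
  "Cinf_c \<phi> \<longleftrightarrow> (\<forall>k. Ck k \<phi>) \<and> compact (closure {x. \<phi> x \<noteq> 0})"

definition frac_const :: "nat \<Rightarrow> real \<Rightarrow> real" where
  "frac_const n \<alpha> =
     2 powr \<alpha> * pi powr (- real n / 2) * Gamma ((real n + \<alpha> + 1) / 2) / Gamma ((1 - \<alpha>) / 2)"

definition frac_div :: "real \<Rightarrow> ('a::euclidean_space \<Rightarrow> 'a) \<Rightarrow> 'a \<Rightarrow> real" where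
  "frac_div \<alpha> \<phi> x =
     frac_const DIM('a) \<alpha> *
     (\<integral>y. ((y - x) \<bullet> (\<phi> y - \<phi> x)) / norm (y - x) powr (real DIM('a) + \<alpha> + 1) \<partial>lebesgue)"

text \<open>
  The coercion \<open>ennreal\<close> sends negative reals to \<open>0\<close>; this does not change the supremum, because
  \<open>\<phi> = 0\<close> is admissible.
\<close>

definition frac_variation :: "real \<Rightarrow> ('a::euclidean_space \<Rightarrow> real) \<Rightarrow> ennreal" where
  "frac_variation \<alpha> f =
     (SUP \<phi> \<in> {\<phi> :: 'a \<Rightarrow> 'a. Cinf_c \<phi> \<and> (AE x in lebesgue. norm (\<phi> x) \<le> 1)}.
        ennreal (\<integral>x. f x * frac_div \<alpha> \<phi> x \<partial>lebesgue))"

definition BV :: "real \<Rightarrow> real \<Rightarrow> ('a::euclidean_space \<Rightarrow> real) set" where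
  "BV \<alpha> p = {f. mem_Lp p f \<and> frac_variation \<alpha> f < \<infinity>}"

definition riesz_potential :: "real \<Rightarrow> ('a::euclidean_space \<Rightarrow> real) \<Rightarrow> 'a \<Rightarrow> real" where
  "riesz_potential s f x =
     2 powr (- s) * pi powr (- real DIM('a) / 2) *
     Gamma ((real DIM('a) - s) / 2) / Gamma (s / 2) *
     (\<integral>y. f y / norm (x - y) powr (real DIM('a) - s) \<partial>lebesgue)"

definition ball_average :: "('a::euclidean_space \<Rightarrow> real) \<Rightarrow> 'a \<Rightarrow> real \<Rightarrow> real" where
  "ball_average u x r =
     (LINT y:ball x r|lebesgue. u y) / measure lebesgue (ball x r)"

text \<open>The value \<open>0\<close> is taken at points where the averages have no finite limit.\<close>

definition precise_rep :: "('a::euclidean_space \<Rightarrow> real) \<Rightarrow> 'a \<Rightarrow> real" where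
  "precise_rep u x =
     (if \<exists>l. (ball_average u x \<longlongrightarrow> l) (at_right 0)
      then Lim (at_right 0) (ball_average u x) else 0)"

definition locally_finite_borel :: "'a::metric_space measure \<Rightarrow> bool" where
  "locally_finite_borel \<mu> \<longleftrightarrow>
     sets \<mu> = sets borel \<and> (\<forall>x. \<exists>r>0. emeasure \<mu> (ball x r) < \<infinity>)"

definition growth_norm :: "real \<Rightarrow> 'a::metric_space measure \<Rightarrow> ennreal" where
  "growth_norm s \<mu> = (SUP x. SUP r\<in>{0<..}. emeasure \<mu> (ball x r) / ennreal (r powr s))"

end

theory Submission
  imports Defs
begin

text \<open>
  Put \<open>u = I\<^bsub>1 - \<alpha>\<^esub> f\<close>. The Riesz kernel has gradient proportional to the kernel of the fractional
  divergence, so \<open>div\<^sup>\<alpha> \<phi> = I\<^bsub>1 - \<alpha>\<^esub> (div \<phi>)\<close> and, by Fubini, \<open>\<integral> u div \<phi> = \<integral> f div\<^sup>\<alpha> \<phi>\<close>. By duality,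
  every mollification \<open>v\<close> of \<open>u\<close> satisfies \<open>\<integral> \<bar>\<nabla>v\<bar> \<le> \<bar>D\<^sup>\<alpha>f\<bar>\<close>, and since \<open>p < n / (1 - \<alpha>)\<close> the means of
  \<open>\<bar>v\<bar>\<close> over large balls tend to \<open>0\<close>.

  For such a smooth \<open>v\<close>, each point of \<open>{v > t}\<close>, \<open>t > 0\<close>, is the centre of a ball in which \<open>{v > t}\<close>
  and its complement both have density bounded below. The Poincare inequality, applied to smooth
  approximations of the indicator of \<open>{v > t}\<close>, bounds the \<open>(n - 1)\<close>-st power of the radius by the
  relative perimeter of \<open>{v > t}\<close>, defined as the lower limit of the corresponding weighted integrals
  of \<open>\<bar>\<nabla>v\<bar>\<close>. A Vitali covering gives \<open>\<mu> {v > t} \<le> c \<parallel>\<mu>\<parallel> Per {v > t}\<close>. With this definition of the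
  perimeter the only half of the coarea formula that is needed, \<open>\<integral> Per {v > t} dt \<le> \<integral> \<bar>\<nabla>v\<bar>\<close>, is
  Fatou's lemma, and integration over \<open>t\<close> yields the inequality for \<open>v\<close>.

  Finally, mollifying with a radial kernel is taking a weighted mean of ball averages, so the
  mollifications converge to the precise representative wherever the limit defining it exists, and
  Fatou's lemma concludes.
\<close>

text \<open>Two demands shape the argument. The measure \<mu> may live on Lebesgue null sets such as
  hypersurfaces, so the estimates have to hold at points and not almost everywhere: {v > t} is open
  and is covered around each of its points, and the mollifications converge at each point where the
  ball averages do. The constant may depend on n only: \<alpha>, p and f reach the geometric half of
  the proof just through the total variation of v and the qualitative decay of its means, and
  neither contributes a factor. The decay produces the covering radii. For t > 0 the density of {v >
  t} around one of its points is 1 at small scales and below 1/2 at large ones; the first dyadic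
  scale below 1/2 is the radius wanted. Negative values of v are reached through -v, which doubles
  the constant. A perimeter defined as a lower limit suits three uses of Fatou's lemma: bounding it
  below in one ball, summing it over disjoint balls, integrating it over t. The constant obtained is
  2 * 5^(n - 1) * 2^(2 n + 3) / \<omega>, with \<omega> the volume of the unit ball.\<close>

lemma ball_in_sets_borel [measurable]: "ball (x::'a::metric_space) r \<in> sets borel"
  by simp

section \<open>Affine changes of variables for Lebesgue measure\<close>

lemma lborel_distr_unit_affine:
  fixes t :: "'a::euclidean_space"
  assumes "\<bar>c\<bar> = 1"
  shows "distr lborel borel (\<lambda>x. t + c *\<^sub>R x) = lborel"
  using lborel_affine[of c t] assms by (auto simp: density_1)

lemma lborel_integral_unit_affine:
  fixes f :: "'a::euclidean_space \<Rightarrow> 'b::{banach, second_countable_topology}"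
  assumes "\<bar>c\<bar> = 1" and [measurable]: "f \<in> borel_measurable borel"
  shows "(\<integral>x. f (t + c *\<^sub>R x) \<partial>lborel) = (\<integral>x. f x \<partial>lborel)"
proof -
  have "(\<integral>x. f x \<partial>distr lborel borel (\<lambda>x. t + c *\<^sub>R x)) = (\<integral>x. f (t + c *\<^sub>R x) \<partial>lborel)"
    by (rule integral_distr) auto
  then show ?thesis by (simp add: lborel_distr_unit_affine[OF assms(1)])
qed

lemma lborel_integrable_unit_affine:
  fixes f :: "'a::euclidean_space \<Rightarrow> 'b::{banach, second_countable_topology}"
  assumes "\<bar>c\<bar> = 1" and [measurable]: "f \<in> borel_measurable borel"
  shows "integrable lborel (\<lambda>x. f (t + c *\<^sub>R x)) \<longleftrightarrow> integrable lborel f"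
proof -
  have "integrable (distr lborel borel (\<lambda>x. t + c *\<^sub>R x)) f \<longleftrightarrow> integrable lborel (\<lambda>x. f (t + c *\<^sub>R x))"
    by (rule integrable_distr_eq) auto
  then show ?thesis by (simp add: lborel_distr_unit_affine[OF assms(1)])
qed

lemma nn_integral_lborel_affine:
  fixes f :: "'a::euclidean_space \<Rightarrow> ennreal"
  assumes "c \<noteq> 0" and [measurable]: "f \<in> borel_measurable borel"
  shows "(\<integral>\<^sup>+x. f (t + c *\<^sub>R x) \<partial>lborel) * ennreal (\<bar>c\<bar> ^ DIM('a)) = (\<integral>\<^sup>+x. f x \<partial>lborel)"
proof -
  have "(\<integral>\<^sup>+x. f x \<partial>lborel) = (\<integral>\<^sup>+x. f x \<partial>density (distr lborel borel (\<lambda>x. t + c *\<^sub>R x)) (\<lambda>_. \<bar>c\<bar>^DIM('a)))"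
    using lborel_affine[OF assms(1), of t] by simp
  also have "\<dots> = (\<integral>\<^sup>+x. ennreal (\<bar>c\<bar> ^ DIM('a)) * f x \<partial>distr lborel borel (\<lambda>x. t + c *\<^sub>R x))"
    by (rule nn_integral_density) (auto simp: ennreal_power)
  also have "\<dots> = (\<integral>\<^sup>+x. ennreal (\<bar>c\<bar> ^ DIM('a)) * f (t + c *\<^sub>R x) \<partial>lborel)"
    by (rule nn_integral_distr) auto
  also have "\<dots> = (\<integral>\<^sup>+x. f (t + c *\<^sub>R x) \<partial>lborel) * ennreal (\<bar>c\<bar> ^ DIM('a))"
    by (subst nn_integral_cmult) (auto simp: mult.commute)
  finally show ?thesis by simp
qed

lemma nn_integral_lborel_unit_affine:
  fixes f :: "'a::euclidean_space \<Rightarrow> ennreal"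
  assumes "\<bar>c\<bar> = 1" and "f \<in> borel_measurable borel"
  shows "(\<integral>\<^sup>+x. f (t + c *\<^sub>R x) \<partial>lborel) = (\<integral>\<^sup>+x. f x \<partial>lborel)"
  using nn_integral_lborel_affine[of c f t] assms by auto

section \<open>Riesz kernels\<close>

lemma ennreal_le_suminf: "(f j :: ennreal) \<le> (\<Sum>i. f i)"
  using sum_le_suminf[of f "{j}"] by simp

text \<open>Common form of the dyadic decompositions at the origin and at infinity. It suffices that
  one ball of the family accounts for each point: the other terms of the sum only enlarge the
  majorant, so whole balls can replace shells.\<close>

lemma nn_integral_le_geometric_ball_sum:
  fixes g :: "'a::euclidean_space \<Rightarrow> ennreal"
  assumes q: "0 \<le> q" "q < 1" and nonneg: "A \<ge> 0" "\<And>j. 0 \<le> a j" "\<And>j. 0 \<le> \<rho> j"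
    and le: "\<And>z. \<exists>j. g z \<le> ennreal (a j) * indicator (ball 0 (\<rho> j)) z"
    and eq: "\<And>j. a j * (unit_ball_vol (real DIM('a)) * \<rho> j ^ DIM('a)) = A * q ^ j"
  shows "(\<integral>\<^sup>+z. g z \<partial>lborel) \<le> ennreal (A * (1 / (1 - q)))"
proof -
  have "(\<integral>\<^sup>+z. g z \<partial>lborel) \<le> (\<integral>\<^sup>+z. (\<Sum>j. ennreal (a j) * indicator (ball (0::'a) (\<rho> j)) z) \<partial>lborel)"
  proof (rule nn_integral_mono)
    fix z :: 'a
    obtain j where "g z \<le> ennreal (a j) * indicator (ball 0 (\<rho> j)) z" using le by blast
    also have "\<dots> \<le> (\<Sum>j. ennreal (a j) * indicator (ball 0 (\<rho> j)) z)" by (rule ennreal_le_suminf)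
    finally show "g z \<le> \<dots>" .
  qed
  also have "\<dots> = (\<Sum>j. (\<integral>\<^sup>+z. ennreal (a j) * indicator (ball (0::'a) (\<rho> j)) z \<partial>lborel))"
    by (rule nn_integral_suminf) auto
  also have "\<dots> = (\<Sum>j. ennreal (A * q ^ j))"
    using nonneg by (intro suminf_cong) (simp add: nn_integral_cmult_indicator emeasure_ball flip: ennreal_mult' eq)
  also have "\<dots> = ennreal (A * (1 / (1 - q)))"
    by (intro suminf_ennreal_eq sums_mult geometric_sums) (use q nonneg in auto)
  finally show ?thesis .
qed

text \<open>On the shell between the radii R / 2^(j + 1) and R / 2^j the kernel is at most its value
  at the inner radius. Enlarging the shell to a ball gives a geometric series of ratio 2^(\<gamma> -
  n), which is below 1 because \<gamma> < n.\<close>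

lemma nn_integral_norm_powr_ball_le:
  assumes "0 \<le> \<gamma>" "\<gamma> < real DIM('a)"
  shows "\<exists>C\<ge>0. \<forall>R>0. (\<integral>\<^sup>+z. ennreal (norm (z::'a::euclidean_space) powr (-\<gamma>)) * indicator (ball 0 R) z \<partial>lborel)
            \<le> ennreal (C * R powr (real DIM('a) - \<gamma>))"
proof -
  define q where "q = 2 powr (\<gamma> - real DIM('a))"
  define \<omega> where "\<omega> = unit_ball_vol (real DIM('a))"
  have \<omega>: "\<omega> \<ge> 0" by (simp add: \<omega>_def)
  have q: "0 \<le> q" "q < 1"
    unfolding q_def using assms powr_less_mono[of "\<gamma> - real DIM('a)" 0 2] by auto
  have "(\<integral>\<^sup>+z. ennreal (norm (z::'a) powr (-\<gamma>)) * indicator (ball 0 R) z \<partial>lborel)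
            \<le> ennreal (\<omega> * 2 powr \<gamma> * (1 / (1 - q)) * R powr (real DIM('a) - \<gamma>))" if R: "R > 0" for R
  proof -
    define a where "a j = (R / 2 ^ (Suc j)) powr (-\<gamma>)" for j
    have "(\<integral>\<^sup>+z. ennreal (norm (z::'a) powr (-\<gamma>)) * indicator (ball 0 R) z \<partial>lborel)
        \<le> ennreal (\<omega> * 2 powr \<gamma> * R powr (real DIM('a) - \<gamma>) * (1 / (1 - q)))"
    proof (rule nn_integral_le_geometric_ball_sum[OF q])
      show "\<exists>j. ennreal (norm z powr (-\<gamma>)) * indicator (ball 0 R) z \<le> ennreal (a j) * indicator (ball 0 (R / 2 ^ j)) z" for z :: 'a
      \<comment> \<open>At the origin the left side vanishes, because
        \<open>0 powr (-\<gamma>) = 0\<close>.\<close>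
      proof (cases "z = 0 \<or> norm z \<ge> R")
        case True
        then show ?thesis by auto
      next
        case False
        then have z: "0 < norm z" "norm z < R" by auto
        have "(\<lambda>j. R / 2 ^ (Suc j)) \<longlonglongrightarrow> 0"
          by (rule LIMSEQ_Suc[of "\<lambda>j. R / 2 ^ j"]) (rule LIMSEQ_divide_realpow_zero, simp)
        then have "eventually (\<lambda>j. R / 2 ^ (Suc j) < norm z) sequentially"
          using z(1) by (rule order_tendstoD)
        then have ex: "\<exists>j. R / 2 ^ (Suc j) \<le> norm z"
          by (auto simp: eventually_sequentially intro: less_imp_le)
        define j where "j = (LEAST j. R / 2 ^ (Suc j) \<le> norm z)"
        have j1: "R / 2 ^ (Suc j) \<le> norm z" unfolding j_def using ex by (rule LeastI_ex)
        have j2: "norm z < R / 2 ^ j"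
        proof (cases j)
          case 0
          then show ?thesis using z by simp
        next
          case (Suc i)
          then have "\<not> (R / 2 ^ (Suc i) \<le> norm z)" unfolding j_def by (intro not_less_Least) simp
          then show ?thesis using Suc by simp
        qed
        have "norm z powr (-\<gamma>) \<le> a j"
          unfolding a_def using j1 R assms by (intro powr_mono2') auto
        then have "ennreal (norm z powr (-\<gamma>)) * indicator (ball 0 R) z
           \<le> ennreal (a j) * indicator (ball 0 (R / 2 ^ j)) z"
          using j2 z by (auto intro!: ennreal_leI)
        then show ?thesis by blast
      qed
      show "a j * (unit_ball_vol (real DIM('a)) * (R / 2 ^ j) ^ DIM('a)) = \<omega> * 2 powr \<gamma> * R powr (real DIM('a) - \<gamma>) * q ^ j" for j
      proof -
        have 1: "a j = R powr (-\<gamma>) * (2 powr (real j * \<gamma>) * 2 powr \<gamma>)"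
          unfolding a_def using R
          by (simp add: powr_divide powr_mult powr_minus powr_powr powr_realpow[symmetric] powr_add[symmetric]
             field_simps del: power_Suc)
        have 2: "(R / 2 ^ j) ^ DIM('a) = R powr (real DIM('a)) * 2 powr (- real j * real DIM('a))"
          using R by (simp add: power_divide powr_realpow powr_minus powr_powr[symmetric] powr_divide field_simps)
        have 3: "q ^ j = 2 powr (real j * \<gamma>) * 2 powr (- real j * real DIM('a))"
          unfolding q_def by (simp add: powr_realpow[symmetric] powr_powr powr_add[symmetric] algebra_simps)
        have 4: "R powr (real DIM('a) - \<gamma>) = R powr (real DIM('a)) * R powr (-\<gamma>)"
          by (simp add: powr_add[symmetric])
        show ?thesis unfolding 1 2 3 4 by (simp add: mult_ac \<omega>_def)
      qed
    qed (use \<omega> R in \<open>auto simp: a_def\<close>)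
    then show ?thesis by (simp add: mult_ac)
  qed
  then show ?thesis
    using \<omega> q by (intro exI[of _ "\<omega> * 2 powr \<gamma> * (1 / (1 - q))"]) auto
qed

text \<open>The counterpart at infinity: the shells are 2^j \<le> 1 + |z| < 2^(j + 1), and the ratio
  is 2^(n - \<gamma>).\<close>

lemma nn_integral_one_plus_norm_powr_finite:
  assumes "real DIM('a) < \<gamma>"
  shows "(\<integral>\<^sup>+z. ennreal ((1 + norm (z::'a::euclidean_space)) powr (-\<gamma>)) \<partial>lborel) < \<infinity>"
proof -
  define q where "q = 2 powr (real DIM('a) - \<gamma>)"
  define \<omega> where "\<omega> = unit_ball_vol (real DIM('a))"
  have \<omega>: "\<omega> \<ge> 0" by (simp add: \<omega>_def)
  have q: "0 \<le> q" "q < 1"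
    unfolding q_def using assms powr_less_mono[of "real DIM('a) - \<gamma>" 0 2] by auto
  define a where "a j = (2 ^ j) powr (-\<gamma>)" for j
  have "(\<integral>\<^sup>+z. ennreal ((1 + norm (z::'a)) powr (-\<gamma>)) \<partial>lborel) \<le> ennreal (\<omega> * 2 ^ DIM('a) * (1 / (1 - q)))"
  proof (rule nn_integral_le_geometric_ball_sum[OF q])
    show "\<exists>j. ennreal ((1 + norm z) powr (-\<gamma>)) \<le> ennreal (a j) * indicator (ball 0 (2 ^ Suc j)) z" for z :: 'a
    proof -
      obtain i :: nat where "1 + norm z < 2 ^ i"
        using real_arch_pow[of 2 "1 + norm z"] by auto
      then have ex: "\<exists>j. 1 + norm z < 2 ^ Suc j"
        by (intro exI[of _ i]) (auto intro: less_le_trans)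
      define j where "j = (LEAST j. 1 + norm z < 2 ^ Suc j)"
      have j1: "1 + norm z < 2 ^ Suc j" unfolding j_def using ex by (rule LeastI_ex)
      have j2: "2 ^ j \<le> 1 + norm z"
      proof (cases j)
        case 0
        then show ?thesis by simp
      next
        case (Suc i)
        then have "\<not> (1 + norm z < 2 ^ Suc i)" unfolding j_def by (intro not_less_Least) simp
        then show ?thesis using Suc by simp
      qed
      have "(1 + norm z) powr (-\<gamma>) \<le> a j"
        unfolding a_def using j2 assms by (intro powr_mono2') auto
      then have "ennreal ((1 + norm z) powr (-\<gamma>))
           \<le> ennreal (a j) * indicator (ball 0 (2 ^ Suc j)) z"
        using j1 by (auto intro!: ennreal_leI simp: indicator_def)
      then show ?thesis by blast
    qed
    show "a j * (unit_ball_vol (real DIM('a)) * (2 ^ Suc j) ^ DIM('a)) = \<omega> * 2 ^ DIM('a) * q ^ j" for j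
    proof -
      have 1: "a j = 2 powr (- real j * \<gamma>)"
        unfolding a_def by (simp add: powr_realpow[symmetric] powr_powr)
      have 2: "((2::real) ^ Suc j) ^ DIM('a) = 2 ^ DIM('a) * 2 powr (real j * real DIM('a))"
        by (simp add: powr_realpow powr_powr[symmetric] power_mult_distrib)
      have 3: "q ^ j = 2 powr (- real j * \<gamma>) * 2 powr (real j * real DIM('a))"
        unfolding q_def by (simp add: powr_realpow[symmetric] powr_powr powr_add[symmetric] algebra_simps)
      show ?thesis unfolding 1 2 3 by (simp add: mult_ac \<omega>_def)
    qed
  qed (use \<omega> in \<open>auto simp: a_def\<close>)
  then show ?thesis by (auto simp: le_less_trans)
qed

abbreviation kernel_mass :: "real \<Rightarrow> real \<Rightarrow> 'a::euclidean_space \<Rightarrow> ennreal" where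
  "kernel_mass \<gamma> R z \<equiv> \<integral>\<^sup>+y. ennreal (norm (z - y) powr (-\<gamma>)) * indicator (ball 0 R) y \<partial>lborel"

abbreviation ball_mass :: "('a::euclidean_space \<Rightarrow> real) \<Rightarrow> real \<Rightarrow> ennreal" where
  "ball_mass u R \<equiv> \<integral>\<^sup>+y. ennreal \<bar>u y\<bar> * indicator (ball 0 R) y \<partial>lborel"

text \<open>If |z| \<ge> 2 R, then |z - y| \<ge> (R + |z|) / 3 on the ball, so the kernel is
  essentially constant there. Otherwise R + |z| < 3 R, and recentring at z puts the ball inside one
  of radius 3 R around the singularity. Keeping R inside the weight is what later makes the means of
  u decay.\<close>

lemma nn_integral_kernel_ball_le:
  assumes "0 \<le> \<gamma>" "\<gamma> < real DIM('a)"
  shows "\<exists>C\<ge>0. \<forall>R>0. \<forall>z::'a::euclidean_space.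
     kernel_mass \<gamma> R z
            \<le> ennreal (C * R ^ DIM('a) * (R + norm z) powr (-\<gamma>))"
proof -
  obtain C where C: "C \<ge> 0" "\<And>R. R > 0 \<Longrightarrow> 
     (\<integral>\<^sup>+z. ennreal (norm (z::'a) powr (-\<gamma>)) * indicator (ball 0 R) z \<partial>lborel)
            \<le> ennreal (C * R powr (real DIM('a) - \<gamma>))"
    using nn_integral_norm_powr_ball_le[OF assms] by auto
  define \<omega> where "\<omega> = unit_ball_vol (real DIM('a))"
  have \<omega>: "\<omega> \<ge> 0" by (simp add: \<omega>_def)
  define D where "D = \<omega> * 3 powr \<gamma> + C * 3 powr (real DIM('a))"
  have "kernel_mass \<gamma> R z
            \<le> ennreal (D * R ^ DIM('a) * (R + norm z) powr (-\<gamma>))" if R: "R > 0" for R and z :: 'a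
  proof (cases "norm z \<ge> 2 * R")
    case True
    have "kernel_mass \<gamma> R z
       \<le> (\<integral>\<^sup>+y. ennreal (3 powr \<gamma> * (R + norm z) powr (-\<gamma>)) * indicator (ball (0::'a) R) y \<partial>lborel)"
    proof (rule nn_integral_mono)
      fix y :: 'a
      show "ennreal (norm (z - y) powr (-\<gamma>)) * indicator (ball 0 R) y
         \<le> ennreal (3 powr \<gamma> * (R + norm z) powr (-\<gamma>)) * indicator (ball 0 R) y"
      proof (cases "y \<in> ball 0 R")
        case y: True
        have "norm (z - y) \<ge> norm z - norm y" by norm
        then have "norm (z - y) \<ge> (R + norm z) / 3" using y True by simp
        then have "norm (z - y) powr (-\<gamma>) \<le> ((R + norm z) / 3) powr (-\<gamma>)"
          using R assms by (intro powr_mono2') (auto intro: add_pos_nonneg)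
        also have "\<dots> = 3 powr \<gamma> * (R + norm z) powr (-\<gamma>)"
          using R by (simp add: powr_divide powr_minus field_simps)
        finally show ?thesis by (auto intro!: mult_right_mono ennreal_leI)
      qed auto
    qed
    also have "\<dots> = ennreal (3 powr \<gamma> * (R + norm z) powr (-\<gamma>)) * ennreal (\<omega> * R ^ DIM('a))"
      using R by (subst nn_integral_cmult_indicator) (auto simp: emeasure_ball \<omega>_def)
    also have "\<dots> = ennreal (3 powr \<gamma> * (R + norm z) powr (-\<gamma>) * (\<omega> * R ^ DIM('a)))"
      by (rule ennreal_mult'[symmetric]) simp
    also have "\<dots> \<le> ennreal (D * R ^ DIM('a) * (R + norm z) powr (-\<gamma>))"
    proof (rule ennreal_leI)
      have "\<omega> * 3 powr \<gamma> * (R ^ DIM('a) * (R + norm z) powr (-\<gamma>)) \<le> D * (R ^ DIM('a) * (R + norm z) powr (-\<gamma>))"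
        using R C \<omega> by (intro mult_right_mono) (auto simp: D_def)
      then show "3 powr \<gamma> * (R + norm z) powr (-\<gamma>) * (\<omega> * R ^ DIM('a)) \<le> D * R ^ DIM('a) * (R + norm z) powr (-\<gamma>)"
        by (simp add: mult_ac)
    qed
    finally show ?thesis .
  next
    case False
    have "kernel_mass \<gamma> R z
       \<le> (\<integral>\<^sup>+y. ennreal (norm (z - y) powr (-\<gamma>)) * indicator (ball 0 (3 * R)) (z - y) \<partial>lborel)"
    proof (rule nn_integral_mono)
      fix y :: 'a
      have "norm (z - y) \<le> norm z + norm y" by norm
      then have "indicator (ball 0 R) y \<le> (indicator (ball 0 (3 * R)) (z - y) :: ennreal)"
        using False by (auto simp: indicator_def)
      then show "ennreal (norm (z - y) powr (-\<gamma>)) * indicator (ball 0 R) y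
         \<le> ennreal (norm (z - y) powr (-\<gamma>)) * indicator (ball 0 (3 * R)) (z - y)"
        by (rule mult_left_mono) simp
    qed
    also have "\<dots> = (\<integral>\<^sup>+y. ennreal (norm (y::'a) powr (-\<gamma>)) * indicator (ball 0 (3 * R)) y \<partial>lborel)"
    proof -
      have "(\<lambda>y. ennreal (norm (y::'a) powr (-\<gamma>)) * indicator (ball 0 (3 * R)) y) \<in> borel_measurable borel"
        by measurable
      from nn_integral_lborel_unit_affine[OF _ this, of "-1" z] show ?thesis by simp
    qed
    also have "\<dots> \<le> ennreal (C * (3 * R) powr (real DIM('a) - \<gamma>))"
      using C R by auto
    also have "\<dots> \<le> ennreal (D * R ^ DIM('a) * (R + norm z) powr (-\<gamma>))"
    proof (rule ennreal_leI)
      have "(3 * R) powr (real DIM('a) - \<gamma>) = (3 * R) powr real DIM('a) * (3 * R) powr (-\<gamma>)"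
        by (simp add: powr_add[symmetric])
      also have "\<dots> \<le> (3 * R) powr real DIM('a) * (R + norm z) powr (-\<gamma>)"
        using False R assms by (intro mult_left_mono powr_mono2') (auto intro: add_pos_nonneg)
      also have "(3 * R) powr real DIM('a) = 3 powr real DIM('a) * R ^ DIM('a)"
        using R by (simp add: powr_mult powr_realpow)
      finally have "C * (3 * R) powr (real DIM('a) - \<gamma>) 
         \<le> C * (3 powr real DIM('a) * R ^ DIM('a) * (R + norm z) powr (-\<gamma>))"
        using C by (intro mult_left_mono)
      also have "\<dots> = C * 3 powr real DIM('a) * (R ^ DIM('a) * (R + norm z) powr (-\<gamma>))" by (simp add: mult_ac)
      also have "\<dots> \<le> D * (R ^ DIM('a) * (R + norm z) powr (-\<gamma>))"
        using R C \<omega> by (intro mult_right_mono) (auto simp: D_def)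
      finally show "C * (3 * R) powr (real DIM('a) - \<gamma>) \<le> D * R ^ DIM('a) * (R + norm z) powr (-\<gamma>)"
        by (simp add: mult_ac)
    qed
    finally show ?thesis .
  qed
  moreover have "D \<ge> 0" using C \<omega> by (auto simp: D_def)
  ultimately show ?thesis by blast
qed

text \<open>Young's inequality separates |f|^p from the q-th power of the weight, q being conjugate
  to p. That power is integrable when \<beta> q > n, which is p (n - \<beta>) < n; with \<beta> = n
  - (1 - \<alpha>) this is the bound p < n / (1 - \<alpha>).\<close>

lemma nn_integral_Lp_weight_finite:
  fixes f :: "'a::euclidean_space \<Rightarrow> real"
  assumes [measurable]: "f \<in> borel_measurable borel" and p: "1 \<le> p" "p * (real DIM('a) - \<beta>) < real DIM('a)"
    and \<beta>: "0 < \<beta>" and int: "integrable lborel (\<lambda>x. \<bar>f x\<bar> powr p)"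
  shows "(\<integral>\<^sup>+z. ennreal (\<bar>f z\<bar> * (1 + norm z) powr (-\<beta>)) \<partial>lborel) < \<infinity>"
proof -
  have fin: "(\<integral>\<^sup>+z. ennreal (\<bar>f z\<bar> powr p) \<partial>lborel) < \<infinity>"
    using int unfolding integrable_iff_bounded by simp
  show ?thesis
  proof (cases "p = 1")
    case True
    have "(\<integral>\<^sup>+z. ennreal (\<bar>f z\<bar> * (1 + norm z) powr (-\<beta>)) \<partial>lborel) \<le> (\<integral>\<^sup>+z. ennreal (\<bar>f z\<bar> powr p) \<partial>lborel)"
    proof (intro nn_integral_mono ennreal_leI)
      fix z :: 'a
      have "(1 + norm z) powr (-\<beta>) \<le> 1 powr (-\<beta>)"
        using \<beta> by (intro powr_mono2') auto
      then show "\<bar>f z\<bar> * (1 + norm z) powr (-\<beta>) \<le> \<bar>f z\<bar> powr p"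
        using True by (auto intro: mult_left_le)
    qed
    then show ?thesis using fin by (auto intro: le_less_trans)
  next
    case False
    then have p1: "p > 1" using p by simp
    define q where "q = p / (p - 1)"
    have q: "q > 1" "1 / p + 1 / q = 1" using p1 by (auto simp: q_def field_simps)
    have "real DIM('a) < \<beta> * q"
      using p p1 by (simp add: q_def field_simps)
    then have fin2: "(\<integral>\<^sup>+z. ennreal ((1 + norm (z::'a)) powr (-(\<beta> * q))) \<partial>lborel) < \<infinity>"
      by (rule nn_integral_one_plus_norm_powr_finite)
    have "(\<integral>\<^sup>+z. ennreal (\<bar>f z\<bar> * (1 + norm z) powr (-\<beta>)) \<partial>lborel)
       \<le> (\<integral>\<^sup>+z. ennreal (\<bar>f z\<bar> powr p) + ennreal ((1 + norm z) powr (-(\<beta> * q))) \<partial>lborel)"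
    proof (intro nn_integral_mono)
      fix z :: 'a
      have "\<bar>f z\<bar> * (1 + norm z) powr (-\<beta>) \<le> \<bar>f z\<bar> powr p / p + ((1 + norm z) powr (-\<beta>)) powr q / q"
        by (rule Youngs_inequality) (use p1 q in auto)
      also have "\<dots> \<le> \<bar>f z\<bar> powr p + (1 + norm z) powr (-(\<beta> * q))"
        using p1 q by (intro add_mono) (auto simp: powr_powr divide_le_eq mult_le_cancel_left1)
      finally show "ennreal (\<bar>f z\<bar> * (1 + norm z) powr (-\<beta>)) 
          \<le> ennreal (\<bar>f z\<bar> powr p) + ennreal ((1 + norm z) powr (-(\<beta> * q)))"
        by (simp add: ennreal_leI flip: ennreal_plus)
    qed
    also have "\<dots> = (\<integral>\<^sup>+z. ennreal (\<bar>f z\<bar> powr p) \<partial>lborel) + (\<integral>\<^sup>+z. ennreal ((1 + norm (z::'a)) powr (-(\<beta> * q))) \<partial>lborel)"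
      by (rule nn_integral_add) auto
    also have "\<dots> < \<infinity>" using fin fin2 by simp
    finally show ?thesis .
  qed
qed

text \<open>Integrability is not assumed: a Bochner integral that does not exist has the value 0.
  The bounds for u thus hold also at points where the integral defining it diverges.\<close>

lemma ennreal_abs_integral_le_nn_integral:
  fixes f :: "'a \<Rightarrow> real"
  shows "ennreal \<bar>integral\<^sup>L M f\<bar> \<le> (\<integral>\<^sup>+x. ennreal \<bar>f x\<bar> \<partial>M)"
proof (cases "integrable M f")
  case True
  then show ?thesis using integral_norm_bound_ennreal[of M f] by simp
qed (simp add: not_integrable_integral_eq)

text \<open>All that remains of the exponent p is the weighted integrability of f, which makes the
  Riesz potential of |f| locally integrable.\<close>

locale riesz_setting =
  fixes f :: "'a::euclidean_space \<Rightarrow> real" and \<alpha> :: real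
  assumes \<alpha>: "0 < \<alpha>" "\<alpha> < 1" and f_borel [measurable]: "f \<in> borel_measurable borel"
    and weight: "(\<integral>\<^sup>+z. ennreal (\<bar>f z\<bar> * (1 + norm z) powr (-(real DIM('a) - (1 - \<alpha>)))) \<partial>lborel) < \<infinity>"
begin

text \<open>The Riesz kernel of order 1 - \<alpha> is \<kappa> |x|^(-\<beta>). Since n - 1 < \<beta>
  < n, it is locally integrable, while its gradient, of order |x|^(-\<beta> - 1), is integrable at
  infinity but not at the origin.\<close>

definition \<beta> where "\<beta> = real DIM('a) - (1 - \<alpha>)"
definition \<kappa> where "\<kappa> = 2 powr (- (1 - \<alpha>)) * pi powr (- real DIM('a) / 2) *
     Gamma ((real DIM('a) - (1 - \<alpha>)) / 2) / Gamma ((1 - \<alpha>) / 2)"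
definition u where "u = riesz_potential (1 - \<alpha>) f"

abbreviation weighted_mass :: "real \<Rightarrow> ennreal" where
  "weighted_mass R \<equiv> \<integral>\<^sup>+z. ennreal (\<bar>f z\<bar> * (R + norm z) powr (-\<beta>)) \<partial>lborel"

lemma \<beta>_bounds: "0 < \<beta>" "\<beta> < real DIM('a)"
proof -
  have "real DIM('a) \<ge> 1" using DIM_positive[where 'a='a] by linarith
  then show "0 < \<beta>" using \<alpha> unfolding \<beta>_def by linarith
  show "\<beta> < real DIM('a)" using \<alpha> by (simp add: \<beta>_def)
qed

lemma \<kappa>_pos: "0 < \<kappa>"
  using \<beta>_bounds \<alpha> unfolding \<kappa>_def \<beta>_def by (auto intro!: mult_pos_pos divide_pos_pos Gamma_real_pos)

lemma weight_finite: "weighted_mass 1 < \<infinity>"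
  using weight by (simp add: \<beta>_def)

lemma u_eq: "u x = \<kappa> * (\<integral>y. f y * norm (x - y) powr (-\<beta>) \<partial>lborel)"
proof -
  have "(\<integral>y. f y / norm (x - y) powr \<beta> \<partial>lebesgue) = (\<integral>y. f y / norm (x - y) powr \<beta> \<partial>lborel)"
    by (rule integral_completion) measurable
  moreover have "(\<lambda>y. f y * norm (x - y) powr (-\<beta>)) = (\<lambda>y. f y / norm (x - y) powr \<beta>)"
    by (simp add: powr_minus divide_inverse)
  ultimately show ?thesis
    unfolding u_def riesz_potential_def \<kappa>_def \<beta>_def[symmetric] by simp
qed

lemma u_borel [measurable]: "u \<in> borel_measurable borel"
  unfolding u_eq[abs_def] by measurable

lemma weight_R: "R > 0 \<Longrightarrow> weighted_mass R < \<infinity>"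
proof -
  assume R: "R > 0"
  define m where "m = min 1 R"
  have m: "m > 0" "m \<le> 1" "m \<le> R" using R by (auto simp: m_def)
  have "weighted_mass R
     \<le> (\<integral>\<^sup>+z. ennreal (m powr (-\<beta>)) * ennreal (\<bar>f z\<bar> * (1 + norm z) powr (-\<beta>)) \<partial>lborel)"
  proof (rule nn_integral_mono)
    fix z :: 'a
    have "m * (1 + norm z) \<le> R + norm z" using m mult_right_mono[of m 1 "norm z"] by (simp add: distrib_left)
    then have "(R + norm z) powr (-\<beta>) \<le> (m * (1 + norm z)) powr (-\<beta>)"
      using m \<beta>_bounds by (intro powr_mono2') (auto intro!: mult_pos_pos add_pos_nonneg)
    then have "\<bar>f z\<bar> * (R + norm z) powr (-\<beta>) \<le> m powr (-\<beta>) * (\<bar>f z\<bar> * (1 + norm z) powr (-\<beta>))"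
      using m mult_left_mono[of "(R + norm z) powr (-\<beta>)" "(m * (1 + norm z)) powr (-\<beta>)" "\<bar>f z\<bar>"]
      by (simp add: powr_mult mult_ac)
    then show "ennreal (\<bar>f z\<bar> * (R + norm z) powr (-\<beta>)) \<le> ennreal (m powr (-\<beta>)) * ennreal (\<bar>f z\<bar> * (1 + norm z) powr (-\<beta>))"
      by (simp add: ennreal_leI flip: ennreal_mult')
  qed
  also have "\<dots> = ennreal (m powr (-\<beta>)) * weighted_mass 1"
    by (rule nn_integral_cmult) measurable
  also have "\<dots> < \<infinity>" using weight_finite by (simp add: ennreal_mult_less_top)
  finally show ?thesis .
qed

abbreviation double_mass :: "real \<Rightarrow> ennreal" where
  "double_mass R \<equiv> \<integral>\<^sup>+x. \<integral>\<^sup>+y. ennreal \<bar>f x\<bar> * (ennreal (norm (x - y) powr (-\<beta>)) * indicator (ball 0 R) y) \<partial>lborel \<partial>lborel"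

text \<open>The Tonelli estimate behind both the size of u on balls and the use of Fubini's theorem
  in \<open>u_duality\<close>.\<close>

lemma kernel_double_integral_le:
  "\<exists>C\<ge>0. \<forall>R>0. double_mass R
     \<le> ennreal (C * R ^ DIM('a)) * weighted_mass R"
proof -
  obtain C where C: "C \<ge> 0" "\<And>R z. R > 0 \<Longrightarrow>
     kernel_mass \<beta> R (z :: 'a)
            \<le> ennreal (C * R ^ DIM('a) * (R + norm z) powr (-\<beta>))"
    using nn_integral_kernel_ball_le[where 'a='a, of \<beta>] \<beta>_bounds by auto
  have "double_mass R
     \<le> ennreal (C * R ^ DIM('a)) * weighted_mass R" (is "?I \<le> _") if R: "R > 0" for R
  proof -
    have "?I = (\<integral>\<^sup>+x. ennreal \<bar>f x\<bar> * kernel_mass \<beta> R x \<partial>lborel)"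
      by (intro nn_integral_cong nn_integral_cmult) measurable
    also have "\<dots> \<le> (\<integral>\<^sup>+x. ennreal \<bar>f x\<bar> * ennreal (C * R ^ DIM('a) * (R + norm x) powr (-\<beta>)) \<partial>lborel)"
      by (intro nn_integral_mono mult_left_mono C R) simp
    also have "\<dots> = (\<integral>\<^sup>+x. ennreal (C * R ^ DIM('a)) * ennreal (\<bar>f x\<bar> * (R + norm x) powr (-\<beta>)) \<partial>lborel)"
      using C R by (intro nn_integral_cong) (simp add: mult_ac flip: ennreal_mult')
    also have "\<dots> = ennreal (C * R ^ DIM('a)) * weighted_mass R"
      by (rule nn_integral_cmult) measurable
    finally show ?thesis .
  qed
  then show ?thesis using C(1) by blast
qed

lemma u_ball_le:
  "\<exists>C\<ge>0. \<forall>R>0. ball_mass u R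
     \<le> ennreal (C * R ^ DIM('a)) * weighted_mass R"
proof -
  define K where "K x y R = ennreal (norm (x - y) powr (-\<beta>)) * indicator (ball 0 R) y" for x y :: 'a and R
  obtain C where C: "C \<ge> 0" "\<And>R. R > 0 \<Longrightarrow> (\<integral>\<^sup>+x. \<integral>\<^sup>+y. ennreal \<bar>f x\<bar> * K x y R \<partial>lborel \<partial>lborel)
     \<le> ennreal (C * R ^ DIM('a)) * weighted_mass R"
    using kernel_double_integral_le unfolding K_def by blast
  have "ball_mass u R
     \<le> ennreal (\<kappa> * C * R ^ DIM('a)) * weighted_mass R" if R: "R > 0" for R
  proof -
    have "ball_mass u R
      \<le> (\<integral>\<^sup>+y. ennreal \<kappa> * (\<integral>\<^sup>+x. ennreal \<bar>f x\<bar> * K x y R \<partial>lborel) \<partial>lborel)"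
    proof (rule nn_integral_mono)
      fix y :: 'a
      have "ennreal \<bar>u y\<bar> = ennreal \<kappa> * ennreal \<bar>\<integral>x. f x * norm (y - x) powr (-\<beta>) \<partial>lborel\<bar>"
        using \<kappa>_pos by (simp add: u_eq abs_mult ennreal_mult')
      also have "\<dots> \<le> ennreal \<kappa> * (\<integral>\<^sup>+x. ennreal \<bar>f x * norm (y - x) powr (-\<beta>)\<bar> \<partial>lborel)"
        by (intro mult_left_mono ennreal_abs_integral_le_nn_integral) simp
      finally show "ennreal \<bar>u y\<bar> * indicator (ball 0 R) y \<le> ennreal \<kappa> * (\<integral>\<^sup>+x. ennreal \<bar>f x\<bar> * K x y R \<partial>lborel)"
        by (auto simp: K_def abs_mult ennreal_mult norm_minus_commute indicator_def)
    qed
    also have "\<dots> = ennreal \<kappa> * (\<integral>\<^sup>+y. \<integral>\<^sup>+x. ennreal \<bar>f x\<bar> * K x y R \<partial>lborel \<partial>lborel)"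
      unfolding K_def by (rule nn_integral_cmult) measurable
    also have "(\<integral>\<^sup>+y. \<integral>\<^sup>+x. ennreal \<bar>f x\<bar> * K x y R \<partial>lborel \<partial>lborel) = (\<integral>\<^sup>+x. \<integral>\<^sup>+y. ennreal \<bar>f x\<bar> * K x y R \<partial>lborel \<partial>lborel)"
      unfolding K_def by (rule lborel_pair.Fubini') measurable
    also have "ennreal \<kappa> * \<dots> \<le> ennreal \<kappa> * (ennreal (C * R ^ DIM('a)) * weighted_mass R)"
      by (intro mult_left_mono C R) simp
    also have "\<dots> = ennreal (\<kappa> * C * R ^ DIM('a)) * weighted_mass R"
      using \<kappa>_pos C(1) R by (simp add: ennreal_mult mult.assoc)
    finally show ?thesis .
  qed
  then show ?thesis using C \<kappa>_pos by (intro exI[of _ "\<kappa> * C"]) auto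
qed

lemma u_ball_finite: "ball_mass u R < \<infinity>"
proof (cases "R > 0")
  case True
  obtain C where "ball_mass u R
     \<le> ennreal (C * R ^ DIM('a)) * weighted_mass R"
    using u_ball_le True by (auto simp del: mem_ball)
  also have "\<dots> < \<infinity>" using weight_R[OF True] by (simp add: ennreal_mult_less_top)
  finally show ?thesis .
next
  case False
  then have "ball 0 R = ({}::'a set)" by auto
  show ?thesis unfolding \<open>ball 0 R = {}\<close> by simp
qed

text \<open>The mean of |u| over a ball of radius R is at most a constant times
  \<open>weighted_mass R\<close>, which tends to 0 by dominated convergence, the weight at R = 1
  being the majorant. This mean decay replaces decay at infinity, which u need not have
  pointwise.\<close>

lemma u_average_small:
  assumes "\<delta> > 0"
  shows "\<exists>R0>0. \<forall>R\<ge>R0. ball_mass u R \<le> ennreal (\<delta> * R ^ DIM('a))"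
proof -
  obtain C where C: "C \<ge> 0" "\<And>R. R > 0 \<Longrightarrow> ball_mass u R
     \<le> ennreal (C * R ^ DIM('a)) * weighted_mass R"
    using u_ball_le by auto
  have "(\<lambda>k. weighted_mass (1 + real k)) \<longlonglongrightarrow> (\<integral>\<^sup>+z. 0 \<partial>(lborel :: 'a measure))"
  proof (rule nn_integral_dominated_convergence[where w="\<lambda>z. ennreal (\<bar>f z\<bar> * (1 + norm z) powr (-\<beta>))"])
    show "AE x in lborel. ennreal (\<bar>f x\<bar> * (1 + real k + norm x) powr - \<beta>) \<le> ennreal (\<bar>f x\<bar> * (1 + norm x) powr - \<beta>)" for k
      using \<beta>_bounds by (intro AE_I2 ennreal_leI mult_left_mono powr_mono2') (auto intro!: add_pos_nonneg)
    show "AE x in lborel. (\<lambda>k. ennreal (\<bar>f x\<bar> * (1 + real k + norm x) powr - \<beta>)) \<longlonglongrightarrow> 0"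
    proof (intro AE_I2)
      fix x :: 'a
      have "filterlim (\<lambda>k. (1 + norm x) + real k) at_top sequentially"
        by (intro filterlim_tendsto_add_at_top[OF tendsto_const] filterlim_real_sequentially)
      then have "(\<lambda>k. ((1 + norm x) + real k) powr (-\<beta>)) \<longlonglongrightarrow> 0"
        using \<beta>_bounds by (intro tendsto_neg_powr) auto
      then have "(\<lambda>k. \<bar>f x\<bar> * (1 + real k + norm x) powr (-\<beta>)) \<longlonglongrightarrow> \<bar>f x\<bar> * 0"
        by (intro tendsto_mult tendsto_const) (simp add: add_ac)
      then show "(\<lambda>k. ennreal (\<bar>f x\<bar> * (1 + real k + norm x) powr - \<beta>)) \<longlonglongrightarrow> 0"
        by (simp flip: ennreal_0)
    qed
  qed (use weight_finite in auto)
  then have lim: "(\<lambda>k. weighted_mass (1 + real k)) \<longlonglongrightarrow> 0" by simp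
  \<comment> \<open>The summand 1 in the denominator covers the case C = 0.\<close>
  define e where "e = ennreal (\<delta> / (C + 1))"
  have "0 < e" using assms C by (auto simp: e_def)
  with lim have "eventually (\<lambda>k. weighted_mass (1 + real k) < e) sequentially" by (rule order_tendstoD)
  then obtain k where k: "weighted_mass (1 + real k) < e" by (auto simp: eventually_sequentially)
  show ?thesis
  proof (intro exI conjI allI impI)
    show "0 < 1 + real k" by simp
    fix R assume R: "R \<ge> 1 + real k"
    then have R0: "R > 0" by linarith
    have "weighted_mass R \<le> weighted_mass (1 + real k)"
      using R \<beta>_bounds by (intro nn_integral_mono ennreal_leI mult_left_mono powr_mono2') (auto intro!: add_pos_nonneg)
    then have "weighted_mass R \<le> e" using k by simp
    then have "ennreal (C * R ^ DIM('a)) * weighted_mass R \<le> ennreal (C * R ^ DIM('a)) * ennreal (\<delta> / (C + 1))"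
      unfolding e_def by (rule mult_left_mono) simp
    also have "\<dots> = ennreal (C * R ^ DIM('a) * (\<delta> / (C + 1)))"
      using C R0 by (intro ennreal_mult'[symmetric]) auto
    also have "\<dots> \<le> ennreal (\<delta> * R ^ DIM('a))"
      using C R0 assms by (intro ennreal_leI) (simp add: field_simps)
    finally show "ball_mass u R \<le> ennreal (\<delta> * R ^ DIM('a))"
      using C(2)[OF R0] by (rule order_trans[rotated])
  qed
qed

text \<open>The kernel is symmetric, so Fubini's theorem moves the potential from f to h.
  Boundedness and compact support of h reduce absolute convergence to the finiteness of
  \<open>double_mass\<close>.\<close>

lemma u_duality:
  assumes [measurable]: "h \<in> borel_measurable borel" and hM: "\<And>y. \<bar>h y\<bar> \<le> M" and h0: "\<And>y. y \<notin> ball 0 R \<Longrightarrow> h y = 0"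
    and R: "R > 0"
  shows "(\<integral>y. u y * h y \<partial>lborel) = (\<integral>x. f x * (\<kappa> * (\<integral>y. h y * norm (x - y) powr (-\<beta>) \<partial>lborel)) \<partial>lborel)"
proof -
  have M: "M \<ge> 0" using hM[of 0] by linarith
  define F where "F x y = f x * (h y * norm (x - y) powr (-\<beta>))" for x y
  have [measurable]: "case_prod F \<in> borel_measurable (lborel \<Otimes>\<^sub>M lborel)"
    unfolding F_def[abs_def] by measurable
  have "integrable (lborel \<Otimes>\<^sub>M lborel) (case_prod F)"
  proof (rule integrableI_bounded)
    have "(\<integral>\<^sup>+z. ennreal (norm (case_prod F z)) \<partial>(lborel \<Otimes>\<^sub>M lborel)) = (\<integral>\<^sup>+x. \<integral>\<^sup>+y. ennreal \<bar>F x y\<bar> \<partial>lborel \<partial>lborel)"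
      by (subst lborel.nn_integral_fst[symmetric]) auto
    also have "\<dots> \<le> (\<integral>\<^sup>+x. \<integral>\<^sup>+y. ennreal M * (ennreal \<bar>f x\<bar> * (ennreal (norm (x - y) powr (-\<beta>)) * indicator (ball 0 R) y)) \<partial>lborel \<partial>lborel)"
    proof (intro nn_integral_mono)
      fix x y :: 'a
      have "\<bar>F x y\<bar> \<le> M * (\<bar>f x\<bar> * norm (x - y) powr (-\<beta>))"
        using mult_right_mono[OF hM, of "\<bar>f x\<bar> * norm (x - y) powr (-\<beta>)" y] by (simp add: F_def abs_mult mult_ac)
      then show "ennreal \<bar>F x y\<bar> \<le> ennreal M * (ennreal \<bar>f x\<bar> * (ennreal (norm (x - y) powr (-\<beta>)) * indicator (ball 0 R) y))"
        using M h0[of y] by (cases "y \<in> ball 0 R") (auto simp: F_def ennreal_leI simp flip: ennreal_mult')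
    qed
    also have "\<dots> = ennreal M * double_mass R"
      by (simp add: nn_integral_cmult)
    also have "\<dots> < \<infinity>"
    proof -
      obtain C where "double_mass R
          \<le> ennreal (C * R ^ DIM('a)) * weighted_mass R"
        using kernel_double_integral_le R by blast
      also have "\<dots> < \<infinity>" using weight_R[OF R] by (simp add: ennreal_mult_less_top)
      finally show ?thesis by (simp add: ennreal_mult_less_top)
    qed
    finally show "(\<integral>\<^sup>+z. ennreal (norm (case_prod F z)) \<partial>(lborel \<Otimes>\<^sub>M lborel)) < \<infinity>" .
  qed simp
  then have "(\<integral>y. (\<integral>x. F x y \<partial>lborel) \<partial>lborel) = (\<integral>x. (\<integral>y. F x y \<partial>lborel) \<partial>lborel)"
    by (rule lborel_pair.Fubini_integral)
  then have eq: "\<kappa> * (\<integral>y. (\<integral>x. F x y \<partial>lborel) \<partial>lborel) = \<kappa> * (\<integral>x. (\<integral>y. F x y \<partial>lborel) \<partial>lborel)" by simp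
  have 1: "u y * h y = \<kappa> * (\<integral>x. F x y \<partial>lborel)" for y
  proof -
    have "(\<integral>x. F x y \<partial>lborel) = (\<integral>x. h y * (f x * norm (y - x) powr (-\<beta>)) \<partial>lborel)"
      by (simp add: F_def mult_ac norm_minus_commute)
    also have "\<dots> = h y * (\<integral>x. f x * norm (y - x) powr (-\<beta>) \<partial>lborel)" by simp
    finally show ?thesis by (simp add: u_eq)
  qed
  have 2: "f x * (\<kappa> * (\<integral>y. h y * norm (x - y) powr (-\<beta>) \<partial>lborel)) = \<kappa> * (\<integral>y. F x y \<partial>lborel)" for x
    by (simp add: F_def)
  show ?thesis unfolding 1 2 using eq by simp
qed

end

section \<open>Bump functions and mollification\<close>

text \<open>The complement of the closed ball is open, so h is locally 0 there. Returning from the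
  closed ball to an open one costs the radius \<open>R + 1\<close> that recurs for supports of
  derivatives.\<close>

lemma has_derivative_zero_outside:
  fixes h :: "'a::real_normed_vector \<Rightarrow> 'b::real_normed_vector"
  assumes "(h has_derivative h') (at x)" "\<And>y. y \<notin> ball 0 R \<Longrightarrow> h y = 0" "x \<notin> cball 0 R"
  shows "h' v = 0"
proof -
  have "((\<lambda>_. 0) has_derivative h') (at x)"
    by (rule has_derivative_transform_within_open[OF assms(1), of "- cball 0 R"]) (use assms in auto)
  then have "h' = (\<lambda>_. 0)"
    by (rule has_derivative_unique) (rule has_derivative_const)
  then show ?thesis by simp
qed

lemma bounded_continuous_support:
  fixes g :: "'a::euclidean_space \<Rightarrow> 'b::real_normed_vector"
  assumes "continuous_on UNIV g" "\<And>y. y \<notin> cball 0 R \<Longrightarrow> g y = 0"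
  shows "\<exists>M>0. \<forall>x. norm (g x) \<le> M"
proof -
  have "compact (g ` cball 0 R)"
    by (intro compact_continuous_image continuous_on_subset[OF assms(1)]) auto
  then obtain B where B: "B > 0" "\<And>z. z \<in> g ` cball 0 R \<Longrightarrow> norm z \<le> B"
    using compact_imp_bounded bounded_pos by metis
  then have "norm (g x) \<le> B" for x
    using assms(2)[of x] by (cases "x \<in> cball 0 R") auto
  then show ?thesis using B(1) by auto
qed

lemma integrable_continuous_support:
  fixes g :: "'a::euclidean_space \<Rightarrow> 'b::{banach, second_countable_topology}"
  assumes "continuous_on UNIV g" "\<And>y. y \<notin> cball 0 R \<Longrightarrow> g y = 0"
  shows "integrable lborel g"
proof -
  have "integrable lborel (\<lambda>x. indicator (cball 0 R) x *\<^sub>R g x)"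
    by (intro borel_integrable_compact continuous_on_subset[OF assms(1)]) auto
  also have "(\<lambda>x. indicator (cball 0 R) x *\<^sub>R g x) = g"
    using assms(2) by (auto simp: indicator_def fun_eq_iff)
  finally show ?thesis .
qed

lemma has_derivative_support_Lipschitz:
  fixes \<phi> :: "'a::euclidean_space \<Rightarrow> 'b::real_normed_vector"
  assumes der: "\<And>x. (\<phi> has_derivative \<phi>' x) (at x)" and cont: "\<And>v. continuous_on UNIV (\<lambda>x. \<phi>' x v)"
    and supp: "\<And>y. y \<notin> ball 0 R \<Longrightarrow> \<phi> y = 0"
  shows "\<exists>L\<ge>0. (\<forall>x v. norm (\<phi>' x v) \<le> L * norm v) \<and> (\<forall>x y. norm (\<phi> x - \<phi> y) \<le> L * norm (x - y))"
proof -
  have "\<exists>M>0. \<forall>x. norm (\<phi>' x i) \<le> M" for i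
    by (rule bounded_continuous_support[OF cont, where R=R]) (rule has_derivative_zero_outside[OF der supp])
  then obtain M where M: "\<And>i. M i > 0" "\<And>i x. norm (\<phi>' x i) \<le> M i" by metis
  define L where "L = (\<Sum>i\<in>Basis. M i)"
  have L: "L \<ge> 0" unfolding L_def using M by (intro sum_nonneg) (auto intro: less_imp_le)
  have b: "norm (\<phi>' x v) \<le> L * norm v" for x v
  proof -
    have lin: "linear (\<phi>' x)" using der by (rule has_derivative_linear)
    have "\<phi>' x v = \<phi>' x (\<Sum>i\<in>Basis. (v \<bullet> i) *\<^sub>R i)" by (simp add: euclidean_representation)
    also have "\<dots> = (\<Sum>i\<in>Basis. (v \<bullet> i) *\<^sub>R \<phi>' x i)"
      by (simp add: linear_sum[OF lin] linear_scale[OF lin])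
    also have "norm \<dots> \<le> (\<Sum>i\<in>Basis. norm v * M i)"
      by (intro sum_norm_le) (auto intro!: mult_mono M Basis_le_norm)
    finally show ?thesis by (simp add: L_def sum_distrib_left mult.commute)
  qed
  moreover have "norm (\<phi> x - \<phi> y) \<le> L * norm (x - y)" for x y
    by (rule differentiable_bound[of UNIV]) (auto intro!: onorm_le b der)
  ultimately show ?thesis using L by blast
qed

section \<open>Calculus of the classes C^k\<close>

lemma Ck_SucD: "Ck (Suc k) f \<Longrightarrow> Ck k f"
proof (induction k arbitrary: f)
  case 0
  then show ?case by (auto intro!: continuous_at_imp_continuous_on differentiable_imp_continuous_within)
next
  case (Suc k)
  then show ?case by (metis Ck.simps(2))
qed

lemma Ck_imp_continuous: "Ck k f \<Longrightarrow> continuous_on UNIV f"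
proof (induction k)
  case (Suc k)
  then show ?case using Ck_SucD by blast
qed simp

lemma Ck_SucI:
  assumes der: "\<And>x. (f has_derivative f' x) (at x)" and "\<And>v. Ck k (\<lambda>x. f' x v)"
  shows "Ck (Suc k) f"
proof -
  have "frechet_derivative f (at x) = f' x" for x
    using frechet_derivative_at[OF der] by simp
  with assms show ?thesis by (auto simp: differentiable_def)
qed

lemma Ck_SucE:
  assumes "Ck (Suc k) f"
  obtains f' where "\<And>x. (f has_derivative f' x) (at x)" "\<And>v. Ck k (\<lambda>x. f' x v)"
  using assms that[of "\<lambda>x. frechet_derivative f (at x)"] by (simp add: frechet_derivative_works)

lemma Ck_const: "Ck k (\<lambda>_. c)"
  by (induction k arbitrary: c) (auto intro!: Ck_SucI[where f'="\<lambda>_ _. 0"] simp del: Ck.simps(2))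

lemma Ck_add: "Ck k f \<Longrightarrow> Ck k g \<Longrightarrow> Ck k (\<lambda>x. f x + g x)"
proof (induction k arbitrary: f g)
  case 0
  then show ?case by (auto intro: continuous_intros)
next
  case (Suc k)
  obtain f' where f': "\<And>x. (f has_derivative f' x) (at x)" "\<And>v. Ck k (\<lambda>x. f' x v)" using Ck_SucE[OF Suc.prems(1)] by metis
  obtain g' where g': "\<And>x. (g has_derivative g' x) (at x)" "\<And>v. Ck k (\<lambda>x. g' x v)" using Ck_SucE[OF Suc.prems(2)] by metis
  show ?case by (rule Ck_SucI[OF has_derivative_add[OF f'(1) g'(1)]]) (rule Suc.IH[OF f'(2) g'(2)])
qed

lemma Ck_mult:
  fixes f g :: "'a::real_normed_vector \<Rightarrow> real"
  shows "Ck k f \<Longrightarrow> Ck k g \<Longrightarrow> Ck k (\<lambda>x. f x * g x)"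
proof (induction k arbitrary: f g)
  case 0
  then show ?case by (auto intro: continuous_intros)
next
  case (Suc k)
  obtain f' where f': "\<And>x. (f has_derivative f' x) (at x)" "\<And>v. Ck k (\<lambda>x. f' x v)" using Ck_SucE[OF Suc.prems(1)] by metis
  obtain g' where g': "\<And>x. (g has_derivative g' x) (at x)" "\<And>v. Ck k (\<lambda>x. g' x v)" using Ck_SucE[OF Suc.prems(2)] by metis
  show ?case
    by (rule Ck_SucI[OF has_derivative_mult[OF f'(1) g'(1)]], rule Ck_add; rule Suc.IH)
       (auto intro: f' g' Ck_SucD Suc.prems)
qed

lemma Ck_inner_left: "Ck k (\<lambda>x. x \<bullet> v)"
  by (cases k) (auto intro!: continuous_intros Ck_SucI[where f'="\<lambda>x h. h \<bullet> v"] Ck_const derivative_eq_intros simp del: Ck.simps(2))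

text \<open>The derivatives of \<open>exp (- 1 / t)\<close> are combinations of the functions \<open>exp (- 1 / t) / t ^ m\<close>.\<close>

definition flat_exp :: "nat \<Rightarrow> real \<Rightarrow> real" where
  "flat_exp m t = (if t > 0 then exp (- (1 / t)) / t ^ m else 0)"

lemma flat_exp_nonneg: "flat_exp m t \<ge> 0"
  by (simp add: flat_exp_def)

lemma flat_exp_tendsto_0: "(flat_exp m \<longlongrightarrow> 0) (at 0)"
proof -
  have "((\<lambda>x. x ^ m / exp x) \<longlongrightarrow> (0::real)) at_top" by (rule tendsto_power_div_exp_0)
  then have "((\<lambda>x. flat_exp m (inverse x)) \<longlongrightarrow> 0) at_top"
    by (rule Lim_transform_eventually)
       (auto intro!: eventually_mono[OF eventually_gt_at_top[of 0]] simp: flat_exp_def exp_minus field_simps)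
  then have "(flat_exp m \<longlongrightarrow> 0) (at_right 0)" by (simp add: filterlim_at_right_to_top)
  moreover have "(flat_exp m \<longlongrightarrow> 0) (at_left 0)"
    by (rule Lim_transform_eventually[OF tendsto_const])
       (auto simp: eventually_at_filter flat_exp_def)
  ultimately show ?thesis by (rule filterlim_split_at[rotated])
qed

text \<open>The family is closed under differentiation. The delicate point is t = 0, where the
  difference quotient of \<open>flat_exp m\<close> is exactly \<open>flat_exp (m + 1)\<close>, whose
  limit is already known.\<close>

lemma flat_exp_deriv:
  "(flat_exp m has_field_derivative flat_exp (m + 2) t - real m * flat_exp (m + 1) t) (at t)"
proof (cases t "0::real" rule: linorder_cases)
  case less
  show ?thesis
    by (rule DERIV_cong, rule has_field_derivative_transform_within_open[of "\<lambda>_. 0" _ _ "{..<0}"])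
       (use less in \<open>auto simp: flat_exp_def\<close>)
next
  case equal
  have "((\<lambda>h. (flat_exp m (0 + h) - flat_exp m 0) / h) \<longlongrightarrow> 0) (at 0)"
    by (rule Lim_transform_eventually[OF flat_exp_tendsto_0[of "m + 1"]])
       (auto simp: eventually_at_filter flat_exp_def)
  then show ?thesis using equal by (simp add: DERIV_def flat_exp_def)
next
  case greater
  have "((\<lambda>t. exp (- (1 / t)) / t ^ m) has_field_derivative
      (exp (- (1 / t)) * (1 / t ^ 2)) / t ^ m - real m * (exp (- (1 / t)) / t ^ (m + 1))) (at t)"
  proof (rule DERIV_cong)
    show "((\<lambda>t. exp (- (1 / t)) / t ^ m) has_field_derivative
      (exp (- (1 / t)) * (1 / t ^ 2) * t ^ m - exp (- (1 / t)) * (real m * t ^ (m - Suc 0))) / (t ^ m * t ^ m)) (at t)"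
      using greater
      by (intro DERIV_divide DERIV_pow) (auto intro!: derivative_eq_intros simp: power2_eq_square)
  qed (use greater in \<open>cases m; simp add: field_simps power2_eq_square\<close>)
  then have "(flat_exp m has_field_derivative
      (exp (- (1 / t)) * (1 / t ^ 2)) / t ^ m - real m * (exp (- (1 / t)) / t ^ (m + 1))) (at t)"
    by (rule has_field_derivative_transform_within_open[of _ _ _ "{0<..}"]) (use greater in \<open>auto simp: flat_exp_def\<close>)
  then show ?thesis using greater by (simp add: flat_exp_def power_add power2_eq_square mult_ac)
qed

lemma continuous_on_flat_exp: "continuous_on S (flat_exp m)"
  using flat_exp_deriv by (intro DERIV_continuous_on) (auto intro: DERIV_subset)

lemma flat_exp_borel [measurable]: "flat_exp m \<in> borel_measurable borel"
  by (intro borel_measurable_continuous_onI continuous_on_flat_exp)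

text \<open>The induction runs over all m at once, since a derivative involves the indices m + 1 and
  m + 2. The squared norm, unlike the norm, is smooth at the origin.\<close>

lemma Ck_flat_exp_norm: "Ck k (\<lambda>x::'a::euclidean_space. flat_exp m (c - (norm x)\<^sup>2))"
proof (induction k arbitrary: m)
  case 0
  then show ?case by (auto intro!: continuous_intros continuous_on_compose2[OF continuous_on_flat_exp])
next
  case (Suc k)
  show ?case
  proof (rule Ck_SucI)
    fix x :: 'a
    have 1: "((\<lambda>x. c - (norm x)\<^sup>2) has_derivative (\<lambda>h. - 2 * (x \<bullet> h))) (at x)"
      unfolding power2_norm_eq_inner by (auto intro!: derivative_eq_intros simp: inner_commute)
    from has_derivative_compose[OF 1 flat_exp_deriv[of m, unfolded has_field_derivative_def]]
    show "((\<lambda>x. flat_exp m (c - (norm x)\<^sup>2)) has_derivative 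
       (\<lambda>h. (flat_exp (m + 2) (c - (norm x)\<^sup>2) + - real m * flat_exp (m + 1) (c - (norm x)\<^sup>2)) * (- 2 * (x \<bullet> h)))) (at x)"
      by simp
  next
    fix v :: 'a
    show "Ck k (\<lambda>x. (flat_exp (m + 2) (c - (norm x)\<^sup>2) + - real m * flat_exp (m + 1) (c - (norm x)\<^sup>2)) * (- 2 * (x \<bullet> v)))"
      by (intro Ck_mult Ck_add Ck_const Ck_inner_left Suc.IH)
  qed
qed

text \<open>The classical bump function exp (- 1 / (r^2 - |x|^2)), extended by 0 outside the ball of
  radius r.\<close>

definition bump :: "real \<Rightarrow> 'a::euclidean_space \<Rightarrow> real" where
  "bump r x = flat_exp 0 (r\<^sup>2 - (norm x)\<^sup>2)"

lemma Ck_bump: "Ck k (bump r)"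
  unfolding bump_def[abs_def] by (rule Ck_flat_exp_norm)

lemma bump_nonneg: "bump r x \<ge> 0"
  by (simp add: bump_def flat_exp_nonneg)

lemma bump_minus: "bump r (- x) = bump r x"
  by (simp add: bump_def)

lemma bump_pos: "norm x < r \<Longrightarrow> bump r x > 0"
  using power_strict_mono[of "norm x" r 2] by (auto simp: bump_def flat_exp_def)

lemma bump_outside: "r > 0 \<Longrightarrow> x \<notin> ball 0 r \<Longrightarrow> bump r x = 0"
  using power_mono[of r "norm x" 2] by (auto simp: bump_def flat_exp_def not_less)

lemma continuous_on_bump: "continuous_on UNIV (bump r)"
  by (rule Ck_imp_continuous[OF Ck_bump])

lemma bump_borel [measurable]: "bump r \<in> borel_measurable borel"
  by (intro borel_measurable_continuous_onI continuous_on_bump)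

lemma bump_integrable: "r > 0 \<Longrightarrow> integrable lborel (bump r)"
  by (rule integrable_continuous_support[OF continuous_on_bump, of r]) (auto intro: bump_outside)

lemma bump_integral_pos: "r > 0 \<Longrightarrow> 0 < (\<integral>x. bump r (x::'a::euclidean_space) \<partial>lborel)"
proof -
  assume r: "r > 0"
  have "\<not> (AE x in lborel. bump r (x::'a) = 0)"
  proof
    assume "AE x in lborel. bump r (x::'a) = 0"
    then have "AE x in lborel. x \<notin> ball (0::'a) r"
      by eventually_elim (use bump_pos in \<open>force simp: less_le\<close>)
    then have "ball (0::'a) r \<in> null_sets lborel" by (subst AE_iff_null_sets) auto
    then have "emeasure lborel (ball (0::'a) r) = 0" by auto
    then show False using r unit_ball_vol_pos[of "real DIM('a)"] by (simp add: emeasure_ball)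
  qed
  then have "(\<integral>x. bump r (x::'a) \<partial>lborel) \<noteq> 0"
    using integral_nonneg_eq_0_iff_AE[OF bump_integrable[OF r]] bump_nonneg by auto
  moreover have "(\<integral>x. bump r (x::'a) \<partial>lborel) \<ge> 0" by (simp add: bump_nonneg)
  ultimately show ?thesis by simp
qed

section \<open>Convolution of a smooth kernel with a locally integrable function\<close>

definition locally_integrable :: "('a::euclidean_space \<Rightarrow> 'b::{banach, second_countable_topology}) \<Rightarrow> bool" where
  "locally_integrable g \<longleftrightarrow> g \<in> borel_measurable borel \<and> (\<forall>R. integrable lborel (\<lambda>y. indicator (ball 0 R) y *\<^sub>R g y))"

definition conv :: "('a::euclidean_space \<Rightarrow> real) \<Rightarrow> ('a \<Rightarrow> 'b::{banach, second_countable_topology}) \<Rightarrow> 'a \<Rightarrow> 'b" where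
  "conv \<rho> g x = (\<integral>y. \<rho> (x - y) *\<^sub>R g y \<partial>lborel)"

lemma locally_integrable_borel [measurable_dest]: "locally_integrable g \<Longrightarrow> g \<in> borel_measurable borel"
  by (simp add: locally_integrable_def)

lemma locally_integrable_const: "locally_integrable (\<lambda>_::'a::euclidean_space. c::real)"
  unfolding locally_integrable_def
proof (intro conjI allI)
  show "integrable lborel (\<lambda>y::'a. indicator (ball 0 R) y *\<^sub>R c)" for R
    by (intro integrable_scaleR_left integrable_real_indicator emeasure_bounded_finite) auto
qed simp

text \<open>Here \<rho> stands for a kernel already reflected and translated, hence its support
  around x.\<close>

lemma conv_integrable:
  assumes g: "locally_integrable g" and [measurable]: "\<rho> \<in> borel_measurable borel"
    and "\<And>z. \<bar>\<rho> z\<bar> \<le> M" "\<And>z. z \<notin> ball x R \<Longrightarrow> \<rho> z = 0"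
  shows "integrable lborel (\<lambda>y. \<rho> y *\<^sub>R g y)"
    and "norm (\<integral>y. \<rho> y *\<^sub>R g y \<partial>lborel) \<le> M * (\<integral>y. norm (indicator (ball 0 (norm x + R)) y *\<^sub>R g y) \<partial>lborel)"
proof -
  let ?n = "\<lambda>y. norm (indicator (ball 0 (norm x + R)) y *\<^sub>R g y)"
  have [measurable]: "g \<in> borel_measurable borel" using g by (rule locally_integrable_borel)
  have M: "M \<ge> 0" using assms(3)[of 0] by linarith
  have gi: "integrable lborel (\<lambda>y. ?n y)"
    using g by (intro integrable_norm) (simp add: locally_integrable_def)
  have b: "norm (\<rho> y *\<^sub>R g y) \<le> M * ?n y" for y
  proof (cases "y \<in> ball x R")
    case True
    then have "norm y < norm x + R" using norm_triangle_sub[of y x] by (simp add: dist_norm norm_minus_commute)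
    then show ?thesis using assms(3)[of y] by (auto intro!: mult_right_mono)
  qed (use assms(4) M in auto)
  show int: "integrable lborel (\<lambda>y. \<rho> y *\<^sub>R g y)"
    by (rule Bochner_Integration.integrable_bound[OF integrable_mult_right[OF gi, of M]])
       (use b in \<open>auto intro: order_trans[OF _ abs_ge_self]\<close>)
  have "norm (\<integral>y. \<rho> y *\<^sub>R g y \<partial>lborel) \<le> (\<integral>y. norm (\<rho> y *\<^sub>R g y) \<partial>lborel)"
    by (rule integral_norm_bound)
  also have "\<dots> \<le> (\<integral>y. M * ?n y \<partial>lborel)"
    by (rule integral_mono[OF integrable_norm[OF int] integrable_mult_right[OF gi] b])
  also have "\<dots> = M * (\<integral>y. ?n y \<partial>lborel)" by simp
  finally show "norm (\<integral>y. \<rho> y *\<^sub>R g y \<partial>lborel) \<le> \<dots>" .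
qed

lemma conv_dominated_convergence:
  assumes g: "locally_integrable g" and [measurable]: "\<And>n. r n \<in> borel_measurable borel"
    and bound: "\<And>n y. \<bar>r n y\<bar> \<le> M" and supp: "\<And>n y. y \<notin> ball 0 R \<Longrightarrow> r n y = 0"
    and lim: "\<And>y. (\<lambda>n. r n y) \<longlonglongrightarrow> r' y"
  shows "(\<lambda>n. \<integral>y. r n y *\<^sub>R g y \<partial>lborel) \<longlonglongrightarrow> (\<integral>y. r' y *\<^sub>R g y \<partial>lborel)"
proof (rule integral_dominated_convergence[where w="\<lambda>y. M * norm (indicator (ball 0 R) y *\<^sub>R g y)"])
  have [measurable]: "g \<in> borel_measurable borel" using g by (rule locally_integrable_borel)
  have [measurable]: "r' \<in> borel_measurable borel"
    by (rule borel_measurable_LIMSEQ_metric[OF _ lim]) measurable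
  show "(\<lambda>y. r' y *\<^sub>R g y) \<in> borel_measurable lborel" "(\<lambda>y. r n y *\<^sub>R g y) \<in> borel_measurable lborel" for n
    by measurable
  show "integrable lborel (\<lambda>y. M * norm (indicator (ball 0 R) y *\<^sub>R g y))"
    using g by (intro integrable_mult_right integrable_norm) (simp add: locally_integrable_def)
  show "AE y in lborel. (\<lambda>n. r n y *\<^sub>R g y) \<longlonglongrightarrow> r' y *\<^sub>R g y"
    by (intro AE_I2 tendsto_scaleR lim tendsto_const)
  have M: "M \<ge> 0" using bound[of 0 0] by linarith
  show "AE y in lborel. norm (r n y *\<^sub>R g y) \<le> M * norm (indicator (ball 0 R) y *\<^sub>R g y)" for n
  proof (intro AE_I2)
    fix y
    show "norm (r n y *\<^sub>R g y) \<le> M * norm (indicator (ball 0 R) y *\<^sub>R g y)"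
      by (cases "y \<in> ball 0 R") (use bound supp M in \<open>auto intro!: mult_right_mono\<close>)
  qed
qed

lemma continuous_on_conv:
  assumes g: "locally_integrable g" and cont: "continuous_on UNIV \<rho>" and supp: "\<And>z. z \<notin> ball 0 R \<Longrightarrow> \<rho> z = 0"
  shows "continuous_on UNIV (conv \<rho> g)"
proof (intro continuous_at_imp_continuous_on ballI continuous_at_sequentiallyI)
  fix x :: 'a and X assume X: "X \<longlonglongrightarrow> x"
  have [measurable]: "\<rho> \<in> borel_measurable borel" using cont by (rule borel_measurable_continuous_onI)
  obtain K where K: "\<And>n. norm (X n) \<le> K" using X by (metis convergent_def convergent_imp_Bseq Bseq_def)
  obtain M where M: "\<And>z. \<bar>\<rho> z\<bar> \<le> M" using bounded_continuous_support[OF cont, of R] supp by auto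
  show "(\<lambda>n. conv \<rho> g (X n)) \<longlonglongrightarrow> conv \<rho> g x"
    unfolding conv_def
  proof (rule conv_dominated_convergence[OF g, where M=M and R="K + R"])
    show "\<rho> (X n - y) = 0" if "y \<notin> ball 0 (K + R)" for n y
      by (rule supp) (use that K[of n] norm_triangle_ineq2[of y "X n"] in \<open>auto simp: norm_minus_commute\<close>)
    show "(\<lambda>n. \<rho> (X n - y)) \<longlonglongrightarrow> \<rho> (x - y)" for y
      using cont by (intro continuous_on_tendsto_compose[OF cont] tendsto_intros X) auto
  qed (use M in auto)
qed

text \<open>Smoothness comes from the kernel alone. The first order remainders of \<rho>, divided by
  the increment, are bounded by 2 L, tend to 0 at each point and live in a common ball, so they
  converge under the integral against a merely locally integrable g.\<close>

lemma conv_has_derivative: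
  assumes g: "locally_integrable g" and der: "\<And>x. (\<rho> has_derivative \<rho>' x) (at x)"
    and cont: "\<And>v. continuous_on UNIV (\<lambda>x. \<rho>' x v)" and supp: "\<And>z. z \<notin> ball 0 R \<Longrightarrow> \<rho> z = 0"
  shows "(conv \<rho> g has_derivative (\<lambda>v. conv (\<lambda>z. \<rho>' z v) g x)) (at x)"
proof -
  have rcont: "continuous_on UNIV \<rho>"
    using der by (auto intro!: continuous_at_imp_continuous_on has_derivative_continuous)
  have [measurable]: "\<rho> \<in> borel_measurable borel" "\<And>v. (\<lambda>x. \<rho>' x v) \<in> borel_measurable borel"
    using rcont cont by (auto intro: borel_measurable_continuous_onI)
  obtain L where L: "L \<ge> 0" "\<And>x v. \<bar>\<rho>' x v\<bar> \<le> L * norm v" "\<And>x y. \<bar>\<rho> x - \<rho> y\<bar> \<le> L * norm (x - y)"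
    using has_derivative_support_Lipschitz[where R=R, OF der cont supp] by auto
  obtain M where M: "\<And>z. \<bar>\<rho> z\<bar> \<le> M" using bounded_continuous_support[OF rcont, of R] supp by auto
  have dz: "\<rho>' z v = 0" if "z \<notin> ball 0 (R + 1)" for z v
    by (rule has_derivative_zero_outside[OF der supp]) (use that in auto)
  have out: "x' - y \<notin> ball 0 S" if "y \<notin> ball x' S" for x' y :: 'a and S
    using that by (auto simp: dist_norm norm_minus_commute)
  have I0: "integrable lborel (\<lambda>y. \<rho> (x' - y) *\<^sub>R g y)" for x'
    by (rule conv_integrable[OF g, where M=M and R=R and x=x']) (use M supp out in auto)
  have I1: "integrable lborel (\<lambda>y. \<rho>' (x - y) v *\<^sub>R g y)" for v
    by (rule conv_integrable[OF g, where M="L * norm v" and R="R + 1" and x=x]) (use L dz out in auto)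
  have lin: "linear (\<rho>' z)" for z using der by (rule has_derivative_linear)
  show ?thesis unfolding has_derivative_at
  proof
    show "bounded_linear (\<lambda>v. conv (\<lambda>z. \<rho>' z v) g x)"
    proof (rule bounded_linear_intro)
      show "conv (\<lambda>z. \<rho>' z (a + b)) g x = conv (\<lambda>z. \<rho>' z a) g x + conv (\<lambda>z. \<rho>' z b) g x" for a b
        unfolding conv_def by (simp add: linear_add[OF lin] scaleR_left_distrib I1)
      show "conv (\<lambda>z. \<rho>' z (c *\<^sub>R a)) g x = c *\<^sub>R conv (\<lambda>z. \<rho>' z a) g x" for c a
        unfolding conv_def by (simp add: linear_scale[OF lin] flip: scaleR_scaleR)
      show "norm (conv (\<lambda>z. \<rho>' z v) g x) \<le> norm v * (L * (\<integral>y. norm (indicator (ball 0 (norm x + (R + 1))) y *\<^sub>R g y) \<partial>lborel))" for v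
        using conv_integrable(2)[OF g, where M="L * norm v" and R="R + 1" and x=x and \<rho>="\<lambda>y. \<rho>' (x - y) v"] L dz out
        unfolding conv_def by (simp add: mult_ac)
    qed
    show "(\<lambda>h. norm (conv \<rho> g (x + h) - conv \<rho> g x - conv (\<lambda>z. \<rho>' z h) g x) / norm h) \<midarrow>0\<rightarrow> 0"
      unfolding tendsto_at_iff_sequentially o_def
    proof (intro allI impI)
      fix X :: "nat \<Rightarrow> 'a" assume X0: "\<forall>i. X i \<in> UNIV - {0}" and X: "X \<longlonglongrightarrow> 0"
      obtain K where K: "\<And>n. norm (X n) \<le> K" using X by (metis convergent_def convergent_imp_Bseq Bseq_def)
      have K0: "K \<ge> 0" using K[of 0] norm_ge_zero[of "X 0"] by linarith
      define r where "r n y = (\<rho> (x + X n - y) - \<rho> (x - y) - \<rho>' (x - y) (X n)) / norm (X n)" for n y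
      have "(\<lambda>n. \<integral>y. r n y *\<^sub>R g y \<partial>lborel) \<longlonglongrightarrow> (\<integral>y. 0 *\<^sub>R g y \<partial>lborel)"
      \<comment> \<open>Both translates of \<rho> and the derivative have to vanish outside the
        ball: K bounds the increments, and the derivative accounts for R + 1.\<close>
      proof (rule conv_dominated_convergence[OF g, where M="2 * L" and R="norm x + K + R + 1"])
        show "r n \<in> borel_measurable borel" for n unfolding r_def[abs_def] by measurable
        show "\<bar>r n y\<bar> \<le> 2 * L" for n y
        proof -
          have "\<bar>\<rho> (x + X n - y) - \<rho> (x - y)\<bar> \<le> L * norm (X n)" using L(3)[of "x + X n - y" "x - y"] by simp
          then have "\<bar>\<rho> (x + X n - y) - \<rho> (x - y) - \<rho>' (x - y) (X n)\<bar> \<le> 2 * L * norm (X n)"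
            using L(2)[of "x - y" "X n"] by linarith
          then show ?thesis using X0 by (simp add: r_def abs_divide divide_le_eq)
        qed
        show "r n y = 0" if "y \<notin> ball 0 (norm x + K + R + 1)" for n y
        proof -
          have "norm y \<le> norm (x - y) + norm x" "norm y \<le> norm (x + X n - y) + norm (x + X n)"
            using norm_triangle_sub[of y x] norm_triangle_sub[of y "x + X n"] by (simp_all add: norm_minus_commute)
          moreover have "norm (x + X n) \<le> norm x + K" using norm_triangle_ineq[of x "X n"] K[of n] by linarith
          moreover have "norm y \<ge> norm x + K + R + 1" using that by simp
          ultimately have "norm (x - y) \<ge> R + 1" "norm (x + X n - y) \<ge> R"
            using K0 by linarith+
          then show ?thesis unfolding r_def using supp[of "x - y"] supp[of "x + X n - y"] dz[of "x - y"] by simp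
        qed
        show "(\<lambda>n. r n y) \<longlonglongrightarrow> 0" for y
        proof -
          have "(\<lambda>h. norm (\<rho> (x - y + h) - \<rho> (x - y) - \<rho>' (x - y) h) / norm h) \<midarrow>0\<rightarrow> 0"
            using der[of "x - y"] by (simp add: has_derivative_at)
          then have "(\<lambda>n. norm (\<rho> (x - y + X n) - \<rho> (x - y) - \<rho>' (x - y) (X n)) / norm (X n)) \<longlonglongrightarrow> 0"
            unfolding tendsto_at_iff_sequentially o_def using X0 X by blast
          then have "(\<lambda>n. \<bar>r n y\<bar>) \<longlonglongrightarrow> 0" by (simp add: r_def abs_divide algebra_simps)
          then show ?thesis by (simp add: tendsto_rabs_zero_iff)
        qed
      qed
      then have "(\<lambda>n. norm (\<integral>y. r n y *\<^sub>R g y \<partial>lborel)) \<longlonglongrightarrow> 0"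
        by (simp add: tendsto_norm_zero_iff)
      moreover have "norm (\<integral>y. r n y *\<^sub>R g y \<partial>lborel) =
          norm (conv \<rho> g (x + X n) - conv \<rho> g x - conv (\<lambda>z. \<rho>' z (X n)) g x) / norm (X n)" for n
      proof -
        have "(\<lambda>y. r n y *\<^sub>R g y) = (\<lambda>y. inverse (norm (X n)) *\<^sub>R
           (\<rho> (x + X n - y) *\<^sub>R g y - \<rho> (x - y) *\<^sub>R g y - \<rho>' (x - y) (X n) *\<^sub>R g y))"
          by (auto simp: r_def fun_eq_iff divide_inverse scaleR_left_diff_distrib[symmetric] mult.commute)
        then have "(\<integral>y. r n y *\<^sub>R g y \<partial>lborel) = inverse (norm (X n)) *\<^sub>R
           (conv \<rho> g (x + X n) - conv \<rho> g x - conv (\<lambda>z. \<rho>' z (X n)) g x)"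
          unfolding conv_def by (simp add: I0 I1)
        then show ?thesis by (simp add: divide_inverse mult.commute)
      qed
      ultimately show "(\<lambda>n. norm (conv \<rho> g (x + X n) - conv \<rho> g x - conv (\<lambda>z. \<rho>' z (X n)) g x) / norm (X n)) \<longlonglongrightarrow> 0"
        by simp
    qed
  qed
qed

lemma Ck_conv:
  assumes g: "locally_integrable g"
  shows "Ck k \<rho> \<Longrightarrow> (\<And>z. z \<notin> ball 0 R \<Longrightarrow> \<rho> z = 0) \<Longrightarrow> Ck k (conv \<rho> g)"
proof (induction k arbitrary: \<rho> R)
  case 0
  then show ?case using continuous_on_conv[OF g, of \<rho> R] by simp
next
  case (Suc k)
  obtain \<rho>' where \<rho>': "\<And>x. (\<rho> has_derivative \<rho>' x) (at x)" "\<And>v. Ck k (\<lambda>x. \<rho>' x v)"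
    using Ck_SucE[OF Suc.prems(1)] by metis
  show ?case
  proof (rule Ck_SucI)
    show "(conv \<rho> g has_derivative (\<lambda>v. conv (\<lambda>z. \<rho>' z v) g x)) (at x)" for x
      by (rule conv_has_derivative[OF g \<rho>'(1) Ck_imp_continuous[OF \<rho>'(2)] Suc.prems(2)])
    show "Ck k (conv (\<lambda>z. \<rho>' z v) g)" for v
      by (rule Suc.IH[OF \<rho>'(2), of "R + 1"])
         (rule has_derivative_zero_outside[OF \<rho>'(1) Suc.prems(2)], auto)
  qed
qed

section \<open>The fractional divergence as a Riesz potential\<close>

text \<open>The convolution of \<open>h\<close> with the constant \<open>1\<close> is constant, and \<open>\<integral> \<partial>\<^sub>v h\<close> is its derivative.\<close>

lemma lborel_integral_directional_derivative:
  fixes h :: "'a::euclidean_space \<Rightarrow> real"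
  assumes der: "\<And>x. (h has_derivative h' x) (at x)" and cont: "\<And>v. continuous_on UNIV (\<lambda>x. h' x v)"
    and supp: "\<And>y. y \<notin> ball 0 R \<Longrightarrow> h y = 0"
  shows "(\<integral>x. h' x v \<partial>lborel) = 0"
proof -
  have flip: "conv g (\<lambda>_. 1 :: real) x = (\<integral>y. g y \<partial>lborel)" if "continuous_on UNIV g" for g :: "'a \<Rightarrow> real" and x
    using lborel_integral_unit_affine[OF _ borel_measurable_continuous_onI[OF that], of "-1" x]
    by (simp add: conv_def)
  have "(conv h (\<lambda>_. 1 :: real) has_derivative (\<lambda>v. conv (\<lambda>z. h' z v) (\<lambda>_. 1) 0)) (at 0)"
    by (rule conv_has_derivative[OF locally_integrable_const der cont, where R=R]) (rule supp)
  moreover have "conv h (\<lambda>_. 1 :: real) = (\<lambda>_. \<integral>y. h y \<partial>lborel)"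
    using der by (intro ext flip) (auto intro!: continuous_at_imp_continuous_on has_derivative_continuous)
  ultimately have "(\<lambda>v. conv (\<lambda>z. h' z v) (\<lambda>_. 1) 0) = (\<lambda>_. 0 :: real)"
    using has_derivative_unique[OF _ has_derivative_const] by simp
  then show ?thesis using flip[OF cont, of v 0] by (simp add: fun_eq_iff)
qed

lemma integrable_norm_powr_ball:
  assumes "0 \<le> \<gamma>" "\<gamma> < real DIM('a)"
  shows "integrable lborel (\<lambda>z::'a::euclidean_space. indicator (ball 0 R) z * norm z powr (-\<gamma>))"
proof (cases "R > 0")
  case True
  obtain C where C: "(\<integral>\<^sup>+z. ennreal (norm (z::'a) powr (-\<gamma>)) * indicator (ball 0 R) z \<partial>lborel) \<le> ennreal C"
    using nn_integral_norm_powr_ball_le[OF assms] True by blast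
  show ?thesis
  proof (rule integrableI_bounded)
    have "(\<integral>\<^sup>+z. ennreal (norm (indicator (ball 0 R) z * norm (z::'a) powr (-\<gamma>))) \<partial>lborel)
      = (\<integral>\<^sup>+z. ennreal (norm (z::'a) powr (-\<gamma>)) * indicator (ball 0 R) z \<partial>lborel)"
      by (intro nn_integral_cong) (auto simp: indicator_def)
    also have "\<dots> < \<infinity>" using C by (auto intro: le_less_trans)
    finally show "(\<integral>\<^sup>+z. ennreal (norm (indicator (ball 0 R) z * norm (z::'a) powr (-\<gamma>))) \<partial>lborel) < \<infinity>" .
  qed measurable
next
  case False
  then have "ball 0 R = ({}::'a set)" by auto
  show ?thesis unfolding \<open>ball 0 R = {}\<close> by simp
qed

lemma integrable_one_plus_norm_powr:
  assumes "real DIM('a) < \<gamma>"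
  shows "integrable lborel (\<lambda>z::'a::euclidean_space. (1 + norm z) powr (-\<gamma>))"
  by (rule integrableI_bounded) (use nn_integral_one_plus_norm_powr_finite[OF assms] in auto)

text \<open>Integration by parts, one coordinate at a time, against the kernel (|y - x|^2 +
  e)^(-\<beta>/2). With e > 0 it is smooth, and its gradient is - \<beta> (y - x) (|y - x|^2 +
  e)^(-\<beta>/2 - 1).\<close>

lemma integral_div_regularized_kernel:
  fixes \<phi> :: "'a::euclidean_space \<Rightarrow> 'a"
  assumes der: "\<And>x. (\<phi> has_derivative \<phi>' x) (at x)" and cont: "\<And>v. continuous_on UNIV (\<lambda>x. \<phi>' x v)"
    and supp: "\<And>y. y \<notin> ball 0 R \<Longrightarrow> \<phi> y = 0" and e: "e > 0"
  shows "(\<integral>y. (\<Sum>i\<in>Basis. \<phi>' y i \<bullet> i) * ((norm (y - x))\<^sup>2 + e) powr (-\<beta>/2) \<partial>lborel)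
     = \<beta> * (\<integral>y. ((y - x) \<bullet> \<phi> y) * ((norm (y - x))\<^sup>2 + e) powr (-\<beta>/2 - 1) \<partial>lborel)"
proof -
  define k where "k y = ((norm (y - x))\<^sup>2 + e) powr (-\<beta>/2)" for y
  define l where "l y = ((norm (y - x))\<^sup>2 + e) powr (-\<beta>/2 - 1)" for y
  have pos: "(norm (y - x))\<^sup>2 + e > 0" for y by (rule add_nonneg_pos) (use e in auto)
  have kder: "(k has_derivative (\<lambda>h. - \<beta> * ((y - x) \<bullet> h) * l y)) (at y)" for y
  proof -
    have 1: "((\<lambda>y. (norm (y - x))\<^sup>2 + e) has_derivative (\<lambda>h. 2 * ((y - x) \<bullet> h))) (at y)"
      unfolding power2_norm_eq_inner by (auto intro!: derivative_eq_intros simp: inner_commute)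
    have "((\<lambda>s. s powr (-\<beta>/2)) has_field_derivative (-\<beta>/2) * ((norm (y - x))\<^sup>2 + e) powr (-\<beta>/2 - 1)) (at ((norm (y - x))\<^sup>2 + e))"
      by (rule has_real_derivative_powr[OF pos])
    from has_derivative_compose[OF 1 this[unfolded has_field_derivative_def]]
    have "(k has_derivative (\<lambda>h. -\<beta>/2 * ((norm (y - x))\<^sup>2 + e) powr (-\<beta>/2 - 1) * (2 * ((y - x) \<bullet> h)))) (at y)"
      unfolding k_def .
    then show ?thesis unfolding l_def by (rule has_derivative_eq_rhs) (auto simp: fun_eq_iff)
  qed
  have pcont: "continuous_on UNIV \<phi>"
    using der by (auto intro!: continuous_at_imp_continuous_on has_derivative_continuous)
  have nz: "(norm (y - x))\<^sup>2 + e \<noteq> 0" for y using pos[of y] by simp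
  have kcont: "continuous_on UNIV k"
    unfolding k_def by (intro continuous_intros) (use nz in simp)
  have lcont: "continuous_on UNIV l"
    unfolding l_def by (intro continuous_intros) (use nz in simp)
  have comp: "(\<integral>y. (\<phi>' y i \<bullet> i) * k y + (\<phi> y \<bullet> i) * (- \<beta> * ((y - x) \<bullet> i) * l y) \<partial>lborel) = 0" if i: "i \<in> Basis" for i
  proof (rule lborel_integral_directional_derivative[where R=R and v=i and h="\<lambda>y. (\<phi> y \<bullet> i) * k y"
      and h'="\<lambda>y h. (\<phi>' y h \<bullet> i) * k y + (\<phi> y \<bullet> i) * (- \<beta> * ((y - x) \<bullet> h) * l y)"])
    show "((\<lambda>y. \<phi> y \<bullet> i * k y) has_derivative
          (\<lambda>h. \<phi>' y h \<bullet> i * k y + \<phi> y \<bullet> i * (- \<beta> * ((y - x) \<bullet> h) * l y))) (at y)" for y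
      by (rule has_derivative_eq_rhs, rule has_derivative_mult[OF has_derivative_inner_left[OF der] kder])
         (auto simp: fun_eq_iff)
    show "continuous_on UNIV (\<lambda>y. \<phi>' y h \<bullet> i * k y + \<phi> y \<bullet> i * (- \<beta> * ((y - x) \<bullet> h) * l y))" for h
      by (intro continuous_intros cont pcont kcont lcont)
  qed (use supp in auto)
  have dz: "\<phi>' y v = 0" if "y \<notin> cball 0 R" for y v
    using has_derivative_zero_outside[OF der supp that] .
  have int1: "integrable lborel (\<lambda>y. (\<phi>' y i \<bullet> i) * k y)" for i
    by (rule integrable_continuous_support[where R=R]) (use dz in \<open>auto intro!: continuous_intros cont kcont\<close>)
  have int2: "integrable lborel (\<lambda>y. ((y - x) \<bullet> i) * (\<phi> y \<bullet> i) * l y)" for i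
    by (rule integrable_continuous_support[where R=R]) (use supp in \<open>auto intro!: continuous_intros pcont lcont\<close>)
  have "(\<integral>y. (\<phi>' y i \<bullet> i) * k y \<partial>lborel) = \<beta> * (\<integral>y. ((y - x) \<bullet> i) * (\<phi> y \<bullet> i) * l y \<partial>lborel)" if "i \<in> Basis" for i
  proof -
    have "0 = (\<integral>y. (\<phi>' y i \<bullet> i) * k y - \<beta> * (((y - x) \<bullet> i) * (\<phi> y \<bullet> i) * l y) \<partial>lborel)"
      by (subst comp[OF that, symmetric]) (intro Bochner_Integration.integral_cong refl, simp add: algebra_simps)
    also have "\<dots> = (\<integral>y. (\<phi>' y i \<bullet> i) * k y \<partial>lborel) - (\<integral>y. \<beta> * (((y - x) \<bullet> i) * (\<phi> y \<bullet> i) * l y) \<partial>lborel)"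
      by (intro Bochner_Integration.integral_diff int1 integrable_mult_right int2)
    finally show ?thesis by simp
  qed
  then have "(\<Sum>i\<in>Basis. \<integral>y. (\<phi>' y i \<bullet> i) * k y \<partial>lborel) = (\<Sum>i\<in>Basis. \<beta> * (\<integral>y. ((y - x) \<bullet> i) * (\<phi> y \<bullet> i) * l y \<partial>lborel))"
    by simp
  also have "\<dots> = \<beta> * (\<integral>y. (\<Sum>i\<in>Basis. ((y - x) \<bullet> i) * (\<phi> y \<bullet> i) * l y) \<partial>lborel)"
    by (subst Bochner_Integration.integral_sum) (auto simp: int2 sum_distrib_left)
  also have "(\<lambda>y. (\<Sum>i\<in>Basis. ((y - x) \<bullet> i) * (\<phi> y \<bullet> i) * l y)) = (\<lambda>y. ((y - x) \<bullet> \<phi> y) * l y)"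
  proof -
    have "(y - x) \<bullet> \<phi> y = (\<Sum>i\<in>Basis. ((y - x) \<bullet> i) * (\<phi> y \<bullet> i))" for y
      by (rule euclidean_inner)
    then show ?thesis by (simp add: sum_distrib_right)
  qed
  finally have "(\<Sum>i\<in>Basis. \<integral>y. (\<phi>' y i \<bullet> i) * k y \<partial>lborel) = \<beta> * (\<integral>y. ((y - x) \<bullet> \<phi> y) * l y \<partial>lborel)" .
  moreover have "(\<integral>y. (\<Sum>i\<in>Basis. \<phi>' y i \<bullet> i) * k y \<partial>lborel) = (\<Sum>i\<in>Basis. \<integral>y. (\<phi>' y i \<bullet> i) * k y \<partial>lborel)"
    unfolding sum_distrib_right by (rule Bochner_Integration.integral_sum) (rule int1)
  ultimately show ?thesis by (simp add: k_def l_def)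
qed

text \<open>Let e tend to 0 in the regularized identity. On the right the limit kernel has size |y -
  x|^(-\<beta> - 1), which is not integrable near x; subtracting \<phi> x from \<phi> y gains a
  factor |y - x| by the Lipschitz bound. The price is a bounded term without compact support, and
  \<beta> + 1 > n makes it integrable at infinity.\<close>

lemma integral_div_riesz_kernel:
  fixes \<phi> :: "'a::euclidean_space \<Rightarrow> 'a"
  assumes der: "\<And>x. (\<phi> has_derivative \<phi>' x) (at x)" and cont: "\<And>v. continuous_on UNIV (\<lambda>x. \<phi>' x v)"
    and supp: "\<And>y. y \<notin> ball 0 R \<Longrightarrow> \<phi> y = 0"
    and \<beta>: "0 < \<beta>" "\<beta> < real DIM('a)" "real DIM('a) < \<beta> + 1"
  shows "(\<integral>y. (\<Sum>i\<in>Basis. \<phi>' y i \<bullet> i) * norm (x - y) powr (-\<beta>) \<partial>lborel)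
     = \<beta> * (\<integral>y. ((y - x) \<bullet> (\<phi> y - \<phi> x)) / norm (y - x) powr (\<beta> + 2) \<partial>lborel)"
proof -
  let ?p = "\<lambda>y. (y - x) \<bullet> (\<phi> y - \<phi> x)"
  define D where "D y = (\<Sum>i\<in>Basis. \<phi>' y i \<bullet> i)" for y
  have pcont: "continuous_on UNIV \<phi>"
    using der by (auto intro!: continuous_at_imp_continuous_on has_derivative_continuous)
  then have [measurable]: "\<phi> \<in> borel_measurable borel" by (intro borel_measurable_continuous_onI)
  have Dcont: "continuous_on UNIV D" unfolding D_def by (intro continuous_intros cont)
  then have [measurable]: "D \<in> borel_measurable borel" by (intro borel_measurable_continuous_onI)
  have D0: "D y = 0" if "y \<notin> cball 0 R" for y
    unfolding D_def using has_derivative_zero_outside[OF der supp that] by simp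
  obtain M where M: "M > 0" "\<And>y. \<bar>D y\<bar> \<le> M"
    using bounded_continuous_support[OF Dcont D0] by auto
  obtain N where N: "N > 0" "\<And>y. norm (\<phi> y) \<le> N"
    using bounded_continuous_support[OF pcont, of R] supp by auto
  obtain L where L: "L \<ge> 0" "\<And>x y. norm (\<phi> x - \<phi> y) \<le> L * norm (x - y)"
    using has_derivative_support_Lipschitz[OF der cont supp] by blast
  define e where "e k = inverse (real (Suc k))" for k
  have e: "e k > 0" for k by (simp add: e_def)
  have e0: "e \<longlonglongrightarrow> 0" unfolding e_def by (rule LIMSEQ_inverse_real_of_nat)
  have ker_le: "((norm z)\<^sup>2 + e k) powr (-s/2) \<le> norm z powr (-s)" if "z \<noteq> 0" "s > 0" for z :: 'a and k s
  proof -
    have "((norm z)\<^sup>2 + e k) powr (-s/2) \<le> ((norm z)\<^sup>2) powr (-s/2)"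
      using that e[of k] by (intro powr_mono2') auto
    also have "\<dots> = norm z powr (-s)" using that by (simp add: powr_powr flip: powr_numeral)
    finally show ?thesis .
  qed
  have ker_lim: "(\<lambda>k. ((norm z)\<^sup>2 + e k) powr (-s/2)) \<longlonglongrightarrow> norm z powr (-s)" if "z \<noteq> 0" for z :: 'a and s
  proof -
    have "(\<lambda>k. ((norm z)\<^sup>2 + e k) powr (-s/2)) \<longlonglongrightarrow> ((norm z)\<^sup>2 + 0) powr (-s/2)"
      using that by (intro tendsto_intros e0) auto
    also have "((norm z)\<^sup>2 + 0) powr (-s/2) = norm z powr (-s)" using that by (simp add: powr_powr flip: powr_numeral)
    finally show ?thesis .
  qed
  have trans: "integrable lborel (\<lambda>y. g (y - x))" if "integrable lborel g" for g :: "'a \<Rightarrow> real"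
    using lborel_integrable_unit_affine[of 1 g "-x"] that by (simp add: borel_measurable_integrable)
  have "(\<lambda>k. \<integral>y. D y * ((norm (y - x))\<^sup>2 + e k) powr (-\<beta>/2) \<partial>lborel) \<longlonglongrightarrow> (\<integral>y. D y * norm (x - y) powr (-\<beta>) \<partial>lborel)"
  proof (rule integral_dominated_convergence[where w="\<lambda>y. M * (indicator (ball 0 (R + norm x + 1)) (y - x) * norm (y - x) powr (-\<beta>))"])
    show "integrable lborel (\<lambda>y. M * (indicator (ball 0 (R + norm x + 1)) (y - x) * norm (y - x) powr (-\<beta>)))"
      by (intro integrable_mult_right trans[where g="\<lambda>z. indicator (ball 0 (R + norm x + 1)) z * norm z powr (-\<beta>)"]
          integrable_norm_powr_ball) (use \<beta> in auto)
    show "AE y in lborel. (\<lambda>k. D y * ((norm (y - x))\<^sup>2 + e k) powr (-\<beta>/2)) \<longlonglongrightarrow> D y * norm (x - y) powr (-\<beta>)"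
      using AE_lborel_singleton[of x]
    proof eventually_elim
      case (elim y)
      then show ?case using ker_lim[of "y - x" \<beta>] by (intro tendsto_mult tendsto_const) (simp add: norm_minus_commute)
    qed
    show "AE y in lborel. norm (D y * ((norm (y - x))\<^sup>2 + e k) powr (-\<beta>/2))
        \<le> M * (indicator (ball 0 (R + norm x + 1)) (y - x) * norm (y - x) powr (-\<beta>))" for k
      using AE_lborel_singleton[of x]
    proof eventually_elim
      case (elim y)
      show ?case
      proof (cases "y \<in> cball 0 R")
        case True
        then have "y - x \<in> ball 0 (R + norm x + 1)" using norm_triangle_ineq4[of y x] by simp
        then show ?thesis using ker_le[of "y - x" \<beta> k] M elim \<beta> by (auto simp: abs_mult intro!: mult_mono)
      next
        case False
        then show ?thesis using D0 M by auto
      qed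
    qed
  qed measurable
  moreover have "(\<integral>y. D y * ((norm (y - x))\<^sup>2 + e k) powr (-\<beta>/2) \<partial>lborel)
     = \<beta> * (\<integral>y. ((y - x) \<bullet> \<phi> y) * ((norm (y - x))\<^sup>2 + e k) powr (-\<beta>/2 - 1) \<partial>lborel)" for k
    unfolding D_def by (rule integral_div_regularized_kernel[OF der cont supp e])
  ultimately have lim1: "(\<lambda>k. \<beta> * (\<integral>y. ((y - x) \<bullet> \<phi> y) * ((norm (y - x))\<^sup>2 + e k) powr (-\<beta>/2 - 1) \<partial>lborel))
      \<longlonglongrightarrow> (\<integral>y. D y * norm (x - y) powr (-\<beta>) \<partial>lborel)" by simp
  define s where "s k y = ?p y * ((norm (y - x))\<^sup>2 + e k) powr (-\<beta>/2 - 1)" for k y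
  \<comment> \<open>2 N bounds |\<phi> y - \<phi> x|; the power of 2 comes from |z| \<ge> (1 + |z|)
    / 2 when |z| \<ge> 1.\<close>
  define K where "K = 2 * N * 2 powr (\<beta> + 1)"
  define w where "w z = L * (indicator (ball 0 1) z * norm z powr (-\<beta>)) + K * (1 + norm z) powr (-(\<beta> + 1))" for z :: 'a
  have K: "K \<ge> 0" using N by (simp add: K_def)
  have wint: "integrable lborel (\<lambda>y. w (y - x))"
    unfolding w_def
    by (rule trans, intro Bochner_Integration.integrable_add integrable_mult_right integrable_norm_powr_ball
        integrable_one_plus_norm_powr) (use \<beta> in auto)
  have dom: "\<bar>s k y\<bar> \<le> w (y - x)" for k y
  proof (cases "y = x")
    case True
    then show ?thesis using L K by (simp add: s_def w_def)
  next
    case False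
    define z where "z = y - x"
    have z: "z \<noteq> 0" using False by (simp add: z_def)
    have "\<bar>s k y\<bar> \<le> (norm z * norm (\<phi> y - \<phi> x)) * norm z powr (-(\<beta> + 2))"
      unfolding s_def abs_mult z_def[symmetric]
      using Cauchy_Schwarz_ineq2[of z "\<phi> y - \<phi> x"] ker_le[OF z, of "\<beta> + 2" k] \<beta>
      by (intro mult_mono) (auto simp: add_divide_distrib diff_divide_distrib)
    also have "\<dots> = norm (\<phi> y - \<phi> x) * norm z powr (-(\<beta> + 1))"
      using z by (simp add: powr_diff powr_minus powr_add power2_eq_square field_simps)
    also have "\<dots> \<le> w z"
    proof (cases "norm z < 1")
      case True
      have "norm (\<phi> y - \<phi> x) * norm z powr (-(\<beta> + 1)) \<le> (L * norm z) * norm z powr (-(\<beta> + 1))"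
        unfolding z_def by (intro mult_right_mono L) auto
      also have "\<dots> = L * norm z powr (-\<beta>)" using z by (simp add: powr_diff powr_minus powr_add power2_eq_square field_simps)
      also have "\<dots> \<le> w z" using True K by (simp add: w_def)
      finally show ?thesis .
    next
      case False
      have "norm (\<phi> y - \<phi> x) \<le> 2 * N" using norm_triangle_ineq4[of "\<phi> y" "\<phi> x"] N(2)[of x] N(2)[of y] by linarith
      moreover have "norm z powr (-(\<beta> + 1)) \<le> ((1 + norm z) / 2) powr (-(\<beta> + 1))"
        using False \<beta> by (intro powr_mono2') (auto intro: add_pos_nonneg)
      moreover have "((1 + norm z) / 2) powr (-(\<beta> + 1)) = 2 powr (\<beta> + 1) * (1 + norm z) powr (-(\<beta> + 1))"
        by (simp add: powr_divide powr_minus powr_diff powr_add field_simps)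
      ultimately have "norm (\<phi> y - \<phi> x) * norm z powr (-(\<beta> + 1)) \<le> 2 * N * (2 powr (\<beta> + 1) * (1 + norm z) powr (-(\<beta> + 1)))"
        using N by (intro mult_mono) auto
      also have "\<dots> \<le> w z" using False L by (simp add: w_def K_def)
      finally show ?thesis .
    qed
    finally show ?thesis by (simp add: z_def)
  qed
  have sm: "s k \<in> borel_measurable lborel" for k unfolding s_def[abs_def] by measurable
  have lim2: "(\<lambda>k. \<integral>y. s k y \<partial>lborel) \<longlonglongrightarrow> (\<integral>y. ?p y / norm (y - x) powr (\<beta> + 2) \<partial>lborel)"
  proof (rule integral_dominated_convergence[OF _ sm wint])
    show "AE y in lborel. norm (s k y) \<le> w (y - x)" for k using dom by auto
    show "AE y in lborel. (\<lambda>k. s k y) \<longlonglongrightarrow> ?p y / norm (y - x) powr (\<beta> + 2)"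
    proof (intro AE_I2)
      fix y
      show "(\<lambda>k. s k y) \<longlonglongrightarrow> ?p y / norm (y - x) powr (\<beta> + 2)"
      proof (cases "y = x")
        case False
        have "(\<lambda>k. s k y) \<longlonglongrightarrow> ?p y * norm (y - x) powr (-(\<beta> + 2))"
          unfolding s_def using ker_lim[of "y - x" "\<beta> + 2"] False
          by (intro tendsto_mult tendsto_const) (simp add: add_divide_distrib diff_divide_distrib)
        then show ?thesis by (simp only: powr_minus divide_inverse)
      qed (simp add: s_def)
    qed
  qed measurable
  have sint: "integrable lborel (s k)" for k
    by (rule Bochner_Integration.integrable_bound[OF wint sm]) (use dom in \<open>auto intro: order_trans[OF _ abs_ge_self]\<close>)
  have "(\<integral>y. ((y - x) \<bullet> \<phi> y) * ((norm (y - x))\<^sup>2 + e k) powr (-\<beta>/2 - 1) \<partial>lborel) = (\<integral>y. s k y \<partial>lborel)" for k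
  proof -
    define l where "l y = ((norm (y - x))\<^sup>2 + e k) powr (-\<beta>/2 - 1)" for y
    have nz: "(norm (y - x))\<^sup>2 + e k \<noteq> 0" for y
      using e[of k] by (metis add_nonneg_eq_0_iff less_le zero_le_power2)
    have lcont: "continuous_on UNIV l"
      unfolding l_def by (intro continuous_intros) (use nz in simp)
    have [measurable]: "l \<in> borel_measurable borel" using lcont by (rule borel_measurable_continuous_onI)
    have pint: "integrable lborel (\<lambda>y. ((y - x) \<bullet> \<phi> y) * l y)"
      by (rule integrable_continuous_support[where R=R]) (use supp in \<open>auto intro!: continuous_intros pcont lcont\<close>)
    \<comment> \<open>The subtraction of \<phi> x is free at the regularized level: the term Q it
      introduces is odd under y \<mapsto> 2 x - y, so its integral is 0.\<close>
    define Q where "Q y = ((y - x) \<bullet> \<phi> x) * l y" for y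
    have [measurable]: "Q \<in> borel_measurable borel" unfolding Q_def[abs_def] by measurable
    have Qeq: "Q = (\<lambda>y. ((y - x) \<bullet> \<phi> y) * l y - s k y)"
      by (auto simp: Q_def s_def l_def fun_eq_iff inner_diff_right algebra_simps)
    have "(\<integral>y. Q y \<partial>lborel) = (\<integral>y. Q (2 *\<^sub>R x + (-1) *\<^sub>R y) \<partial>lborel)"
      by (rule lborel_integral_unit_affine[symmetric]) auto
    also have "(\<lambda>y. Q (2 *\<^sub>R x + (-1) *\<^sub>R y)) = (\<lambda>y. - Q y)"
      by (auto simp: Q_def l_def fun_eq_iff scaleR_2 norm_minus_commute algebra_simps)
    finally have "(\<integral>y. Q y \<partial>lborel) = 0" by simp
    then have "(\<integral>y. ((y - x) \<bullet> \<phi> y) * l y \<partial>lborel) - (\<integral>y. s k y \<partial>lborel) = 0"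
      unfolding Qeq using pint sint by simp
    then show ?thesis by (simp add: l_def)
  qed
  with lim1 have "(\<lambda>k. \<beta> * (\<integral>y. s k y \<partial>lborel)) \<longlonglongrightarrow> (\<integral>y. D y * norm (x - y) powr (-\<beta>) \<partial>lborel)" by simp
  from LIMSEQ_unique[OF this tendsto_mult[OF tendsto_const lim2]] show ?thesis by (simp add: D_def)
qed

lemma nn_integral_le_if_ball_le:
  fixes g :: "'a::euclidean_space \<Rightarrow> ennreal" and M :: "'a measure"
  assumes [measurable]: "g \<in> borel_measurable borel" and "\<And>R. R > 0 \<Longrightarrow> (\<integral>\<^sup>+x. g x * indicator (ball 0 R) x \<partial>M) \<le> V"
    and [measurable_cong]: "sets M = sets borel"
  shows "(\<integral>\<^sup>+x. g x \<partial>M) \<le> V"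
proof -
  have "(\<integral>\<^sup>+x. g x \<partial>M) \<le> (\<integral>\<^sup>+x. liminf (\<lambda>n. g x * indicator (ball 0 (real (Suc n))) x) \<partial>M)"
  proof (rule nn_integral_mono)
    fix x :: 'a
    obtain N :: nat where N: "norm x < real N" using reals_Archimedean2 by blast
    have "eventually (\<lambda>n. g x \<le> g x * indicator (ball 0 (real (Suc n))) x) sequentially"
      using eventually_ge_at_top[of N] by eventually_elim (use N in \<open>auto simp: indicator_def\<close>)
    then show "g x \<le> liminf (\<lambda>n. g x * indicator (ball 0 (real (Suc n))) x)"
      by (rule Liminf_bounded)
  qed
  also have "\<dots> \<le> liminf (\<lambda>n. \<integral>\<^sup>+x. g x * indicator (ball 0 (real (Suc n))) x \<partial>M)"
    by (rule nn_integral_liminf) measurable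
  also have "\<dots> \<le> liminf (\<lambda>n. V)"
    by (intro Liminf_mono always_eventually allI assms(2)) auto
  also have "\<dots> = V" by (simp add: Liminf_const)
  finally show ?thesis .
qed

lemma has_derivative_minus_even:
  fixes \<rho> :: "'a::real_normed_vector \<Rightarrow> real"
  assumes "\<And>z. \<rho> (- z) = \<rho> z" and der: "\<And>x. (\<rho> has_derivative \<rho>' x) (at x)"
  shows "\<rho>' (- z) v = - \<rho>' z v"
proof -
  have "((\<lambda>z. \<rho> (- z)) has_derivative (\<lambda>v. \<rho>' (- z) (- v))) (at z)"
    by (rule has_derivative_compose[OF _ der]) (auto intro!: derivative_eq_intros)
  then have "(\<rho> has_derivative (\<lambda>v. \<rho>' (- z) (- v))) (at z)" by (simp add: assms(1))
  then have "\<rho>' z = (\<lambda>v. \<rho>' (- z) (- v))" using der has_derivative_unique by blast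
  moreover have "linear (\<rho>' (- z))" using der by (rule has_derivative_linear)
  ultimately show ?thesis by (simp add: linear_neg)
qed

section \<open>Normalized bump functions as mollifiers\<close>

definition mollifier :: "real \<Rightarrow> 'a::euclidean_space \<Rightarrow> real" where
  "mollifier r z = bump r z / (\<integral>x. bump r (x::'a) \<partial>lborel)"

context
  fixes r :: real
  assumes r: "r > 0"
begin

lemma mollifier_nonneg: "mollifier r z \<ge> 0"
  unfolding mollifier_def using bump_nonneg bump_integral_pos[OF r] by (auto intro!: divide_nonneg_pos)

lemma mollifier_minus: "mollifier r (- z) = mollifier r z"
  by (simp add: mollifier_def bump_minus)

lemma mollifier_outside: "z \<notin> ball 0 r \<Longrightarrow> mollifier r z = 0"
  by (simp add: mollifier_def bump_outside[OF r] del: mem_ball)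

lemma Ck_mollifier: "Ck k (mollifier r)"
  unfolding mollifier_def[abs_def] divide_inverse by (intro Ck_mult Ck_bump Ck_const)

lemma mollifier_borel [measurable]: "mollifier r \<in> borel_measurable borel"
  unfolding mollifier_def[abs_def] by measurable

lemma mollifier_integrable: "integrable lborel (mollifier r)"
  unfolding mollifier_def[abs_def] by (intro integrable_divide bump_integrable r)

lemma mollifier_integral: "(\<integral>z. mollifier r (z::'a::euclidean_space) \<partial>lborel) = 1"
  unfolding mollifier_def using bump_integral_pos[OF r, where 'a='a] by simp

lemma mollifier_translate:
  shows "integrable lborel (\<lambda>y. mollifier r (x - y))" and "(\<integral>y. mollifier r (x - y) \<partial>lborel) = 1"
  using lborel_integrable_unit_affine[of "-1" "mollifier r" x] lborel_integral_unit_affine[of "-1" "mollifier r" x]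
    mollifier_integrable mollifier_integral by auto

end

section \<open>The gradient of the mollified potential\<close>

context riesz_setting
begin

text \<open>Gamma (\<beta>/2 + 1) = (\<beta>/2) Gamma (\<beta>/2) and 2^\<alpha> = 2 * 2^(\<alpha> -
  1). The factor \<beta> is the one produced by differentiating |x|^(-\<beta>), so the two
  normalizations match without a remainder.\<close>

lemma frac_const_eq: "frac_const DIM('a) \<alpha> = \<kappa> * \<beta>"
proof -
  have b: "(real DIM('a) + \<alpha> + 1) / 2 = \<beta> / 2 + 1" unfolding \<beta>_def by (simp add: field_simps)
  have "\<beta> / 2 \<notin> \<int>\<^sub>\<le>\<^sub>0" using \<beta>_bounds nonpos_Ints_nonpos[of "\<beta> / 2"] by auto
  then have g: "Gamma ((real DIM('a) + \<alpha> + 1) / 2) = (\<beta> / 2) * Gamma (\<beta> / 2)"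
    unfolding b by (rule Gamma_plus1)
  have k: "\<kappa> = 2 powr (\<alpha> - 1) * pi powr (- real DIM('a) / 2) * Gamma (\<beta> / 2) / Gamma ((1 - \<alpha>) / 2)"
    by (simp add: \<kappa>_def \<beta>_def)
  have t: "(2::real) powr \<alpha> = 2 * 2 powr (\<alpha> - 1)" by (simp add: powr_diff)
  show ?thesis unfolding frac_const_def g k t by simp
qed

lemma frac_div_eq:
  fixes \<phi> :: "'a \<Rightarrow> 'a"
  assumes der: "\<And>x. (\<phi> has_derivative \<phi>' x) (at x)" and cont: "\<And>v. continuous_on UNIV (\<lambda>x. \<phi>' x v)"
    and supp: "\<And>y. y \<notin> ball 0 R \<Longrightarrow> \<phi> y = 0"
  shows "frac_div \<alpha> \<phi> x = \<kappa> * (\<integral>y. (\<Sum>i\<in>Basis. \<phi>' y i \<bullet> i) * norm (x - y) powr (-\<beta>) \<partial>lborel)"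
proof -
  have "continuous_on UNIV \<phi>"
    using der by (auto intro!: continuous_at_imp_continuous_on has_derivative_continuous)
  then have [measurable]: "\<phi> \<in> borel_measurable borel" by (intro borel_measurable_continuous_onI)
  have "frac_div \<alpha> \<phi> x = \<kappa> * \<beta> * (\<integral>y. ((y - x) \<bullet> (\<phi> y - \<phi> x)) / norm (y - x) powr (\<beta> + 2) \<partial>lebesgue)"
  proof -
    have *: "real DIM('a) + \<alpha> + 1 = \<beta> + 2" by (simp add: \<beta>_def)
    show ?thesis unfolding frac_div_def frac_const_eq * by simp
  qed
  also have "(\<integral>y. ((y - x) \<bullet> (\<phi> y - \<phi> x)) / norm (y - x) powr (\<beta> + 2) \<partial>lebesgue)
     = (\<integral>y. ((y - x) \<bullet> (\<phi> y - \<phi> x)) / norm (y - x) powr (\<beta> + 2) \<partial>lborel)"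
    by (rule integral_completion) measurable
  finally show ?thesis
    using integral_div_riesz_kernel[where R=R, OF der cont supp \<beta>_bounds] \<alpha> by (simp add: \<beta>_def)
qed

text \<open>In effect the distributional variation of u is at most |D^\<alpha> f|:
  \<open>u_duality\<close> with h = div \<phi> turns each pairing of u into one that is admissible
  for f.\<close>

lemma integral_u_div_le_frac_variation:
  fixes \<phi> :: "'a \<Rightarrow> 'a"
  assumes Ck: "\<And>k. Ck k \<phi>" and supp: "\<And>y. y \<notin> ball 0 R \<Longrightarrow> \<phi> y = 0" and R: "R > 0" and le: "\<And>y. norm (\<phi> y) \<le> 1"
    and der: "\<And>x. (\<phi> has_derivative \<phi>' x) (at x)" and cont: "\<And>v. continuous_on UNIV (\<lambda>x. \<phi>' x v)"
  shows "ennreal (\<integral>y. u y * (\<Sum>i\<in>Basis. \<phi>' y i \<bullet> i) \<partial>lborel) \<le> frac_variation \<alpha> f"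
proof -
  define D where "D y = (\<Sum>i\<in>Basis. \<phi>' y i \<bullet> i)" for y
  have Dcont: "continuous_on UNIV D" unfolding D_def by (intro continuous_intros cont)
  then have [measurable]: "D \<in> borel_measurable borel" by (intro borel_measurable_continuous_onI)
  have D0: "D y = 0" if "y \<notin> cball 0 R" for y
    unfolding D_def using has_derivative_zero_outside[OF der supp that] by simp
  obtain M where M: "\<And>y. \<bar>D y\<bar> \<le> M"
    using bounded_continuous_support[OF Dcont D0] by auto
  have feq: "frac_div \<alpha> \<phi> = (\<lambda>x. \<kappa> * (\<integral>y. D y * norm (x - y) powr (-\<beta>) \<partial>lborel))"
    using frac_div_eq[where R=R, OF der cont supp] by (auto simp: D_def)
  have "(\<integral>y. u y * D y \<partial>lborel) = (\<integral>x. f x * frac_div \<alpha> \<phi> x \<partial>lborel)"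
    unfolding feq by (rule u_duality[where M=M and R="R + 1"]) (use M D0 R in auto)
  also have "\<dots> = (\<integral>x. f x * frac_div \<alpha> \<phi> x \<partial>lebesgue)"
    unfolding feq by (rule integral_completion[symmetric]) measurable
  finally have "ennreal (\<integral>y. u y * D y \<partial>lborel) = ennreal (\<integral>x. f x * frac_div \<alpha> \<phi> x \<partial>lebesgue)" by simp
  also have "\<dots> \<le> frac_variation \<alpha> f"
    unfolding frac_variation_def
  proof (rule SUP_upper, safe)
    have "{x. \<phi> x \<noteq> 0} \<subseteq> ball 0 R" using supp by blast
    then have "bounded {x. \<phi> x \<noteq> 0}" using bounded_ball bounded_subset by blast
    then show "Cinf_c \<phi>" using Ck by (simp add: Cinf_c_def compact_closure)
  qed (use le in auto)
  finally show ?thesis by (simp add: D_def)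
qed

lemma u_locally_integrable: "locally_integrable u"
  unfolding locally_integrable_def
proof (intro conjI allI)
  fix R
  show "integrable lborel (\<lambda>y. indicator (ball 0 R) y *\<^sub>R u y)"
  proof (rule integrableI_bounded)
    have "(\<integral>\<^sup>+y. ennreal (norm (indicator (ball 0 R) y *\<^sub>R u y)) \<partial>lborel) = ball_mass u R"
      by (intro nn_integral_cong) (auto simp: indicator_def)
    then show "(\<integral>\<^sup>+y. ennreal (norm (indicator (ball 0 R) y *\<^sub>R u y)) \<partial>lborel) < \<infinity>"
      using u_ball_finite by simp
  qed measurable
qed measurable

text \<open>The field that recovers the integral of |G| over a ball is - sgn G cut off to that ball.
  It is not smooth, so its mollification \<Phi> is tested instead: Fubini's theorem transfers the
  mollifier from the field to u, and the pairing of u with div \<Phi> is exactly that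
  integral.\<close>

lemma mollified_gradient:
  assumes r: "r > 0"
  shows "\<exists>G. continuous_on UNIV G \<and> (\<forall>x. (conv (mollifier r) u has_derivative (\<lambda>h. G x \<bullet> h)) (at x))
     \<and> (\<integral>\<^sup>+x. ennreal (norm (G x)) \<partial>lborel) \<le> frac_variation \<alpha> f"
proof -
  define \<rho> where "\<rho> = (mollifier r :: 'a \<Rightarrow> real)"
  obtain \<rho>' where \<rho>': "\<And>x. (\<rho> has_derivative \<rho>' x) (at x)" "\<And>v. Ck 0 (\<lambda>x. \<rho>' x v)"
    unfolding \<rho>_def using Ck_SucE[OF Ck_mollifier[OF r]] by metis
  have cont: "continuous_on UNIV (\<lambda>x. \<rho>' x v)" for v using \<rho>'(2) by simp
  have supp: "\<rho> z = 0" if "z \<notin> ball 0 r" for z using mollifier_outside[OF r that] by (simp add: \<rho>_def)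
  have lin: "linear (\<rho>' z)" for z using \<rho>'(1) by (rule has_derivative_linear)
  have odd: "\<rho>' (- z) v = - \<rho>' z v" for z v
    by (rule has_derivative_minus_even[OF _ \<rho>'(1)]) (simp add: \<rho>_def mollifier_minus[OF r])
  obtain L where L: "L \<ge> 0" "\<And>x v. \<bar>\<rho>' x v\<bar> \<le> L * norm v"
    using has_derivative_support_Lipschitz[where R=r, OF \<rho>'(1) cont supp] by auto
  have dz: "\<rho>' z v = 0" if "z \<notin> ball 0 (r + 1)" for z v
    by (rule has_derivative_zero_outside[OF \<rho>'(1) supp]) (use that in auto)
  have [measurable]: "\<rho> \<in> borel_measurable borel" unfolding \<rho>_def by (rule mollifier_borel[OF r])
  have [measurable]: "(\<lambda>x. \<rho>' x v) \<in> borel_measurable borel" for v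
    using cont by (rule borel_measurable_continuous_onI)
  define G where "G x = (\<Sum>i\<in>Basis. conv (\<lambda>z. \<rho>' z i) u x *\<^sub>R i)" for x
  have Gcont: "continuous_on UNIV G"
    unfolding G_def by (intro continuous_intros continuous_on_conv[OF u_locally_integrable cont, where R="r + 1"]) (rule dz)
  then have [measurable]: "G \<in> borel_measurable borel" by (rule borel_measurable_continuous_onI)
  have cder: "(conv \<rho> g has_derivative (\<lambda>v. conv (\<lambda>z. \<rho>' z v) g x)) (at x)"
    if "locally_integrable g" for x and g :: "'a \<Rightarrow> 'b::{banach, second_countable_topology}"
    by (rule conv_has_derivative[OF that \<rho>'(1) cont, where R=r]) (rule supp)
  have Geq: "conv (\<lambda>z. \<rho>' z h) u x = G x \<bullet> h" for x h
  proof -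
    have linD: "linear (\<lambda>v. conv (\<lambda>z. \<rho>' z v) u x)"
      using cder[OF u_locally_integrable] by (rule has_derivative_linear)
    have "conv (\<lambda>z. \<rho>' z h) u x = conv (\<lambda>z. \<rho>' z (\<Sum>i\<in>Basis. (h \<bullet> i) *\<^sub>R i)) u x"
      by (simp add: euclidean_representation)
    also have "\<dots> = (\<Sum>i\<in>Basis. conv (\<lambda>z. \<rho>' z ((h \<bullet> i) *\<^sub>R i)) u x)"
      by (rule linear_sum[OF linD])
    also have "\<dots> = (\<Sum>i\<in>Basis. (h \<bullet> i) *\<^sub>R conv (\<lambda>z. \<rho>' z i) u x)"
      by (intro sum.cong refl linear_scale[OF linD])
    also have "\<dots> = G x \<bullet> h"
      by (simp add: G_def inner_sum_left inner_commute[of h] mult.commute)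
    finally show ?thesis .
  qed
  have ball: "(\<integral>\<^sup>+x. ennreal (norm (G x)) * indicator (ball 0 S) x \<partial>lborel) \<le> frac_variation \<alpha> f" if S: "S > 0" for S
  proof -
    \<comment> \<open>The sign anticipates the transfer: \<rho> is even, so \<rho>' is odd and
      \<rho>' (y - x) becomes - \<rho>' (x - y).\<close>
    define \<phi> where "\<phi> x = - (indicator (ball 0 S) x *\<^sub>R sgn (G x))" for x
    have [measurable]: "\<phi> \<in> borel_measurable borel" unfolding \<phi>_def[abs_def] sgn_div_norm by measurable
    have \<phi>le: "norm (\<phi> x) \<le> indicator (ball 0 S) x" for x by (simp add: \<phi>_def norm_sgn indicator_def)
    then have \<phi>1: "norm (\<phi> x) \<le> 1" for x by (rule order_trans) (simp add: indicator_def)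
    have ind_int: "integrable lborel (\<lambda>x. indicator (ball (0::'a) S) x :: real)" for S
      by (rule integrable_real_indicator[OF _ emeasure_bounded_finite]) auto
    have \<phi>int: "integrable lborel (\<lambda>y. indicator (ball 0 R) y *\<^sub>R \<phi> y)" for R
      by (rule Bochner_Integration.integrable_bound[OF ind_int[of R]])
         (use \<phi>1 in \<open>auto intro!: AE_I2 simp: indicator_def\<close>)
    have \<phi>loc: "locally_integrable \<phi>" unfolding locally_integrable_def using \<phi>int by auto
    let ?div = "\<lambda>y. \<Sum>i\<in>Basis. conv (\<lambda>z. \<rho>' z i) \<phi> y \<bullet> i"
    define \<Phi> where "\<Phi> = conv \<rho> \<phi>"
    have \<rho>Ck: "Ck k \<rho>" for k unfolding \<rho>_def by (rule Ck_mollifier[OF r])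
    have 1: "ennreal (\<integral>y. u y * ?div y \<partial>lborel) \<le> frac_variation \<alpha> f"
    proof (rule integral_u_div_le_frac_variation[where \<phi>=\<Phi> and R="S + r"])
      show "Ck k \<Phi>" for k unfolding \<Phi>_def by (rule Ck_conv[OF \<phi>loc \<rho>Ck, where R=r]) (rule supp)
      show "\<Phi> y = 0" if y: "y \<notin> ball 0 (S + r)" for y
      proof -
        have "\<rho> (y - x) *\<^sub>R \<phi> x = 0" for x
        proof (cases "x \<in> ball 0 S")
          case True
          then have "y - x \<notin> ball 0 r" using y norm_triangle_sub[of y x] by auto
          then show ?thesis using supp by simp
        qed (simp add: \<phi>_def)
        then show ?thesis unfolding \<Phi>_def conv_def by (simp only: integral_zero)
      qed
      \<comment> \<open>Mollifying with a nonnegative kernel of mass 1 preserves the bound, so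
        \<Phi> is admissible in the supremum.\<close>
      show "norm (\<Phi> y) \<le> 1" for y
      proof -
        have "norm (\<Phi> y) \<le> (\<integral>x. norm (\<rho> (y - x) *\<^sub>R \<phi> x) \<partial>lborel)"
          unfolding \<Phi>_def conv_def by (rule integral_norm_bound)
        also have "\<dots> \<le> (\<integral>x. \<rho> (y - x) \<partial>lborel)"
          using mollifier_translate(1)[OF r, of y] mollifier_nonneg[OF r] \<phi>1
          by (intro integral_mono') (auto simp: \<rho>_def intro!: mult_left_le)
        also have "\<dots> = 1" unfolding \<rho>_def by (rule mollifier_translate(2)[OF r])
        finally show ?thesis .
      qed
      show "(\<Phi> has_derivative (\<lambda>v. conv (\<lambda>z. \<rho>' z v) \<phi> x)) (at x)" for x
        unfolding \<Phi>_def by (rule cder[OF \<phi>loc])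
      show "continuous_on UNIV (conv (\<lambda>z. \<rho>' z v) \<phi>)" for v
        by (rule continuous_on_conv[OF \<phi>loc cont, where R="r + 1"]) (rule dz)
    qed (use S r in auto)
    define H where "H x y = u y * \<rho>' (y - x) (\<phi> x)" for x y
    have rsum: "\<rho>' z (\<phi> x) = (\<Sum>i\<in>Basis. \<rho>' z i * (\<phi> x \<bullet> i))" for z x
    proof -
      have "\<rho>' z (\<phi> x) = \<rho>' z (\<Sum>i\<in>Basis. (\<phi> x \<bullet> i) *\<^sub>R i)" by (simp add: euclidean_representation)
      then show ?thesis by (simp add: linear_sum[OF lin] linear_scale[OF lin] mult.commute)
    qed
    have div: "?div y = (\<integral>x. \<rho>' (y - x) (\<phi> x) \<partial>lborel)" for y
    proof -
      have int: "integrable lborel (\<lambda>x. \<rho>' (y - x) i *\<^sub>R \<phi> x)" for i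
        by (rule conv_integrable[OF \<phi>loc, where M="L * norm i" and R="r + 1" and x=y])
           (use L dz in \<open>auto simp: dist_norm\<close>)
      have "?div y = (\<Sum>i\<in>Basis. \<integral>x. (\<rho>' (y - x) i *\<^sub>R \<phi> x) \<bullet> i \<partial>lborel)"
        unfolding conv_def using int by (intro sum.cong refl integral_inner_left[symmetric]) auto
      also have "\<dots> = (\<integral>x. (\<Sum>i\<in>Basis. (\<rho>' (y - x) i *\<^sub>R \<phi> x) \<bullet> i) \<partial>lborel)"
        using int by (intro Bochner_Integration.integral_sum[symmetric] integrable_inner_left) auto
      finally show ?thesis by (simp add: rsum)
    qed
    have [measurable]: "case_prod H \<in> borel_measurable (lborel \<Otimes>\<^sub>M lborel)"
      unfolding H_def[abs_def] rsum by measurable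
    have "integrable (lborel \<Otimes>\<^sub>M lborel) (case_prod H)"
    proof (rule integrableI_bounded)
      have "(\<integral>\<^sup>+z. ennreal (norm (case_prod H z)) \<partial>(lborel \<Otimes>\<^sub>M lborel)) = (\<integral>\<^sup>+x. \<integral>\<^sup>+y. ennreal \<bar>H x y\<bar> \<partial>lborel \<partial>lborel)"
        by (subst lborel.nn_integral_fst[symmetric]) auto
      also have "\<dots> \<le> (\<integral>\<^sup>+x. \<integral>\<^sup>+y. (ennreal L * indicator (ball (0::'a) S) x) * (ennreal \<bar>u y\<bar> * indicator (ball 0 (S + r + 1)) y) \<partial>lborel \<partial>lborel)"
      proof (intro nn_integral_mono)
        fix x y :: 'a
        show "ennreal \<bar>H x y\<bar> \<le> (ennreal L * indicator (ball 0 S) x) * (ennreal \<bar>u y\<bar> * indicator (ball 0 (S + r + 1)) y)"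
        proof (cases "x \<in> ball 0 S \<and> y \<in> ball 0 (S + r + 1)")
          case True
          have "\<bar>H x y\<bar> \<le> \<bar>u y\<bar> * (L * norm (\<phi> x))" unfolding H_def abs_mult by (intro mult_left_mono L) auto
          also have "\<dots> \<le> \<bar>u y\<bar> * (L * 1)" by (intro mult_left_mono \<phi>1 L) auto
          finally show ?thesis using True L by (simp add: ennreal_leI mult.commute flip: ennreal_mult')
        next
          case False
          have "H x y = 0"
          proof (cases "x \<in> ball 0 S")
            case True
            then have "y - x \<notin> ball 0 (r + 1)" using False norm_triangle_sub[of y x] by auto
            then show ?thesis using dz by (simp add: H_def)
          next
            case False
            then have "\<phi> x = 0" by (simp add: \<phi>_def)
            then show ?thesis by (simp add: H_def linear_0[OF lin])
          qed
          then show ?thesis by simp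
        qed
      qed
      also have "\<dots> = (\<integral>\<^sup>+x. (ennreal L * indicator (ball (0::'a) S) x) \<partial>lborel) * ball_mass u (S + r + 1)"
        by (simp add: nn_integral_cmult nn_integral_multc)
      also have "\<dots> < \<infinity>"
        using u_ball_finite[of "S + r + 1"] S
        by (simp add: nn_integral_cmult_indicator ennreal_mult_less_top emeasure_ball)
      finally show "(\<integral>\<^sup>+z. ennreal (norm (case_prod H z)) \<partial>(lborel \<Otimes>\<^sub>M lborel)) < \<infinity>" .
    qed simp
    then have "(\<integral>y. (\<integral>x. H x y \<partial>lborel) \<partial>lborel) = (\<integral>x. (\<integral>y. H x y \<partial>lborel) \<partial>lborel)"
      by (rule lborel_pair.Fubini_integral)
    moreover have "(\<integral>x. H x y \<partial>lborel) = u y * ?div y" for y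
      unfolding div H_def by simp
    moreover have "(\<integral>y. H x y \<partial>lborel) = indicator (ball 0 S) x * norm (G x)" for x
    proof -
      have "(\<integral>y. H x y \<partial>lborel) = - (\<integral>y. \<rho>' (x - y) (\<phi> x) *\<^sub>R u y \<partial>lborel)"
        using odd[of "x - _"] by (simp add: H_def mult.commute flip: Bochner_Integration.integral_minus)
      also have "\<dots> = - (G x \<bullet> \<phi> x)" using Geq[of "\<phi> x" x] by (simp add: conv_def)
      also have "\<dots> = indicator (ball 0 S) x * norm (G x)"
        by (cases "G x = 0") (simp_all add: \<phi>_def sgn_div_norm dot_square_norm power2_eq_square)
      finally show ?thesis .
    qed
    ultimately have 2: "(\<integral>y. u y * ?div y \<partial>lborel) = (\<integral>x. indicator (ball 0 S) x * norm (G x) \<partial>lborel)"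
      by simp
    have Gint: "integrable lborel (\<lambda>x. indicator (ball 0 S) x * norm (G x))"
    proof (rule Bochner_Integration.integrable_bound)
      show "integrable lborel (\<lambda>x. indicator (cball 0 S) x *\<^sub>R G x)"
        by (intro borel_integrable_compact continuous_on_subset[OF Gcont]) auto
    qed (auto simp: indicator_def)
    have "(\<integral>\<^sup>+x. ennreal (norm (G x)) * indicator (ball 0 S) x \<partial>lborel) = (\<integral>\<^sup>+x. ennreal (indicator (ball 0 S) x * norm (G x)) \<partial>lborel)"
      by (intro nn_integral_cong) (auto simp: indicator_def)
    also have "\<dots> = ennreal (\<integral>x. indicator (ball 0 S) x * norm (G x) \<partial>lborel)"
      by (rule nn_integral_eq_integral[OF Gint]) auto
    finally show ?thesis using 1 2 by simp
  qed
  have "(\<integral>\<^sup>+x. ennreal (norm (G x)) \<partial>lborel) \<le> frac_variation \<alpha> f"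
    by (rule nn_integral_le_if_ball_le[OF _ ball]) simp_all
  then show ?thesis using Gcont cder[OF u_locally_integrable] unfolding Geq \<rho>_def by blast
qed

end

section \<open>The boxing inequality and the trace inequality for smooth functions\<close>

text \<open>The Jacobian c^n is at least 2^(-n). Of the two coefficients s and 1 - s along a
  segment, one is always at least 1/2.\<close>

lemma nn_integral_affine_le:
  fixes F :: "'a::euclidean_space \<Rightarrow> ennreal"
  assumes c: "1 / 2 \<le> c" and [measurable]: "F \<in> borel_measurable borel"
  shows "(\<integral>\<^sup>+x. F (t + c *\<^sub>R x) \<partial>lborel) \<le> ennreal (2 ^ DIM('a)) * (\<integral>\<^sup>+x. F x \<partial>lborel)"
proof -
  have "1 \<le> (2 * c) ^ DIM('a)" using c by (intro one_le_power) simp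
  then have "1 \<le> ennreal (2 ^ DIM('a) * c ^ DIM('a))"
    by (simp add: power_mult_distrib ennreal_1[symmetric] ennreal_leI del: ennreal_1)
  then have "(\<integral>\<^sup>+x. F (t + c *\<^sub>R x) \<partial>lborel) * 1
      \<le> (\<integral>\<^sup>+x. F (t + c *\<^sub>R x) \<partial>lborel) * ennreal (2 ^ DIM('a) * c ^ DIM('a))"
    by (rule mult_left_mono) simp
  also have "\<dots> = ennreal (2 ^ DIM('a)) * ((\<integral>\<^sup>+x. F (t + c *\<^sub>R x) \<partial>lborel) * ennreal (\<bar>c\<bar> ^ DIM('a)))"
    using c by (simp add: ennreal_mult mult_ac)
  also have "\<dots> = ennreal (2 ^ DIM('a)) * (\<integral>\<^sup>+x. F x \<partial>lborel)"
    using c by (subst nn_integral_lborel_affine) auto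
  finally show ?thesis by simp
qed

text \<open>The pairs \<open>(x, y)\<close> are treated by integrating along the segment from \<open>y\<close> to \<open>x\<close>; a point at
  parameter \<open>s\<close> depends expansively enough on \<open>x\<close> if \<open>s \<ge> 1 / 2\<close> and on \<open>y\<close> otherwise.\<close>

lemma poincare_ball:
  fixes w :: "'a::euclidean_space \<Rightarrow> real"
  assumes der: "\<And>x. (w has_derivative (\<lambda>h. H x \<bullet> h)) (at x)" and Hcont: "continuous_on UNIV H" and r: "r > 0"
  shows "(\<integral>\<^sup>+x. \<integral>\<^sup>+y. ennreal \<bar>w x - w y\<bar> * (indicator (ball a r) x * indicator (ball a r) y) \<partial>lborel \<partial>lborel)
     \<le> ennreal (2 * r * 2 ^ DIM('a)) * emeasure lborel (ball a r) * (\<integral>\<^sup>+x. ennreal (norm (H x)) * indicator (ball a r) x \<partial>lborel)"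
proof -
  define B where "B = ball a r"
  let ?b = "\<lambda>x y. indicator B x * indicator B y :: ennreal"
  have [measurable]: "B \<in> sets borel" by (simp add: B_def)
  have [measurable]: "H \<in> borel_measurable borel" using Hcont by (rule borel_measurable_continuous_onI)
  have "continuous_on UNIV w"
    using der by (auto intro!: continuous_at_imp_continuous_on has_derivative_continuous)
  then have [measurable]: "w \<in> borel_measurable borel" by (rule borel_measurable_continuous_onI)
  define h where "h x = ennreal (norm (H x))" for x
  have [measurable]: "h \<in> borel_measurable borel" unfolding h_def[abs_def] by measurable
  have convB: "y + s *\<^sub>R (x - y) \<in> B" if "x \<in> B" "y \<in> B" "s \<in> {0..1}" for x y s
    using that convexD_alt[of B y x s] by (simp add: B_def algebra_simps)
  have seg: "ennreal \<bar>w x - w y\<bar> \<le> (\<integral>\<^sup>+s. ennreal (2 * r) * h (y + s *\<^sub>R (x - y)) * indicator {0..1} s \<partial>lborel)"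
    if x: "x \<in> B" and y: "y \<in> B" for x y
  proof -
    define g' where "g' s = H (y + s *\<^sub>R (x - y)) \<bullet> (x - y)" for s :: real
    have "(LBINT s. indicator {0..1} s *\<^sub>R g' s) = w (y + 1 *\<^sub>R (x - y)) - w (y + 0 *\<^sub>R (x - y))"
    proof (rule integral_FTC_Icc)
      show "continuous_on {0..1} g'" unfolding g'_def
        by (intro continuous_intros continuous_on_compose2[OF Hcont]) auto
      fix s :: real
      have "((\<lambda>s. y + s *\<^sub>R (x - y)) has_derivative (\<lambda>c. c *\<^sub>R (x - y))) (at s within {0..1})"
        by (auto intro!: derivative_eq_intros)
      from has_derivative_compose[OF this der]
      show "((\<lambda>s. w (y + s *\<^sub>R (x - y))) has_vector_derivative g' s) (at s within {0..1})"
        by (simp add: has_vector_derivative_def g'_def)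
    qed simp
    then have "ennreal \<bar>w x - w y\<bar> = ennreal \<bar>LBINT s. indicator {0..1} s *\<^sub>R g' s\<bar>" by simp
    also have "\<dots> \<le> (\<integral>\<^sup>+s. ennreal \<bar>indicator {0..1} s *\<^sub>R g' s\<bar> \<partial>lborel)"
      by (rule ennreal_abs_integral_le_nn_integral)
    also have "\<dots> \<le> (\<integral>\<^sup>+s. ennreal (2 * r) * h (y + s *\<^sub>R (x - y)) * indicator {0..1} s \<partial>lborel)"
    proof (rule nn_integral_mono)
      fix s :: real
      have "norm (x - y) \<le> 2 * r"
        using x y dist_triangle2[of x y a] by (auto simp: B_def dist_norm[symmetric] dist_commute)
      then have "\<bar>g' s\<bar> \<le> norm (H (y + s *\<^sub>R (x - y))) * (2 * r)"
        unfolding g'_def by (intro order_trans[OF Cauchy_Schwarz_ineq2] mult_left_mono) auto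
      then show "ennreal \<bar>indicator {0..1} s *\<^sub>R g' s\<bar> \<le> ennreal (2 * r) * h (y + s *\<^sub>R (x - y)) * indicator {0..1} s"
        using r by (auto simp: indicator_def h_def mult.commute ennreal_leI simp flip: ennreal_mult')
    qed
    finally show ?thesis .
  qed
  define I where "I = (\<integral>\<^sup>+x. h x * indicator B x \<partial>lborel)"
  define K where "K s = (\<integral>\<^sup>+x. \<integral>\<^sup>+y. h (y + s *\<^sub>R (x - y)) * ?b x y \<partial>lborel \<partial>lborel)" for s
  \<comment> \<open>By convexity the intermediate point lies in B. The indicator of the variable
    that is integrated first can therefore be exchanged for the indicator of the intermediate point,
    and that variable then ranges over the whole space.\<close>
  define F where "F x = h x * indicator B x" for x
  have [measurable]: "F \<in> borel_measurable borel" unfolding F_def[abs_def] by measurable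
  have IF: "I = (\<integral>\<^sup>+x. F x \<partial>lborel)" by (simp add: I_def F_def)
  have half: "(\<integral>\<^sup>+y. \<integral>\<^sup>+x. F ((1 - s) *\<^sub>R y + s *\<^sub>R x) * indicator B y \<partial>lborel \<partial>lborel)
      \<le> ennreal (2 ^ DIM('a)) * emeasure lborel B * I" if "1 / 2 \<le> s" for s
  proof -
    have "(\<integral>\<^sup>+y. \<integral>\<^sup>+x. F ((1 - s) *\<^sub>R y + s *\<^sub>R x) * indicator B y \<partial>lborel \<partial>lborel)
        = (\<integral>\<^sup>+y. (\<integral>\<^sup>+x. F ((1 - s) *\<^sub>R y + s *\<^sub>R x) \<partial>lborel) * indicator B y \<partial>lborel)"
      by (intro nn_integral_cong nn_integral_multc) measurable
    also have "\<dots> \<le> (\<integral>\<^sup>+y. (ennreal (2 ^ DIM('a)) * I) * indicator B y \<partial>lborel)"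
      unfolding IF by (intro nn_integral_mono mult_right_mono nn_integral_affine_le that) auto
    also have "\<dots> = ennreal (2 ^ DIM('a)) * emeasure lborel B * I"
      by (subst nn_integral_cmult_indicator) (auto simp: mult_ac)
    finally show ?thesis .
  qed
  have K: "K s \<le> ennreal (2 ^ DIM('a)) * emeasure lborel B * I" if s: "s \<in> {0..1}" for s
  proof (cases "s \<ge> 1 / 2")
    case True
    have "K s = (\<integral>\<^sup>+y. \<integral>\<^sup>+x. h (y + s *\<^sub>R (x - y)) * ?b x y \<partial>lborel \<partial>lborel)"
      unfolding K_def by (rule lborel_pair.Fubini') measurable
    also have "\<dots> \<le> (\<integral>\<^sup>+y. \<integral>\<^sup>+x. F ((1 - s) *\<^sub>R y + s *\<^sub>R x) * indicator B y \<partial>lborel \<partial>lborel)"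
      using convB[OF _ _ s] by (intro nn_integral_mono) (auto simp: F_def indicator_def algebra_simps)
    also note half[OF True]
    finally show ?thesis .
  next
    case False
    have "K s \<le> (\<integral>\<^sup>+x. \<integral>\<^sup>+y. F ((1 - (1 - s)) *\<^sub>R x + (1 - s) *\<^sub>R y) * indicator B x \<partial>lborel \<partial>lborel)"
      unfolding K_def using convB[OF _ _ s]
      by (intro nn_integral_mono) (auto simp: F_def indicator_def algebra_simps)
    also have "\<dots> \<le> ennreal (2 ^ DIM('a)) * emeasure lborel B * I" using False by (intro half) simp
    finally show ?thesis .
  qed
  have "(\<integral>\<^sup>+x. \<integral>\<^sup>+y. ennreal \<bar>w x - w y\<bar> * ?b x y \<partial>lborel \<partial>lborel)
    \<le> (\<integral>\<^sup>+x. \<integral>\<^sup>+y. \<integral>\<^sup>+s. ennreal (2 * r) * h (y + s *\<^sub>R (x - y)) * indicator {0..1} s * ?b x y \<partial>lborel \<partial>lborel \<partial>lborel)"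
  proof (intro nn_integral_mono)
    fix x y :: 'a
    have "ennreal \<bar>w x - w y\<bar> * ?b x y
       \<le> (\<integral>\<^sup>+s. ennreal (2 * r) * h (y + s *\<^sub>R (x - y)) * indicator {0..1} s \<partial>lborel) * ?b x y"
      using seg[of x y] by (auto simp: indicator_def)
    also have "\<dots> = (\<integral>\<^sup>+s. ennreal (2 * r) * h (y + s *\<^sub>R (x - y)) * indicator {0..1} s * ?b x y \<partial>lborel)"
      by (rule nn_integral_multc[symmetric]) measurable
    finally show "ennreal \<bar>w x - w y\<bar> * ?b x y \<le> \<dots>" .
  qed
  also have "\<dots> = (\<integral>\<^sup>+x. \<integral>\<^sup>+s. \<integral>\<^sup>+y. ennreal (2 * r) * h (y + s *\<^sub>R (x - y)) * indicator {0..1} s * ?b x y \<partial>lborel \<partial>lborel \<partial>lborel)"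
    by (intro nn_integral_cong lborel_pair.Fubini') measurable
  also have "\<dots> = (\<integral>\<^sup>+s. \<integral>\<^sup>+x. \<integral>\<^sup>+y. ennreal (2 * r) * h (y + s *\<^sub>R (x - y)) * indicator {0..1} s * ?b x y \<partial>lborel \<partial>lborel \<partial>lborel)"
    by (rule lborel_pair.Fubini') measurable
  also have "\<dots> = (\<integral>\<^sup>+s. (ennreal (2 * r) * indicator {0..1} s) * K s \<partial>lborel)"
  proof (intro nn_integral_cong)
    fix s :: real
    have "(\<integral>\<^sup>+x. \<integral>\<^sup>+y. ennreal (2 * r) * h (y + s *\<^sub>R (x - y)) * indicator {0..1} s * ?b x y \<partial>lborel \<partial>lborel)
       = (\<integral>\<^sup>+x. \<integral>\<^sup>+y. (ennreal (2 * r) * indicator {0..1} s) * (h (y + s *\<^sub>R (x - y)) * ?b x y) \<partial>lborel \<partial>lborel)"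
      by (simp add: mult_ac)
    also have "\<dots> = (\<integral>\<^sup>+x. (ennreal (2 * r) * indicator {0..1} s) * (\<integral>\<^sup>+y. h (y + s *\<^sub>R (x - y)) * ?b x y \<partial>lborel) \<partial>lborel)"
      by (intro nn_integral_cong nn_integral_cmult) measurable
    also have "\<dots> = (ennreal (2 * r) * indicator {0..1} s) * K s"
      unfolding K_def by (rule nn_integral_cmult) measurable
    finally show "(\<integral>\<^sup>+x. \<integral>\<^sup>+y. ennreal (2 * r) * h (y + s *\<^sub>R (x - y)) * indicator {0..1} s * ?b x y \<partial>lborel \<partial>lborel)
       = \<dots>" .
  qed
  also have "\<dots> \<le> (\<integral>\<^sup>+s. (ennreal (2 * r) * (ennreal (2 ^ DIM('a)) * emeasure lborel B * I)) * indicator {0..1::real} s \<partial>lborel)"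
    using K by (intro nn_integral_mono) (auto simp: indicator_def intro!: mult_left_mono)
  also have "\<dots> = ennreal (2 * r) * (ennreal (2 ^ DIM('a)) * emeasure lborel B * I)"
    by (subst nn_integral_cmult_indicator) auto
  also have "\<dots> = ennreal (2 * r * 2 ^ DIM('a)) * emeasure lborel B * I"
    using r by (simp add: ennreal_mult mult_ac)
  finally show ?thesis by (simp add: B_def I_def h_def)
qed

text \<open>\<open>smooth_step k\<close> is a smooth approximation of the indicator of \<open>{0<..}\<close>; the shift by \<open>k\<close> makes
  it converge to \<open>0\<close> at the origin, so that the limit is exact at every point.\<close>

definition smooth_step :: "nat \<Rightarrow> real \<Rightarrow> real" where
  "smooth_step k s = 1 / 2 + arctan ((real k)\<^sup>2 * s - real k) / pi"

definition smooth_step' :: "nat \<Rightarrow> real \<Rightarrow> real" where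
  "smooth_step' k s = (real k)\<^sup>2 / (pi * (1 + ((real k)\<^sup>2 * s - real k)\<^sup>2))"

lemma smooth_step_deriv: "(smooth_step k has_field_derivative smooth_step' k s) (at s)"
proof -
  have "((\<lambda>s. (real k)\<^sup>2 * s - real k) has_field_derivative (real k)\<^sup>2) (at s)"
    by (auto intro!: derivative_eq_intros)
  from DERIV_add[OF DERIV_const DERIV_cdivide[OF DERIV_chain2[OF DERIV_arctan this]]]
  show ?thesis
    unfolding smooth_step_def[abs_def] smooth_step'_def by (rule DERIV_cong) (simp add: divide_inverse)
qed

lemma smooth_step'_nonneg: "smooth_step' k s \<ge> 0"
  unfolding smooth_step'_def by (auto intro!: divide_nonneg_nonneg mult_nonneg_nonneg add_nonneg_nonneg)

lemma continuous_on_smooth_step': "continuous_on S (smooth_step' k)"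
proof -
  have "pi * (1 + ((real k)\<^sup>2 * s - real k)\<^sup>2) \<noteq> 0" for s
    by (simp add: add_nonneg_eq_0_iff)
  then show ?thesis unfolding smooth_step'_def by (intro continuous_intros) auto
qed

lemma smooth_step'_borel [measurable]: "smooth_step' k \<in> borel_measurable borel"
  unfolding smooth_step'_def[abs_def] by measurable

lemma smooth_step_borel [measurable]: "smooth_step k \<in> borel_measurable borel"
  unfolding smooth_step_def[abs_def] by measurable

lemma smooth_step_le_1: "smooth_step k s \<le> 1"
  using arctan_ubound[of "(real k)\<^sup>2 * s - real k"] by (simp add: smooth_step_def field_simps)

lemma smooth_step_tendsto: "(\<lambda>k. smooth_step k s) \<longlonglongrightarrow> (if s > 0 then 1 else 0)"
proof (cases "s > 0")
  case True
  have "filterlim (\<lambda>k. real k * (real k * s - 1)) at_top sequentially"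
  proof (rule filterlim_at_top_mult_at_top[OF filterlim_real_sequentially])
    have "filterlim (\<lambda>k. - 1 + s * real k) at_top sequentially"
      by (intro filterlim_tendsto_add_at_top[OF tendsto_const] filterlim_tendsto_pos_mult_at_top[OF tendsto_const True filterlim_real_sequentially])
    then show "filterlim (\<lambda>k. real k * s - 1) at_top sequentially" by (simp add: algebra_simps)
  qed
  then have "(\<lambda>k. arctan (real k * (real k * s - 1))) \<longlonglongrightarrow> pi / 2"
    by (rule filterlim_compose[OF tendsto_arctan_at_top])
  then have "(\<lambda>k. 1 / 2 + arctan (real k * (real k * s - 1)) / pi) \<longlonglongrightarrow> 1 / 2 + (pi / 2) / pi"
    by (intro tendsto_intros) auto
  then show ?thesis using True by (simp add: smooth_step_def power2_eq_square algebra_simps)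
next
  case False
  have "filterlim (\<lambda>k. real k + (real k)\<^sup>2 * (- s)) at_top sequentially"
    by (rule filterlim_at_top_mono[OF filterlim_real_sequentially]) (use False in \<open>auto intro!: always_eventually mult_nonneg_nonpos\<close>)
  then have "filterlim (\<lambda>k. (real k)\<^sup>2 * s - real k) at_bot sequentially"
    unfolding filterlim_uminus_at_bot by (simp add: algebra_simps)
  then have "(\<lambda>k. arctan ((real k)\<^sup>2 * s - real k)) \<longlonglongrightarrow> - (pi / 2)"
    by (rule filterlim_compose[OF tendsto_arctan_at_bot])
  then have "(\<lambda>k. 1 / 2 + arctan ((real k)\<^sup>2 * s - real k) / pi) \<longlonglongrightarrow> 1 / 2 + (- (pi / 2)) / pi"
    by (intro tendsto_intros) auto
  then show ?thesis using False by (simp add: smooth_step_def)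
qed

text \<open>The integral over t is the increment of a primitive between 0 and infinity, equal to
  \<open>smooth_step k s\<close>. This is the unit mass that stands in for the coarea
  formula.\<close>

lemma nn_integral_smooth_step'_le: "(\<integral>\<^sup>+t. ennreal (smooth_step' k (s - t)) * indicator {0..} t \<partial>lborel) \<le> 1"
\<comment> \<open>For k = 0 the step is the constant 1/2 and does not tend to 0, but its derivative
  vanishes.\<close>
proof (cases "k = 0")
  case True
  then show ?thesis by (simp add: smooth_step'_def)
next
  case False
  have "(\<integral>\<^sup>+t. ennreal (smooth_step' k (s - t)) * indicator {0..} t \<partial>lborel) = ennreal (0 - (- smooth_step k (s - 0)))"
  proof (rule nn_integral_FTC_atLeast)
    show "((\<lambda>t. - smooth_step k (s - t)) has_real_derivative smooth_step' k (s - t)) (at t)" for t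
      by (auto intro!: derivative_eq_intros DERIV_chain'[OF _ smooth_step_deriv])
    have "filterlim (\<lambda>t. - ((real k)\<^sup>2 * s - real k) + (real k)\<^sup>2 * t) at_top at_top"
      using False by (intro filterlim_tendsto_add_at_top[OF tendsto_const] filterlim_tendsto_pos_mult_at_top[OF tendsto_const _ filterlim_ident]) auto
    then have "filterlim (\<lambda>t. (real k)\<^sup>2 * (s - t) - real k) at_bot at_top"
      unfolding filterlim_uminus_at_bot by (simp add: algebra_simps)
    then have "((\<lambda>t. arctan ((real k)\<^sup>2 * (s - t) - real k)) \<longlongrightarrow> - (pi / 2)) at_top"
      by (rule filterlim_compose[OF tendsto_arctan_at_bot])
    then have "((\<lambda>t. - (1 / 2 + arctan ((real k)\<^sup>2 * (s - t) - real k) / pi)) \<longlongrightarrow> - (1 / 2 + (- (pi / 2)) / pi)) at_top"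
      by (intro tendsto_intros) auto
    then show "((\<lambda>t. - smooth_step k (s - t)) \<longlongrightarrow> 0) at_top" by (simp add: smooth_step_def)
  qed (auto simp: smooth_step'_nonneg)
  also have "\<dots> \<le> 1" using smooth_step_le_1[of k s] by simp
  finally show ?thesis .
qed

text \<open>The power of 2 is 2^(n + 1) * 2 * (2 * 2^n): the inverses of the two densities times the
  Poincare constant per unit radius.\<close>

abbreviation radius_const :: "nat \<Rightarrow> real" where
  "radius_const n \<equiv> 2 ^ (2 * n + 3) / unit_ball_vol (real n)"

text \<open>The factor \<open>5\<close> comes from Vitali's lemma, the rest from the Poincare inequality and the densities
  \<open>2 powr (- n - 1)\<close> and \<open>1 / 2\<close> of a superlevel set and its complement.\<close>

abbreviation boxing_const :: "nat \<Rightarrow> real" where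
  "boxing_const n \<equiv> 5 powr (real n - 1) * radius_const n"

text \<open>The condition \<open>vanish\<close> says that the means of |v| over balls around the
  origin tend to 0; its purpose is to make superlevel sets at positive levels sparse at large
  scales.\<close>

locale C1_vanishing =
  fixes v :: "'a::euclidean_space \<Rightarrow> real" and G :: "'a \<Rightarrow> 'a"
  assumes v_der: "\<And>x. (v has_derivative (\<lambda>h. G x \<bullet> h)) (at x)" and G_cont: "continuous_on UNIV G"
    and vanish: "\<And>\<delta>. \<delta> > 0 \<Longrightarrow> \<exists>R0>0. \<forall>R\<ge>R0. ball_mass v R \<le> ennreal (\<delta> * R ^ DIM('a))"
begin

abbreviation level_density :: "nat \<Rightarrow> real \<Rightarrow> 'a \<Rightarrow> ennreal" where
  "level_density k t x \<equiv> ennreal (smooth_step' k (v x - t) * norm (G x))"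

abbreviation total_variation :: ennreal where
  "total_variation \<equiv> \<integral>\<^sup>+x. ennreal (norm (G x)) \<partial>lborel"

text \<open>The integrand is the norm of the gradient of \<open>smooth_step k (v x - t)\<close>,
  whose limit in k is the indicator of {v > t}. As a lower limit this is superadditive over disjoint
  sets, the one direction of additivity that the covering argument uses.\<close>

definition level_perimeter :: "real \<Rightarrow> 'a set \<Rightarrow> ennreal" where
  "level_perimeter t B = liminf (\<lambda>k. \<integral>\<^sup>+x. level_density k t x * indicator B x \<partial>lborel)"

lemma v_cont: "continuous_on UNIV v"
  using v_der by (auto intro!: continuous_at_imp_continuous_on has_derivative_continuous)

lemma v_borel [measurable]: "v \<in> borel_measurable borel"
  using v_cont by (rule borel_measurable_continuous_onI)

lemma G_borel [measurable]: "G \<in> borel_measurable borel"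
  using G_cont by (rule borel_measurable_continuous_onI)

lemma superlevel_open: "open {x. t < v x}"
  using v_cont by (intro open_Collect_less continuous_on_const) auto

text \<open>The left side is the integral of the product of the indicators of E at x and of its
  complement at y, and that product is bounded by the limit of |w k x - w k y|. The Poincare
  inequality in its two-point form then applies with no mean values, and Fatou's lemma, once in each
  variable, gives the limit.\<close>

lemma relative_isoperimetric:
  assumes r: "r > 0"
  shows "emeasure lborel (ball a r \<inter> {x. t < v x}) * emeasure lborel (ball a r - {x. t < v x})
     \<le> ennreal (2 * r * 2 ^ DIM('a)) * emeasure lborel (ball a r) * level_perimeter t (ball a r)"
proof -
  define B where "B = ball a r"
  let ?b = "\<lambda>x y. indicator B x * indicator B y :: ennreal"
  define E where "E = {x. t < v x}"
  have [measurable]: "B \<in> sets borel" "E \<in> sets borel" using superlevel_open by (auto simp: B_def E_def)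
  define w where "w k x = smooth_step k (v x - t)" for k x
  have [measurable]: "w k \<in> borel_measurable borel" for k unfolding w_def[abs_def] by measurable
  define c where "c = ennreal (2 * r * 2 ^ DIM('a)) * emeasure lborel B"
  \<comment> \<open>Multiplication by a finite constant is continuous on \<open>ennreal\<close>, so
    c can be taken out of the lower limit below.\<close>
  have c: "c < top" unfolding c_def B_def using r by (simp add: emeasure_ball ennreal_mult_less_top)
  have "emeasure lborel (B \<inter> E) * emeasure lborel (B - E) = (\<integral>\<^sup>+x. \<integral>\<^sup>+y. indicator (B \<inter> E) x * indicator (B - E) y \<partial>lborel \<partial>lborel)"
    by (simp add: nn_integral_cmult nn_integral_multc)
  also have "\<dots> \<le> (\<integral>\<^sup>+x. \<integral>\<^sup>+y. liminf (\<lambda>k. ennreal \<bar>w k x - w k y\<bar> * ?b x y) \<partial>lborel \<partial>lborel)"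
  proof (intro nn_integral_mono)
    fix x y :: 'a
    show "indicator (B \<inter> E) x * indicator (B - E) y \<le> liminf (\<lambda>k. ennreal \<bar>w k x - w k y\<bar> * ?b x y)"
    proof (cases "x \<in> B \<inter> E \<and> y \<in> B - E")
      case True
      have "(\<lambda>k. \<bar>w k x - w k y\<bar>) \<longlonglongrightarrow> \<bar>(if v x - t > 0 then 1 else 0) - (if v y - t > 0 then 1 else 0)\<bar>"
        unfolding w_def by (intro tendsto_intros smooth_step_tendsto)
      then have "(\<lambda>k. \<bar>w k x - w k y\<bar>) \<longlonglongrightarrow> 1" using True by (simp add: E_def)
      then have "liminf (\<lambda>k. ennreal \<bar>w k x - w k y\<bar>) = ennreal 1"
        by (intro lim_imp_Liminf tendsto_ennrealI) simp_all
      then show ?thesis using True by simp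
    qed (auto simp: indicator_def)
  qed
  also have "\<dots> \<le> (\<integral>\<^sup>+x. liminf (\<lambda>k. \<integral>\<^sup>+y. ennreal \<bar>w k x - w k y\<bar> * ?b x y \<partial>lborel) \<partial>lborel)"
    by (intro nn_integral_mono nn_integral_liminf) measurable
  also have "\<dots> \<le> liminf (\<lambda>k. \<integral>\<^sup>+x. \<integral>\<^sup>+y. ennreal \<bar>w k x - w k y\<bar> * ?b x y \<partial>lborel \<partial>lborel)"
    by (intro nn_integral_liminf) measurable
  also have "\<dots> \<le> liminf (\<lambda>k. c * (\<integral>\<^sup>+x. level_density k t x * indicator B x \<partial>lborel))"
  proof (intro Liminf_mono always_eventually allI)
    fix k
    have "(w k has_derivative (\<lambda>h. (smooth_step' k (v x - t) *\<^sub>R G x) \<bullet> h)) (at x)" for x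
    proof -
      have "((\<lambda>x. v x - t) has_derivative (\<lambda>h. G x \<bullet> h)) (at x)"
        by (auto intro!: derivative_eq_intros v_der)
      from has_derivative_compose[OF this smooth_step_deriv[unfolded has_field_derivative_def]]
      show ?thesis unfolding w_def by simp
    qed
    moreover have "continuous_on UNIV (\<lambda>x. smooth_step' k (v x - t) *\<^sub>R G x)"
      by (intro continuous_intros G_cont v_cont continuous_on_compose2[OF continuous_on_smooth_step'[of UNIV]]) auto
    ultimately have "(\<integral>\<^sup>+x. \<integral>\<^sup>+y. ennreal \<bar>w k x - w k y\<bar> * ?b x y \<partial>lborel \<partial>lborel)
        \<le> c * (\<integral>\<^sup>+x. ennreal (norm (smooth_step' k (v x - t) *\<^sub>R G x)) * indicator B x \<partial>lborel)"
      unfolding c_def B_def using r by (rule poincare_ball)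
    then show "(\<integral>\<^sup>+x. \<integral>\<^sup>+y. ennreal \<bar>w k x - w k y\<bar> * ?b x y \<partial>lborel \<partial>lborel)
        \<le> c * (\<integral>\<^sup>+x. level_density k t x * indicator B x \<partial>lborel)"
      by (simp add: smooth_step'_nonneg)
  qed
  also have "\<dots> = c * level_perimeter t B"
    unfolding level_perimeter_def
    by (rule Liminf_compose_continuous_mono)
       (auto intro!: ennreal_continuous_on_cmult c continuous_on_id monoI mult_left_mono)
  finally show ?thesis by (simp add: c_def B_def E_def)
qed

text \<open>With density at least 2^(-n - 1) for the set and 1/2 for its complement, the left side
  of \<open>relative_isoperimetric\<close> is a fixed multiple of r^(2 n) at least, against r^(n +
  1) times the perimeter on the right.\<close>

lemma radius_power_le_level_perimeter:
  assumes r: "r > 0" and in_E: "unit_ball_vol (real DIM('a)) * r ^ DIM('a) \<le> 2 ^ (DIM('a) + 1) * measure lborel (ball a r \<inter> {x. t < v x})"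
    and out_E: "2 * measure lborel (ball a r \<inter> {x. t < v x}) \<le> unit_ball_vol (real DIM('a)) * r ^ DIM('a)"
  shows "ennreal (r powr (real DIM('a) - 1)) \<le> ennreal (radius_const DIM('a)) * level_perimeter t (ball a r)"
proof -
  define B where "B = ball a r"
  define E where "E = {x. t < v x}"
  define \<omega> where "\<omega> = unit_ball_vol (real DIM('a))"
  have \<omega>: "\<omega> > 0" by (simp add: \<omega>_def unit_ball_vol_pos)
  have [measurable]: "B \<in> sets borel" "E \<in> sets borel" using superlevel_open by (auto simp: B_def E_def)
  have fin: "emeasure lborel S < \<infinity>" if "S \<subseteq> B" for S
    by (rule emeasure_bounded_finite) (use that bounded_ball bounded_subset B_def in blast)
  define m where "m = measure lborel (B \<inter> E)"
  have mB: "measure lborel B = \<omega> * r ^ DIM('a)" using r \<omega> by (simp add: measure_def B_def emeasure_ball \<omega>_def)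
  have m1: "\<omega> * r ^ DIM('a) \<le> 2 ^ (DIM('a) + 1) * m" and m2: "2 * m \<le> \<omega> * r ^ DIM('a)"
    using in_E out_E by (simp_all add: m_def B_def E_def \<omega>_def)
  have e1: "emeasure lborel (B \<inter> E) = ennreal m"
    unfolding m_def by (rule emeasure_eq_ennreal_measure) (use fin[of "B \<inter> E"] in auto)
  have e2: "emeasure lborel (B - E) = ennreal (\<omega> * r ^ DIM('a) - m)"
  proof -
    have "measure lborel (B - B \<inter> E) = measure lborel B - measure lborel (B \<inter> E)"
      by (rule measure_Diff) (use fin[of B] in auto)
    moreover have "B - B \<inter> E = B - E" by auto
    ultimately have "measure lborel (B - E) = \<omega> * r ^ DIM('a) - m" by (simp add: mB m_def)
    moreover have "emeasure lborel (B - E) = ennreal (measure lborel (B - E))"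
      by (rule emeasure_eq_ennreal_measure) (use fin[of "B - E"] in auto)
    ultimately show ?thesis by simp
  qed
  have m0: "m \<ge> 0" by (simp add: m_def)
  have iso: "ennreal m * ennreal (\<omega> * r ^ DIM('a) - m)
     \<le> ennreal (2 * r * 2 ^ DIM('a)) * ennreal (\<omega> * r ^ DIM('a)) * level_perimeter t B"
    using relative_isoperimetric[OF r, of a t] r unfolding e1[unfolded B_def E_def] e2[unfolded B_def E_def] B_def
    by (simp add: emeasure_ball \<omega>_def)
  show ?thesis
  proof (cases "level_perimeter t B")
    case (real p)
    define n where "n = DIM('a)"
    have n: "n \<ge> 1" by (simp add: n_def DIM_positive Suc_leI)
    have "ennreal (m * (\<omega> * r ^ n - m)) \<le> ennreal (2 * r * 2 ^ n * (\<omega> * r ^ n) * p)"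
      using iso m0 r \<omega> real m2 unfolding n_def real by (simp add: ennreal_mult)
    then have 1: "m * (\<omega> * r ^ n - m) \<le> 2 * r * 2 ^ n * (\<omega> * r ^ n) * p"
      using r \<omega> real by (subst (asm) ennreal_le_iff) auto
    have "(\<omega> * r ^ n / 2 ^ (n + 1)) * (\<omega> * r ^ n / 2) \<le> m * (\<omega> * r ^ n - m)"
      using m1 m2 m0 r \<omega> unfolding n_def by (intro mult_mono) (auto simp: field_simps)
    with 1 have "(\<omega> * r ^ n / 2 ^ (n + 1)) * (\<omega> * r ^ n / 2) \<le> 2 * r * 2 ^ n * (\<omega> * r ^ n) * p" by linarith
    then have "(\<omega> * r ^ n) * (\<omega> * r ^ n) \<le> (\<omega> * r ^ n) * (2 ^ (2 * n + 3) * r * p)"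
      by (simp add: field_simps power_add power_mult power2_eq_square)
    moreover have "\<omega> * r ^ n > 0" using r \<omega> by simp
    ultimately have "\<omega> * r ^ n \<le> 2 ^ (2 * n + 3) * r * p" by (rule mult_left_le_imp_le)
    moreover have "r ^ n = r * r ^ (n - 1)" using n by (cases n) auto
    ultimately have "r * (\<omega> * r ^ (n - 1)) \<le> r * (2 ^ (2 * n + 3) * p)" by (simp add: mult_ac)
    then have "\<omega> * r ^ (n - 1) \<le> 2 ^ (2 * n + 3) * p" using r by (rule mult_left_le_imp_le)
    moreover have "r powr (real n - 1) = r ^ (n - 1)" using r n by (simp add: powr_realpow[symmetric] of_nat_diff)
    ultimately have "r powr (real n - 1) \<le> 2 ^ (2 * n + 3) / \<omega> * p"
      using \<omega> by (simp add: field_simps)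
    moreover have "unit_ball_vol (real n) = \<omega>" by (simp add: \<omega>_def n_def)
    ultimately show ?thesis using real \<omega> unfolding B_def[symmetric] real n_def[symmetric]
      by (simp add: ennreal_leI flip: ennreal_mult')
  next
    case top
    then show ?thesis using \<omega>[unfolded \<omega>_def, THEN less_imp_neq] by (simp add: B_def ennreal_mult_top)
  qed
qed

text \<open>Markov's inequality on a ball around x, enlarged to one around the origin. For |x| < N
  \<le> S doubling the radius is enough, which makes the scale uniform in x.\<close>

lemma superlevel_density_small:
  assumes t: "t > 0" and N: "N > 0"
  shows "\<exists>R>0. \<forall>S\<ge>R. \<forall>x\<in>ball 0 N. 2 * measure lborel (ball x S \<inter> {x. t < v x}) < unit_ball_vol (real DIM('a)) * S ^ DIM('a)"
proof -
  define \<omega> where "\<omega> = unit_ball_vol (real DIM('a))"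
  have \<omega>: "\<omega> > 0" by (simp add: \<omega>_def unit_ball_vol_pos)
  define E where "E = {x. t < v x}"
  have [measurable]: "E \<in> sets borel" using superlevel_open by (auto simp: E_def)
  \<comment> \<open>After the factor 2^n for the doubled radius and the division by t, a density of
    1/4 remains, strictly below 1/2.\<close>
  define \<delta> where "\<delta> = t * \<omega> / (4 * 2 ^ DIM('a))"
  have "\<delta> > 0" using t \<omega> by (simp add: \<delta>_def)
  then obtain R0 where R0: "R0 > 0" "\<And>R. R \<ge> R0 \<Longrightarrow> ball_mass v R \<le> ennreal (\<delta> * R ^ DIM('a))"
    using vanish by blast
  have "2 * measure lborel (ball x S \<inter> E) < \<omega> * S ^ DIM('a)" if S: "S \<ge> max R0 N" and x: "x \<in> ball 0 N" for S x
  proof -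
    have S0: "S > 0" "S \<ge> N" "S \<ge> R0" using S R0 by auto
    have fin: "emeasure lborel (ball x S \<inter> E) \<noteq> top"
      using emeasure_bounded_finite[of "ball x S \<inter> E"] bounded_ball bounded_subset by (metis inf_le1 infinity_ennreal_def less_irrefl)
    have "ennreal t * emeasure lborel (ball x S \<inter> E) = (\<integral>\<^sup>+y. ennreal t * indicator (ball x S \<inter> E) y \<partial>lborel)"
      by (rule nn_integral_cmult_indicator[symmetric]) measurable
    also have "\<dots> \<le> ball_mass v (2 * S)"
    proof (rule nn_integral_mono)
      fix y
      have "y \<in> ball 0 (2 * S)" if "y \<in> ball x S"
        using that x S0 norm_triangle_sub[of y x] by (simp add: dist_norm norm_minus_commute)
      then show "ennreal t * indicator (ball x S \<inter> E) y \<le> ennreal \<bar>v y\<bar> * indicator (ball 0 (2 * S)) y"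
        by (auto simp: indicator_def E_def intro!: ennreal_leI)
    qed
    also have "\<dots> \<le> ennreal (\<delta> * (2 * S) ^ DIM('a))" using S0 by (intro R0) auto
    finally have "ennreal (t * measure lborel (ball x S \<inter> E)) \<le> ennreal (\<delta> * (2 * S) ^ DIM('a))"
      using t by (simp add: emeasure_eq_ennreal_measure[OF fin] ennreal_mult')
    then have "t * measure lborel (ball x S \<inter> E) \<le> \<delta> * (2 * S) ^ DIM('a)"
      using \<open>\<delta> > 0\<close> S0 by (subst (asm) ennreal_le_iff) auto
    also have "\<dots> = t * (\<omega> * S ^ DIM('a) / 4)" by (simp add: \<delta>_def power_mult_distrib field_simps)
    finally have "measure lborel (ball x S \<inter> E) \<le> \<omega> * S ^ DIM('a) / 4" using t by simp
    moreover have "\<omega> * S ^ DIM('a) > 0" using \<omega> S0 by simp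
    ultimately show ?thesis by linarith
  qed
  then show ?thesis using R0 unfolding E_def \<omega>_def by (intro exI[of _ "max R0 N"]) auto
qed

text \<open>A stopping argument over dyadic radii. At the first radius 2 s where the density of E is
  below 1/2, the complement has density at least 1/2; at s the density of E was still at least 1/2,
  and doubling the radius divides it by at most 2^n. The common bound on the radii, available
  because x stays in a fixed ball, is what Vitali's lemma asks for.\<close>

lemma boxing_radius:
  assumes t: "t > 0" and N: "N > 0"
  shows "\<exists>b. \<forall>x\<in>ball 0 N \<inter> {x. t < v x}. \<exists>r. 0 < r \<and> r \<le> b \<and>
     ennreal (r powr (real DIM('a) - 1)) \<le> ennreal (radius_const DIM('a)) * level_perimeter t (ball x r)"
proof -
  define \<omega> where "\<omega> = unit_ball_vol (real DIM('a))"
  have \<omega>: "\<omega> > 0" by (simp add: \<omega>_def unit_ball_vol_pos)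
  define E where "E = {x. t < v x}"
  have [measurable]: "E \<in> sets borel" using superlevel_open by (auto simp: E_def)
  obtain R where R: "R > 0" "\<And>S x. S \<ge> R \<Longrightarrow> x \<in> ball 0 N \<Longrightarrow> 2 * measure lborel (ball x S \<inter> E) < \<omega> * S ^ DIM('a)"
    using superlevel_density_small[OF t N] unfolding E_def \<omega>_def by blast
  have "\<exists>r. 0 < r \<and> r \<le> 2 * R \<and>
     ennreal (r powr (real DIM('a) - 1)) \<le> ennreal (radius_const DIM('a)) * level_perimeter t (ball x r)"
    if x: "x \<in> ball 0 N" "x \<in> E" for x
  proof -
    obtain r0 where r0: "r0 > 0" "ball x r0 \<subseteq> E"
      using superlevel_open[of t] x openE unfolding E_def by metis
    \<comment> \<open>Q 0 fails because the ball of radius r0 lies inside the open set E, so the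
      least index has a predecessor.\<close>
    define Q where "Q j \<longleftrightarrow> 2 * measure lborel (ball x (r0 * 2 ^ j) \<inter> E) < \<omega> * (r0 * 2 ^ j) ^ DIM('a)" for j :: nat
    obtain i :: nat where "R / r0 < 2 ^ i" using real_arch_pow[of 2 "R / r0"] by auto
    then have "Q i" unfolding Q_def using r0 by (intro R x) (auto simp: field_simps)
    define j where "j = (LEAST j. Q j)"
    have Qj: "Q j" unfolding j_def using \<open>Q i\<close> by (rule LeastI)
    have mball: "measure lborel (ball x s) = \<omega> * s ^ DIM('a)" if "s > 0" for s
      using that \<omega> by (simp add: measure_def emeasure_ball \<omega>_def)
    have "\<not> Q 0"
    proof -
      have "ball x r0 \<inter> E = ball x r0" using r0 by auto
      then show ?thesis using r0 \<omega> mball[OF r0(1)] by (simp add: Q_def)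
    qed
    then have "j \<noteq> 0" using Qj by metis
    then obtain l where l: "j = Suc l" by (cases j) auto
    then have nQ: "\<not> Q l" unfolding j_def by (metis j_def lessI not_less_Least)
    define s where "s = r0 * 2 ^ l"
    have s: "s > 0" using r0 by (simp add: s_def)
    have "s < R" using R(2)[of s x] nQ x unfolding Q_def s_def[symmetric] by (meson not_le)
    have js: "r0 * 2 ^ j = 2 * s" by (simp add: l s_def)
    show ?thesis
    proof (intro exI conjI)
      show "0 < 2 * s" using s by simp
      show "2 * s \<le> 2 * R" using \<open>s < R\<close> by simp
      have fin: "emeasure lborel (ball x (2 * s) \<inter> E) \<noteq> \<infinity>"
        using emeasure_bounded_finite[of "ball x (2 * s) \<inter> E"] bounded_ball bounded_subset by (metis inf_le1 less_irrefl)
      have "measure lborel (ball x s \<inter> E) \<le> measure lborel (ball x (2 * s) \<inter> E)"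
      proof (rule measure_mono_fmeasurable)
        show "ball x (2 * s) \<inter> E \<in> fmeasurable lborel" using fin by (intro fmeasurableI) (auto simp: less_top)
      qed (use s in auto)
      moreover have "\<omega> * s ^ DIM('a) \<le> 2 * measure lborel (ball x s \<inter> E)"
        using nQ unfolding Q_def s_def[symmetric] by simp
      ultimately have "\<omega> * s ^ DIM('a) \<le> 2 * measure lborel (ball x (2 * s) \<inter> E)" by linarith
      then have "2 ^ DIM('a) * (\<omega> * s ^ DIM('a)) \<le> 2 ^ DIM('a) * (2 * measure lborel (ball x (2 * s) \<inter> E))"
        by (rule mult_left_mono) simp
      then have in_E: "\<omega> * (2 * s) ^ DIM('a) \<le> 2 ^ (DIM('a) + 1) * measure lborel (ball x (2 * s) \<inter> E)"
        by (simp add: power_mult_distrib mult_ac)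
      have out_E: "2 * measure lborel (ball x (2 * s) \<inter> E) \<le> \<omega> * (2 * s) ^ DIM('a)"
        using Qj unfolding Q_def js by simp
      show "ennreal ((2 * s) powr (real DIM('a) - 1)) \<le> ennreal (radius_const DIM('a)) * level_perimeter t (ball x (2 * s))"
        by (rule radius_power_le_level_perimeter) (use s in_E out_E in \<open>simp_all add: E_def \<omega>_def\<close>)
    qed
  qed
  then show ?thesis unfolding E_def by (intro exI[of _ "2 * R"]) auto
qed

text \<open>The sum over the balls is written as an integral over counting measure, so that Fatou's
  lemma applies to an infinite family as well. For fixed k disjointness suffices: no point is
  counted twice.\<close>

lemma level_perimeter_disjoint_balls:
  fixes C :: "'a set"
  assumes C: "countable C" and disj: "pairwise (\<lambda>i j. disjnt (ball i (r i)) (ball j (r j))) C"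
  shows "(\<integral>\<^sup>+i. level_perimeter t (ball i (r i)) \<partial>count_space C) \<le> level_perimeter t UNIV"
proof -
  define g where "g k x = level_density k t x" for k x
  have [measurable]: "g k \<in> borel_measurable borel" for k unfolding g_def[abs_def] by measurable
  let ?N = "\<lambda>x. \<integral>\<^sup>+i. indicator (ball i (r i)) x \<partial>count_space C :: ennreal"
  have le1: "?N x \<le> 1" for x
  proof (cases "\<exists>i\<in>C. x \<in> ball i (r i)")
    case True
    then obtain i0 where i0: "i0 \<in> C" "x \<in> ball i0 (r i0)" by blast
    have "i = i0" if "i \<in> C" "x \<in> ball i (r i)" for i
      using disj that i0 unfolding pairwise_def disjnt_def by blast
    then have "?N x \<le> (\<integral>\<^sup>+i. indicator {i0} i \<partial>count_space C)"
      by (intro nn_integral_mono) (auto simp: indicator_def)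
    also have "\<dots> = emeasure (count_space C) {i0}" by (rule nn_integral_indicator) (use i0 in auto)
    also have "\<dots> = 1" using i0 by (simp add: emeasure_count_space)
    finally show ?thesis .
  next
    case False
    then have "?N x = (\<integral>\<^sup>+i. (0::ennreal) \<partial>count_space C)"
      by (intro nn_integral_cong) (auto simp: indicator_def)
    then show ?thesis by simp
  qed
  have "(\<integral>\<^sup>+i. level_perimeter t (ball i (r i)) \<partial>count_space C)
     = (\<integral>\<^sup>+i. liminf (\<lambda>k. \<integral>\<^sup>+x. g k x * indicator (ball i (r i)) x \<partial>lborel) \<partial>count_space C)"
    by (simp add: level_perimeter_def g_def)
  also have "\<dots> \<le> liminf (\<lambda>k. \<integral>\<^sup>+i. \<integral>\<^sup>+x. g k x * indicator (ball i (r i)) x \<partial>lborel \<partial>count_space C)"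
    by (rule nn_integral_liminf) simp
  also have "\<dots> \<le> liminf (\<lambda>k. \<integral>\<^sup>+x. g k x \<partial>lborel)"
  proof (intro Liminf_mono always_eventually allI)
    fix k
    have "(\<integral>\<^sup>+i. \<integral>\<^sup>+x. g k x * indicator (ball i (r i)) x \<partial>lborel \<partial>count_space C)
      = (\<integral>\<^sup>+x. \<integral>\<^sup>+i. g k x * indicator (ball i (r i)) x \<partial>count_space C \<partial>lborel)"
      by (rule nn_integral_count_space_nn_integral[symmetric]) (use C in measurable)
    also have "\<dots> = (\<integral>\<^sup>+x. g k x * ?N x \<partial>lborel)"
      by (intro nn_integral_cong nn_integral_cmult) simp
    also have "\<dots> \<le> (\<integral>\<^sup>+x. g k x * 1 \<partial>lborel)"
      by (intro nn_integral_mono mult_left_mono le1) simp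
    finally show "(\<integral>\<^sup>+i. \<integral>\<^sup>+x. g k x * indicator (ball i (r i)) x \<partial>lborel \<partial>count_space C) \<le> (\<integral>\<^sup>+x. g k x \<partial>lborel)"
      by simp
  qed
  also have "\<dots> = level_perimeter t UNIV" by (simp add: level_perimeter_def g_def)
  finally show ?thesis .
qed

text \<open>Vitali's lemma selects disjoint balls whose fivefold enlargements cover. The growth of
  \<mu> bounds each enlarged ball by a multiple of 5^(n - 1) r^(n - 1), the radius power by the
  perimeter in the original ball, and these perimeters add up.\<close>

lemma emeasure_superlevel_le:
  fixes \<mu> :: "'a measure"
  assumes [measurable_cong]: "sets \<mu> = sets borel" and t: "t > 0"
  shows "emeasure \<mu> {x. t < v x} \<le> ennreal (boxing_const DIM('a))
     * growth_norm (real DIM('a) - 1) \<mu> * level_perimeter t UNIV"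
proof -
  define E where "E = {x. t < v x}"
  have [measurable]: "E \<in> sets borel" using superlevel_open by (auto simp: E_def)
  have Emu: "E \<in> sets \<mu>" by measurable
  define c0 where "c0 = radius_const DIM('a)"
  have c0: "c0 \<ge> 0" by (simp add: c0_def)
  define g where "g = growth_norm (real DIM('a) - 1) \<mu>"
  have growth: "emeasure \<mu> (ball x s) \<le> g * ennreal (s powr (real DIM('a) - 1))" if s: "s > 0" for x s
  proof -
    have "emeasure \<mu> (ball x s) / ennreal (s powr (real DIM('a) - 1)) \<le> g"
      unfolding g_def growth_norm_def using s by (intro SUP_upper2[of x] SUP_upper) auto
    then have "emeasure \<mu> (ball x s) / ennreal (s powr (real DIM('a) - 1)) * ennreal (s powr (real DIM('a) - 1))
       \<le> g * ennreal (s powr (real DIM('a) - 1))" by (rule mult_right_mono) simp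
    then show ?thesis using s by (simp add: ennreal_divide_times ennreal_divide_self)
  qed
  define c where "c = 5 powr (real DIM('a) - 1) * c0"
  have "(\<integral>\<^sup>+x. indicator E x \<partial>\<mu>) \<le> ennreal c * g * level_perimeter t UNIV"
  proof (rule nn_integral_le_if_ball_le)
    fix N :: real assume N: "N > 0"
    \<comment> \<open>The truncation serves the bounded radii only: the resulting estimate does not
      depend on N.\<close>
    define K where "K = ball 0 N \<inter> E"
    obtain b r where r: "\<And>x. x \<in> K \<Longrightarrow> 0 < r x \<and> r x \<le> b \<and>
        ennreal (r x powr (real DIM('a) - 1)) \<le> ennreal c0 * level_perimeter t (ball x (r x))"
      using boxing_radius[OF t N] unfolding K_def E_def c0_def by metis
    have "K \<subseteq> (\<Union>i\<in>K. ball i (r i))" using r by force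
    then obtain C where C: "countable C" "C \<subseteq> K" "pairwise (\<lambda>i j. disjnt (ball i (r i)) (ball j (r j))) C"
        "K \<subseteq> (\<Union>i\<in>C. ball i (5 * r i))"
      using Vitali_covering_lemma_balls[of K "\<lambda>i. i" r K b] r by blast
    have "(\<integral>\<^sup>+x. indicator E x * indicator (ball 0 N) x \<partial>\<mu>) \<le> (\<integral>\<^sup>+x. \<integral>\<^sup>+i. indicator (ball i (5 * r i)) x \<partial>count_space C \<partial>\<mu>)"
    proof (rule nn_integral_mono)
      fix x
      show "indicator E x * indicator (ball 0 N) x \<le> (\<integral>\<^sup>+i. indicator (ball i (5 * r i)) x \<partial>count_space C)"
      proof (cases "x \<in> K")
        case True
        then obtain i0 where i0: "i0 \<in> C" "x \<in> ball i0 (5 * r i0)" using C(4) by blast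
        have "1 = emeasure (count_space C) {i0}" using i0 by (simp add: emeasure_count_space)
        also have "\<dots> = (\<integral>\<^sup>+i. indicator {i0} i \<partial>count_space C)" by (rule nn_integral_indicator[symmetric]) (use i0 in auto)
        also have "\<dots> \<le> (\<integral>\<^sup>+i. indicator (ball i (5 * r i)) x \<partial>count_space C)"
          using i0 by (intro nn_integral_mono) (auto simp: indicator_def)
        finally show ?thesis using True by (simp add: K_def)
      qed (auto simp: K_def indicator_def)
    qed
    also have "\<dots> = (\<integral>\<^sup>+i. \<integral>\<^sup>+x. indicator (ball i (5 * r i)) x \<partial>\<mu> \<partial>count_space C)"
      by (rule nn_integral_count_space_nn_integral) (use C(1) in measurable)
    also have "\<dots> \<le> (\<integral>\<^sup>+i. (ennreal c * g) * level_perimeter t (ball i (r i)) \<partial>count_space C)"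
    proof (rule nn_integral_mono)
      fix i assume "i \<in> space (count_space C)"
      then have i: "i \<in> K" using C(2) by auto
      have "(\<integral>\<^sup>+x. indicator (ball i (5 * r i)) x \<partial>\<mu>) = emeasure \<mu> (ball i (5 * r i))"
        by (rule nn_integral_indicator) measurable
      also have "\<dots> \<le> g * ennreal ((5 * r i) powr (real DIM('a) - 1))" using r[OF i] by (intro growth) simp
      also have "ennreal ((5 * r i) powr (real DIM('a) - 1)) = ennreal (5 powr (real DIM('a) - 1)) * ennreal (r i powr (real DIM('a) - 1))"
        using r[OF i] by (simp add: powr_mult ennreal_mult')
      also have "g * \<dots> \<le> g * (ennreal (5 powr (real DIM('a) - 1)) * (ennreal c0 * level_perimeter t (ball i (r i))))"
        using r[OF i] by (intro mult_left_mono) auto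
      also have "\<dots> = (ennreal c * g) * level_perimeter t (ball i (r i))"
        using c0 by (simp add: c_def ennreal_mult mult_ac)
      finally show "(\<integral>\<^sup>+x. indicator (ball i (5 * r i)) x \<partial>\<mu>) \<le> \<dots>" .
    qed
    also have "\<dots> = (ennreal c * g) * (\<integral>\<^sup>+i. level_perimeter t (ball i (r i)) \<partial>count_space C)"
      by (rule nn_integral_cmult) simp
    also have "\<dots> \<le> (ennreal c * g) * level_perimeter t UNIV"
      by (intro mult_left_mono level_perimeter_disjoint_balls C) simp
    finally show "(\<integral>\<^sup>+x. indicator E x * indicator (ball 0 N) x \<partial>\<mu>) \<le> ennreal c * g * level_perimeter t UNIV" .
  qed (use assms in auto)
  then show ?thesis using Emu by (simp add: E_def c_def c0_def g_def)
qed

text \<open>After Fatou's and Tonelli's theorems the weight of |G x| is the integral over t > 0 of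
  \<open>smooth_step' k (v x - t)\<close>, at most 1 for every k.\<close>

lemma nn_integral_level_perimeter_le:
  "(\<integral>\<^sup>+t. level_perimeter t UNIV * indicator {0<..} t \<partial>lborel) \<le> total_variation"
proof -
  have "(\<integral>\<^sup>+t. level_perimeter t UNIV * indicator {0<..} t \<partial>lborel)
     \<le> (\<integral>\<^sup>+t. liminf (\<lambda>k. \<integral>\<^sup>+x. level_density k t x * indicator {0<..} t \<partial>lborel) \<partial>lborel)"
    by (intro nn_integral_mono) (auto simp: level_perimeter_def indicator_def)
  also have "\<dots> \<le> liminf (\<lambda>k. \<integral>\<^sup>+t. \<integral>\<^sup>+x. level_density k t x * indicator {0<..} t \<partial>lborel \<partial>lborel)"
    by (rule nn_integral_liminf) measurable
  also have "\<dots> \<le> liminf (\<lambda>k. \<integral>\<^sup>+x. ennreal (norm (G x)) \<partial>lborel)"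
  proof (intro Liminf_mono always_eventually allI)
    fix k
    have "(\<integral>\<^sup>+t. \<integral>\<^sup>+x. level_density k t x * indicator {0<..} t \<partial>lborel \<partial>lborel)
      = (\<integral>\<^sup>+x. \<integral>\<^sup>+t. level_density k t x * indicator {0<..} t \<partial>lborel \<partial>lborel)"
      by (rule lborel_pair.Fubini') measurable
    also have "\<dots> \<le> (\<integral>\<^sup>+x. \<integral>\<^sup>+t. ennreal (norm (G x)) * (ennreal (smooth_step' k (v x - t)) * indicator {0..} t) \<partial>lborel \<partial>lborel)"
      by (intro nn_integral_mono) (auto simp: indicator_def smooth_step'_nonneg mult.commute simp flip: ennreal_mult')
    also have "\<dots> = (\<integral>\<^sup>+x. ennreal (norm (G x)) * (\<integral>\<^sup>+t. ennreal (smooth_step' k (v x - t)) * indicator {0..} t \<partial>lborel) \<partial>lborel)"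
      by (intro nn_integral_cong nn_integral_cmult) measurable
    also have "\<dots> \<le> (\<integral>\<^sup>+x. ennreal (norm (G x)) * 1 \<partial>lborel)"
      by (intro nn_integral_mono mult_left_mono nn_integral_smooth_step'_le) simp
    finally show "(\<integral>\<^sup>+t. \<integral>\<^sup>+x. level_density k t x * indicator {0<..} t \<partial>lborel \<partial>lborel)
      \<le> total_variation" by simp
  qed
  also have "\<dots> = total_variation" by (simp add: Liminf_const)
  finally show ?thesis .
qed

text \<open>Layer cake formula; \<open>ennreal (v x)\<close> is the positive part of v, so exactly
  the levels t > 0 occur. Sigma-finiteness of \<mu> licenses the exchange of integrals.\<close>

lemma nn_integral_positive_part_le:
  fixes \<mu> :: "'a measure"
  assumes sets [measurable_cong]: "sets \<mu> = sets borel" and "sigma_finite_measure \<mu>"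
  shows "(\<integral>\<^sup>+x. ennreal (v x) \<partial>\<mu>) \<le> ennreal (boxing_const DIM('a))
     * growth_norm (real DIM('a) - 1) \<mu> * total_variation"
proof -
  interpret \<mu>: sigma_finite_measure \<mu> by fact
  interpret pair_sigma_finite \<mu> "lborel :: real measure" ..
  define D where "D = ennreal (boxing_const DIM('a))
     * growth_norm (real DIM('a) - 1) \<mu>"
  have [measurable]: "(\<lambda>t. level_perimeter t UNIV) \<in> borel_measurable borel"
    unfolding level_perimeter_def by measurable
  have "(\<integral>\<^sup>+x. ennreal (v x) \<partial>\<mu>) = (\<integral>\<^sup>+x. \<integral>\<^sup>+t. indicator {0<..} t * (if t < v x then 1 else 0) \<partial>lborel \<partial>\<mu>)"
  proof (rule nn_integral_cong)
    fix x
    have "(\<integral>\<^sup>+t. indicator {0<..} t * (if t < v x then 1 else 0) \<partial>lborel) = (\<integral>\<^sup>+t. indicator {0<..<v x} t \<partial>lborel)"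
      by (intro nn_integral_cong) (auto simp: indicator_def)
    also have "\<dots> = ennreal (v x)"
      by (cases "v x > 0") (auto simp: ennreal_neg)
    finally show "ennreal (v x) = (\<integral>\<^sup>+t. indicator {0<..} t * (if t < v x then 1 else 0) \<partial>lborel)" by simp
  qed
  also have "\<dots> = (\<integral>\<^sup>+t. \<integral>\<^sup>+x. indicator {0<..} t * (if t < v x then 1 else 0) \<partial>\<mu> \<partial>lborel)"
    by (rule Fubini'[symmetric]) measurable
  also have "\<dots> \<le> (\<integral>\<^sup>+t. D * (level_perimeter t UNIV * indicator {0<..} t) \<partial>lborel)"
  proof (rule nn_integral_mono)
    fix t :: real
    have sl: "{x. t < v x} \<in> sets \<mu>" unfolding sets using superlevel_open by (rule borel_open)
    have "(\<integral>\<^sup>+x. indicator {0<..} t * (if t < v x then 1 else 0) \<partial>\<mu>) = (\<integral>\<^sup>+x. indicator {0<..} t * indicator {x. t < v x} x \<partial>\<mu>)"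
      by (intro nn_integral_cong) (auto simp: indicator_def)
    also have "\<dots> = indicator {0<..} t * emeasure \<mu> {x. t < v x}"
      by (rule nn_integral_cmult_indicator) (rule sl)
    also have "\<dots> \<le> D * (level_perimeter t UNIV * indicator {0<..} t)"
      using emeasure_superlevel_le[OF sets, of t] by (auto simp: indicator_def D_def)
    finally show "(\<integral>\<^sup>+x. indicator {0<..} t * (if t < v x then 1 else 0) \<partial>\<mu>) \<le> \<dots>" .
  qed
  also have "\<dots> = D * (\<integral>\<^sup>+t. level_perimeter t UNIV * indicator {0<..} t \<partial>lborel)"
    by (rule nn_integral_cmult) measurable
  also have "\<dots> \<le> D * total_variation"
    by (intro mult_left_mono nn_integral_level_perimeter_le) simp
  finally show ?thesis by (simp add: D_def)
qed

lemma C1_vanishing_uminus: "C1_vanishing (\<lambda>x. - v x) (\<lambda>x. - G x)"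
proof
  show "((\<lambda>x. - v x) has_derivative (\<lambda>h. - G x \<bullet> h)) (at x)" for x
    using has_derivative_minus[OF v_der[of x]] by simp
qed (use vanish G_cont in \<open>auto intro: continuous_intros\<close>)

end

text \<open>The factor 2 comes from treating the positive parts of v and -v separately: the decay of
  the means makes {v > t} sparse at large scales only for t > 0.\<close>

lemma (in C1_vanishing) trace_inequality:
  fixes \<mu> :: "'a measure"
  assumes sets [measurable_cong]: "sets \<mu> = sets borel" and "sigma_finite_measure \<mu>"
  shows "(\<integral>\<^sup>+x. ennreal \<bar>v x\<bar> \<partial>\<mu>) \<le> ennreal (2 * (boxing_const DIM('a)))
     * growth_norm (real DIM('a) - 1) \<mu> * total_variation"
proof -
  interpret neg: C1_vanishing "\<lambda>x. - v x" "\<lambda>x. - G x" by (rule C1_vanishing_uminus)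
  define c where "c = boxing_const DIM('a)"
  define X where "X = growth_norm (real DIM('a) - 1) \<mu>"
  define Y where "Y = total_variation"
  have "(\<integral>\<^sup>+x. ennreal \<bar>v x\<bar> \<partial>\<mu>) = (\<integral>\<^sup>+x. ennreal (v x) + ennreal (- v x) \<partial>\<mu>)"
    by (intro nn_integral_cong) (auto simp: abs_if ennreal_neg)
  also have "\<dots> = (\<integral>\<^sup>+x. ennreal (v x) \<partial>\<mu>) + (\<integral>\<^sup>+x. ennreal (- v x) \<partial>\<mu>)"
    by (rule nn_integral_add) measurable
  also have "\<dots> \<le> ennreal c * X * Y + ennreal c * X * Y"
    using neg.nn_integral_positive_part_le[OF assms] nn_integral_positive_part_le[OF assms]
    unfolding c_def[symmetric] X_def[symmetric] Y_def[symmetric] norm_minus_cancel by (intro add_mono)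
  also have "\<dots> = ennreal (2 * c) * X * Y"
    by (simp add: ennreal_mult' mult.assoc flip: mult_2)
  finally show ?thesis by (simp only: c_def X_def Y_def)
qed

text \<open>Local finiteness bounds \<mu> on compact sets by a finite subcover, and the closed balls
  around the origin exhaust the space.\<close>

lemma locally_finite_borel_sigma_finite:
  fixes \<mu> :: "'a::euclidean_space measure"
  assumes "locally_finite_borel \<mu>"
  shows "sigma_finite_measure \<mu>"
proof
  have sets: "sets \<mu> = sets borel" and space: "space \<mu> = UNIV"
    using assms sets_eq_imp_space_eq[of \<mu> borel] by (auto simp: locally_finite_borel_def)
  obtain r where r: "\<And>x. r x > 0" "\<And>x. emeasure \<mu> (ball x (r x)) < \<infinity>"
    using assms unfolding locally_finite_borel_def by metis
  have fin: "emeasure \<mu> (cball 0 (real n)) \<noteq> \<infinity>" for n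
  proof -
    have "cball 0 (real n) \<subseteq> (\<Union>x\<in>cball 0 (real n). ball x (r x))" using r(1) by force
    then obtain D where D: "D \<subseteq> cball 0 (real n)" "finite D" "cball 0 (real n) \<subseteq> (\<Union>x\<in>D. ball x (r x))"
      using compactE_image[of "cball 0 (real n)" "cball 0 (real n)" "\<lambda>x. ball x (r x)"] by auto
    have "emeasure \<mu> (cball 0 (real n)) \<le> emeasure \<mu> (\<Union>x\<in>D. ball x (r x))"
      by (intro emeasure_mono D) (simp add: sets borel_open open_UN)
    also have "\<dots> \<le> (\<Sum>x\<in>D. emeasure \<mu> (ball x (r x)))"
      by (intro emeasure_subadditive_finite D) (auto simp: sets)
    also have "\<dots> < \<infinity>" using D r(2) by simp
    finally show ?thesis by simp
  qed
  show "\<exists>A. countable A \<and> A \<subseteq> sets \<mu> \<and> \<Union> A = space \<mu> \<and> (\<forall>a\<in>A. emeasure \<mu> a \<noteq> \<infinity>)"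
  proof (intro exI[of _ "range (\<lambda>n. cball (0::'a) (real n))"] conjI)
    show "\<Union> (range (\<lambda>n. cball (0::'a) (real n))) = space \<mu>"
      unfolding space by (auto intro: real_arch_simple)
  qed (use fin in \<open>auto simp: sets\<close>)
qed

section \<open>Precise representatives as limits of mollifications\<close>

text \<open>\<open>bump r\<close> is a superposition of indicators of the balls of radius \<open>sqrt s\<close>, \<open>s \<le> r\<^sup>2\<close>; hence a
  mollification is a weighted mean of ball averages.\<close>

lemma bump_layers:
  assumes r: "r > 0"
  shows "has_bochner_integral lborel (\<lambda>s. flat_exp 2 (r\<^sup>2 - s) * indicator {0..r\<^sup>2} s * indicator (ball x (sqrt s)) y) (bump r (x - y))"
proof -
  define a where "a = (norm (x - y))\<^sup>2"
  have a: "a \<ge> 0" by (simp add: a_def)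
  have ball: "y \<in> ball x (sqrt s) \<longleftrightarrow> a < s" for s
    unfolding a_def by (simp add: dist_norm real_less_rsqrt) (metis norm_ge_zero real_less_lsqrt real_less_rsqrt real_sqrt_less_iff real_sqrt_unique)
  have ind: "indicator (ball x (sqrt s)) y = (if a < s then 1 else 0 :: real)" for s
    using ball[of s] by (simp add: indicator_def del: mem_ball)
  show ?thesis
  proof (cases "a \<le> r\<^sup>2")
    case True
    have "has_bochner_integral lborel (\<lambda>s. flat_exp 2 (r\<^sup>2 - s) * indicator {a..r\<^sup>2} s) (- flat_exp 0 (r\<^sup>2 - r\<^sup>2) - (- flat_exp 0 (r\<^sup>2 - a)))"
    \<comment> \<open>The weight of a layer is the derivative of \<open>flat_exp 0\<close>, which is
      \<open>flat_exp 2\<close> because the second term in \<open>flat_exp_deriv\<close> carries the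
      factor m = 0.\<close>
    proof (rule has_bochner_integral_FTC_Icc_nonneg)
      show "((\<lambda>s. - flat_exp 0 (r\<^sup>2 - s)) has_real_derivative flat_exp 2 (r\<^sup>2 - s)) (at s)" for s
      proof -
        have "((\<lambda>s. r\<^sup>2 - s) has_real_derivative - 1) (at s)" by (auto intro!: derivative_eq_intros)
        from DERIV_minus[OF DERIV_chain2[OF flat_exp_deriv[of 0] this]]
        show ?thesis by (rule DERIV_cong) (simp add: numeral_2_eq_2)
      qed
    qed (use True in \<open>auto simp: flat_exp_nonneg\<close>)
    moreover have "- flat_exp 0 (r\<^sup>2 - r\<^sup>2) - (- flat_exp 0 (r\<^sup>2 - a)) = bump r (x - y)"
      by (simp add: bump_def a_def) (simp add: flat_exp_def)
    ultimately have *: "has_bochner_integral lborel (\<lambda>s. flat_exp 2 (r\<^sup>2 - s) * indicator {a..r\<^sup>2} s) (bump r (x - y))"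
      by simp
    \<comment> \<open>The open ball requires s > a, the fundamental theorem gives s \<ge> a; the two
      integrands differ at the single point s = a.\<close>
    have "AE s in lborel. flat_exp 2 (r\<^sup>2 - s) * indicator {a..r\<^sup>2} s = flat_exp 2 (r\<^sup>2 - s) * indicator {0..r\<^sup>2} s * (if a < s then 1 else 0)"
      using AE_lborel_singleton[of a]
    proof eventually_elim
      case (elim s)
      then show ?case using a by (simp add: indicator_def)
    qed
    then have "has_bochner_integral lborel (\<lambda>s. flat_exp 2 (r\<^sup>2 - s) * indicator {0..r\<^sup>2} s * (if a < s then 1 else 0)) (bump r (x - y))"
      by (rule has_bochner_integral_cong_AE[THEN iffD1, rotated 2, OF _ *]) measurable
    then show ?thesis unfolding ind .
  next
    case False
    then have "(\<lambda>s. flat_exp 2 (r\<^sup>2 - s) * indicator {0..r\<^sup>2} s * indicator (ball x (sqrt s)) y) = (\<lambda>s. 0)"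
      unfolding ind by (simp add: fun_eq_iff indicator_def)
    moreover have "bump r (x - y) = 0" using False by (simp add: bump_def flat_exp_def a_def)
    ultimately show ?thesis by (simp add: has_bochner_integral_zero)
  qed
qed

text \<open>Fubini's theorem over points and layers. The layers are nonnegative and add up to the
  bump, so absolute convergence reduces to the integrability of the bump times |g|.\<close>

lemma bump_integral_layers:
  fixes g :: "'a::euclidean_space \<Rightarrow> real"
  assumes r: "r > 0" and g: "locally_integrable g"
  shows "integrable lborel (\<lambda>s. flat_exp 2 (r\<^sup>2 - s) * indicator {0..r\<^sup>2} s * (\<integral>y. indicator (ball x (sqrt s)) y * g y \<partial>lborel))" (is "integrable _ ?A")
    and "(\<integral>y. bump r (x - y) * g y \<partial>lborel) = (\<integral>s. flat_exp 2 (r\<^sup>2 - s) * indicator {0..r\<^sup>2} s * (\<integral>y. indicator (ball x (sqrt s)) y * g y \<partial>lborel) \<partial>lborel)"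
proof -
  have [measurable]: "g \<in> borel_measurable borel" using g by (rule locally_integrable_borel)
  define k where "k s y = flat_exp 2 (r\<^sup>2 - s) * indicator {0..r\<^sup>2} s * indicator (ball x (sqrt s)) y" for s y
  have k: "has_bochner_integral lborel (\<lambda>s. k s y) (bump r (x - y))" for y
    unfolding k_def by (rule bump_layers[OF r])
  have k0: "k s y \<ge> 0" for s y by (simp add: k_def flat_exp_nonneg)
  have [measurable]: "(\<lambda>(y, s). k s y) \<in> borel_measurable (lborel \<Otimes>\<^sub>M lborel)"
  proof -
    have "(\<lambda>(y, s). k s y) = (\<lambda>(y, s). flat_exp 2 (r\<^sup>2 - s) * indicator {0..r\<^sup>2} s * (if dist x y < sqrt s then 1 else 0))"
      by (auto simp: k_def indicator_def fun_eq_iff)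
    then show ?thesis by simp
  qed
  obtain M where M: "\<And>z. \<bar>bump r (z::'a)\<bar> \<le> M"
    using bounded_continuous_support[OF continuous_on_bump, of r r, where 'a='a] bump_outside[OF r] by (metis mem_ball mem_cball less_imp_le real_norm_def)
  have bint: "integrable lborel (\<lambda>y. bump r (x - y) *\<^sub>R g y)"
    by (rule conv_integrable[OF g, where M=M and R=r and x=x]) (use M bump_outside[OF r] in \<open>auto simp: dist_norm\<close>)
  define H where "H y s = k s y * g y" for y s
  have int: "integrable (lborel \<Otimes>\<^sub>M lborel) (case_prod H)"
  proof (rule lborel_pair.Fubini_integrable)
    show "case_prod H \<in> borel_measurable (lborel \<Otimes>\<^sub>M lborel)"
      unfolding H_def[abs_def] by measurable
    have "(\<integral>s. norm (case_prod H (y, s)) \<partial>lborel) = norm (bump r (x - y) *\<^sub>R g y)" for y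
    proof -
      have "(\<integral>s. norm (case_prod H (y, s)) \<partial>lborel) = (\<integral>s. k s y * \<bar>g y\<bar> \<partial>lborel)"
        using k0 by (simp add: H_def abs_mult)
      also have "\<dots> = bump r (x - y) * \<bar>g y\<bar>"
        using has_bochner_integral_integral_eq[OF k[of y]] by simp
      finally show ?thesis by (simp add: abs_mult bump_nonneg)
    qed
    then show "integrable lborel (\<lambda>y. \<integral>s. norm (case_prod H (y, s)) \<partial>lborel)"
      using integrable_norm[OF bint] by simp
    show "AE y in lborel. integrable lborel (\<lambda>s. case_prod H (y, s))"
      using integrable.intros[OF k] by (auto simp: H_def)
  qed
  have inner: "(\<integral>y. H y s \<partial>lborel) = ?A s" for s
    by (simp add: H_def k_def mult.assoc)
  have "(\<integral>s. H y s \<partial>lborel) = bump r (x - y) * g y" for y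
    using has_bochner_integral_integral_eq[OF k[of y]] by (simp add: H_def)
  then show "(\<integral>y. bump r (x - y) * g y \<partial>lborel) = (\<integral>s. ?A s \<partial>lborel)"
    using lborel_pair.Fubini_integral[OF int] by (simp add: inner)
  show "integrable lborel ?A"
    using lborel_pair.integrable_snd[OF int] by (simp add: inner)
qed

lemma locally_integrable_diff:
  "locally_integrable f \<Longrightarrow> locally_integrable g \<Longrightarrow> locally_integrable (\<lambda>x. f x - g x)"
  unfolding locally_integrable_def by (auto simp: scaleR_right_diff_distrib)

lemma locally_integrable_indicator_ball:
  fixes g :: "'a::euclidean_space \<Rightarrow> real"
  assumes "locally_integrable g"
  shows "integrable lborel (\<lambda>y. indicator (ball x r) y * g y)"
  using conv_integrable(1)[OF assms, where M=1 and R=r and x=x and \<rho>="indicator (ball x r)"]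
  by (auto simp: indicator_def)

lemma ball_average_eq:
  assumes [measurable]: "u \<in> borel_measurable borel"
  shows "ball_average u x r = (\<integral>y. indicator (ball x r) y * u y \<partial>lborel) / measure lborel (ball x r)"
proof -
  have "(LINT y:ball x r|lebesgue. u y) = (\<integral>y. indicator (ball x r) y * u y \<partial>lborel)"
    unfolding set_lebesgue_integral_def real_scaleR_def by (rule integral_completion) measurable
  moreover have "measure lebesgue (ball x r) = measure lborel (ball x r)"
    by (rule measure_completion) simp
  ultimately show ?thesis by (simp add: ball_average_def)
qed

text \<open>Layer by layer, the integral of u - l over a ball is its volume times the deviation of
  the ball average, hence at most \<delta> times the same layer of the constant function 1.
  Integrating the layers and dividing by the mass of the bump yields the bound.\<close>

lemma mollified_diff_le:
  fixes u :: "'a::euclidean_space \<Rightarrow> real"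
  assumes u: "locally_integrable u" and r: "r > 0" and \<delta>: "\<And>s. 0 < s \<Longrightarrow> s \<le> r \<Longrightarrow> \<bar>ball_average u x s - l\<bar> \<le> \<delta>"
  shows "\<bar>conv (mollifier r) u x - l\<bar> \<le> \<delta>"
proof -
  define Z where "Z = (\<integral>x. bump r (x::'a) \<partial>lborel)"
  have Z: "Z > 0" unfolding Z_def by (rule bump_integral_pos[OF r])
  have ub: "u \<in> borel_measurable borel" using u by (rule locally_integrable_borel)
  define A where "A g s = flat_exp 2 (r\<^sup>2 - s) * indicator {0..r\<^sup>2} s * (\<integral>y. indicator (ball x (sqrt s)) y * g y \<partial>lborel)" for g :: "'a \<Rightarrow> real" and s
  have A: "integrable lborel (A g)" "(\<integral>y. bump r (x - y) * g y \<partial>lborel) = (\<integral>s. A g s \<partial>lborel)"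
    if "locally_integrable g" for g
    unfolding A_def using bump_integral_layers[OF r that, of x] by auto
  have ul: "locally_integrable (\<lambda>y. u y - l)" by (intro locally_integrable_diff u locally_integrable_const)
  have Aint: "\<bar>A (\<lambda>y. u y - l) s\<bar> \<le> \<delta> * A (\<lambda>_. 1) s" for s
  proof (cases "s \<in> {0<..r\<^sup>2}")
    case True
    define m where "m = measure lborel (ball x (sqrt s))"
    have m: "m > 0" using True by (simp add: m_def measure_def emeasure_ball unit_ball_vol_pos)
    have i1: "(\<integral>y. indicator (ball x (sqrt s)) y * 1 \<partial>lborel) = m"
      by (simp add: m_def)
    have "(\<integral>y. indicator (ball x (sqrt s)) y * (u y - l) \<partial>lborel) 
        = (\<integral>y. indicator (ball x (sqrt s)) y * u y - indicator (ball x (sqrt s)) y * l \<partial>lborel)"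
      by (simp add: right_diff_distrib)
    also have "\<dots> = (\<integral>y. indicator (ball x (sqrt s)) y * u y \<partial>lborel) - (\<integral>y. indicator (ball x (sqrt s)) y * l \<partial>lborel)"
      by (intro Bochner_Integration.integral_diff locally_integrable_indicator_ball u locally_integrable_const)
    also have "\<dots> = m * (ball_average u x (sqrt s) - l)"
      using m by (simp add: ball_average_eq[OF ub] m_def right_diff_distrib)
    finally have i2: "(\<integral>y. indicator (ball x (sqrt s)) y * (u y - l) \<partial>lborel) = \<dots>" .
    have "sqrt s \<le> r" using True r real_sqrt_le_mono[of s "r\<^sup>2"] by simp
    then have "\<bar>ball_average u x (sqrt s) - l\<bar> \<le> \<delta>" using True by (intro \<delta>) auto
    then have "flat_exp 2 (r\<^sup>2 - s) * (m * \<bar>ball_average u x (sqrt s) - l\<bar>) \<le> flat_exp 2 (r\<^sup>2 - s) * (m * \<delta>)"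
      using m by (intro mult_left_mono flat_exp_nonneg) auto
    then show ?thesis unfolding A_def i1 i2 using True m flat_exp_nonneg[of 2 "r\<^sup>2 - s"]
      by (simp add: abs_mult mult_ac)
  next
    case False
    show ?thesis
    \<comment> \<open>At s = 0 the weight need not vanish, but the ball is empty and both sides are
      0.\<close>
    proof (cases "s = 0")
      case True
      then show ?thesis by (simp add: A_def)
    next
      case nz: False
      then have "indicator {0..r\<^sup>2} s = (0::real)" using False by (auto simp: indicator_def)
      then show ?thesis by (simp add: A_def)
    qed
  qed
  have "\<bar>\<integral>y. bump r (x - y) * (u y - l) \<partial>lborel\<bar> \<le> (\<integral>s. \<bar>A (\<lambda>y. u y - l) s\<bar> \<partial>lborel)"
    unfolding A(2)[OF ul] using integral_norm_bound[of lborel "A (\<lambda>y. u y - l)"] by simp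
  also have "\<dots> \<le> (\<integral>s. \<delta> * A (\<lambda>_. 1) s \<partial>lborel)"
    by (intro integral_mono integrable_mult_right integrable_abs A ul locally_integrable_const Aint)
  also have "\<dots> = \<delta> * (\<integral>y. bump r (x - y) * 1 \<partial>lborel)"
    by (simp only: A(2)[OF locally_integrable_const, symmetric] integral_mult_right_zero)
  also have "(\<integral>y. bump r (x - y) * 1 \<partial>lborel) = Z"
    using lborel_integral_unit_affine[of "-1" "bump r" x] by (simp add: Z_def)
  finally have main: "\<bar>\<integral>y. bump r (x - y) * (u y - l) \<partial>lborel\<bar> \<le> \<delta> * Z" .
  have "conv (mollifier r) u x - l = (\<integral>y. mollifier r (x - y) * u y \<partial>lborel) - l * (\<integral>y. mollifier r (x - y) \<partial>lborel)"
    by (simp add: conv_def mollifier_translate(2)[OF r])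
  also have "\<dots> = (\<integral>y. mollifier r (x - y) * u y - l * mollifier r (x - y) \<partial>lborel)"
  proof (subst Bochner_Integration.integral_diff)
    obtain M where M: "\<And>z. \<bar>mollifier r (z::'a)\<bar> \<le> M"
      using bounded_continuous_support[OF Ck_imp_continuous[OF Ck_mollifier[OF r]], of r, where 'a='a] mollifier_outside[OF r]
      by (metis mem_ball mem_cball less_imp_le real_norm_def)
    note [measurable] = mollifier_borel[OF r]
    have "integrable lborel (\<lambda>y. mollifier r (x - y) *\<^sub>R u y)"
      by (rule conv_integrable(1)[OF u, where M=M and R=r and x=x]) (use M mollifier_outside[OF r] in \<open>auto simp: dist_norm\<close>)
    then show "integrable lborel (\<lambda>y. mollifier r (x - y) * u y)" by simp
  qed (use mollifier_translate(1)[OF r] in auto)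
  also have "\<dots> = (\<integral>y. bump r (x - y) * (u y - l) / Z \<partial>lborel)"
  proof (intro Bochner_Integration.integral_cong refl)
    fix y
    have "mollifier r (x - y) * u y - l * mollifier r (x - y) = mollifier r (x - y) * (u y - l)"
      by (simp add: algebra_simps)
    then show "mollifier r (x - y) * u y - l * mollifier r (x - y) = bump r (x - y) * (u y - l) / Z"
      by (simp add: mollifier_def Z_def)
  qed
  also have "\<dots> = (\<integral>y. bump r (x - y) * (u y - l) \<partial>lborel) / Z" by simp
  finally show ?thesis using main Z by (simp add: abs_divide divide_le_eq)
qed

text \<open>Only ball averages at x with radius up to that of the mollifier enter. Their convergence
  at x is enough: x need not be a Lebesgue point, which matters because \<mu> can charge null
  sets.\<close>

lemma mollified_tendsto_precise_rep:
  fixes u :: "'a::euclidean_space \<Rightarrow> real"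
  assumes u: "locally_integrable u" and lim: "(ball_average u x \<longlongrightarrow> l) (at_right 0)"
  shows "(\<lambda>k. conv (mollifier (inverse (real (Suc k)))) u x) \<longlonglongrightarrow> l"
proof (rule LIMSEQ_I)
  fix e :: real assume e: "e > 0"
  have "eventually (\<lambda>s. dist (ball_average u x s) l < e / 2) (at_right 0)"
    using lim e by (intro tendstoD) auto
  then obtain b where b: "b > 0" "\<And>s. 0 < s \<Longrightarrow> s < b \<Longrightarrow> \<bar>ball_average u x s - l\<bar> < e / 2"
    unfolding eventually_at_right_field by (auto simp: dist_real_def)
  obtain N where N: "inverse (real (Suc N)) < b" using reals_Archimedean[OF b(1)] by blast
  show "\<exists>no. \<forall>n\<ge>no. norm (conv (mollifier (inverse (real (Suc n)))) u x - l) < e"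
  proof (intro exI allI impI)
    fix n assume "n \<ge> N"
    then have "inverse (real (Suc n)) \<le> inverse (real (Suc N))" by (simp add: le_imp_inverse_le)
    with N have "inverse (real (Suc n)) < b" by linarith
    then have "\<bar>conv (mollifier (inverse (real (Suc n)))) u x - l\<bar> \<le> e / 2"
      using b(2) by (intro mollified_diff_le[OF u]) (auto intro!: less_imp_le)
    then show "norm (conv (mollifier (inverse (real (Suc n)))) u x - l) < e" using e by simp
  qed
qed

lemma nn_integral_mollified_ball_le:
  fixes u :: "'a::euclidean_space \<Rightarrow> real"
  assumes r: "r > 0" and [measurable]: "u \<in> borel_measurable borel"
  shows "ball_mass (conv (mollifier r) u) R \<le> ball_mass u (R + r)"
proof -
  define \<rho> where "\<rho> = (mollifier r :: 'a \<Rightarrow> real)"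
  have [measurable]: "\<rho> \<in> borel_measurable borel" unfolding \<rho>_def by (rule mollifier_borel[OF r])
  have \<rho>0: "\<rho> z \<ge> 0" for z unfolding \<rho>_def by (rule mollifier_nonneg[OF r])
  have out: "\<rho> z = 0" if "z \<notin> ball 0 r" for z using mollifier_outside[OF r that] by (simp add: \<rho>_def)
  have "ball_mass (conv \<rho> u) R
     \<le> (\<integral>\<^sup>+x. \<integral>\<^sup>+y. ennreal \<bar>u y\<bar> * (ennreal (\<rho> (x - y)) * indicator (ball 0 R) x) \<partial>lborel \<partial>lborel)"
  proof (rule nn_integral_mono)
    fix x :: 'a
    have "ennreal \<bar>conv \<rho> u x\<bar> \<le> (\<integral>\<^sup>+y. ennreal \<bar>\<rho> (x - y) *\<^sub>R u y\<bar> \<partial>lborel)"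
      unfolding conv_def by (rule ennreal_abs_integral_le_nn_integral)
    also have "\<dots> = (\<integral>\<^sup>+y. ennreal \<bar>u y\<bar> * ennreal (\<rho> (x - y)) \<partial>lborel)"
      using \<rho>0 by (intro nn_integral_cong) (simp add: abs_mult mult.commute flip: ennreal_mult')
    finally have "ennreal \<bar>conv \<rho> u x\<bar> * indicator (ball 0 R) x \<le> (\<integral>\<^sup>+y. ennreal \<bar>u y\<bar> * ennreal (\<rho> (x - y)) \<partial>lborel) * indicator (ball 0 R) x"
      by (rule mult_right_mono) simp
    also have "\<dots> = (\<integral>\<^sup>+y. ennreal \<bar>u y\<bar> * ennreal (\<rho> (x - y)) * indicator (ball 0 R) x \<partial>lborel)"
      by (rule nn_integral_multc[symmetric]) measurable
    finally show "ennreal \<bar>conv \<rho> u x\<bar> * indicator (ball 0 R) x \<le> (\<integral>\<^sup>+y. ennreal \<bar>u y\<bar> * (ennreal (\<rho> (x - y)) * indicator (ball 0 R) x) \<partial>lborel)"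
      by (simp add: mult.assoc)
  qed
  also have "\<dots> = (\<integral>\<^sup>+y. \<integral>\<^sup>+x. ennreal \<bar>u y\<bar> * (ennreal (\<rho> (x - y)) * indicator (ball 0 R) x) \<partial>lborel \<partial>lborel)"
    by (rule lborel_pair.Fubini') measurable
  also have "\<dots> \<le> (\<integral>\<^sup>+y. \<integral>\<^sup>+x. (ennreal \<bar>u y\<bar> * indicator (ball 0 (R + r)) y) * ennreal (\<rho> (x - y)) \<partial>lborel \<partial>lborel)"
  proof (intro nn_integral_mono)
    fix x y :: 'a
    show "ennreal \<bar>u y\<bar> * (ennreal (\<rho> (x - y)) * indicator (ball 0 R) x) \<le> (ennreal \<bar>u y\<bar> * indicator (ball 0 (R + r)) y) * ennreal (\<rho> (x - y))"
    proof (cases "x \<in> ball 0 R \<and> x - y \<in> ball 0 r")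
      case True
      then have "y \<in> ball 0 (R + r)" using norm_triangle_sub[of y x] by (auto simp: norm_minus_commute)
      then show ?thesis using True by (simp add: mult_ac)
    qed (use out in auto)
  qed
  also have "\<dots> = (\<integral>\<^sup>+y. (ennreal \<bar>u y\<bar> * indicator (ball 0 (R + r)) y) * (\<integral>\<^sup>+x. ennreal (\<rho> (x - y)) \<partial>lborel) \<partial>lborel)"
    by (intro nn_integral_cong nn_integral_cmult) measurable
  also have "(\<lambda>y. \<integral>\<^sup>+x. ennreal (\<rho> (x - y)) \<partial>lborel) = (\<lambda>y. 1)"
  proof
    fix y :: 'a
    have "(\<lambda>x. ennreal (\<rho> x)) \<in> borel_measurable borel" by measurable
    from nn_integral_lborel_unit_affine[OF _ this, of 1 "- y"]
    have "(\<integral>\<^sup>+x. ennreal (\<rho> (x - y)) \<partial>lborel) = (\<integral>\<^sup>+x. ennreal (\<rho> x) \<partial>lborel)" by simp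
    also have "\<dots> = ennreal (\<integral>x. \<rho> x \<partial>lborel)"
      unfolding \<rho>_def by (rule nn_integral_eq_integral[OF mollifier_integrable[OF r]]) (simp add: mollifier_nonneg[OF r])
    also have "\<dots> = 1" by (simp add: \<rho>_def mollifier_integral[OF r])
    finally show "(\<integral>\<^sup>+x. ennreal (\<rho> (x - y)) \<partial>lborel) = 1" .
  qed
  finally show ?thesis by (simp add: \<rho>_def)
qed

section \<open>The trace inequality for Riesz potentials\<close>

context riesz_setting
begin

lemma mollified_vanishing:
  assumes r: "r > 0" and \<delta>: "\<delta> > 0"
  shows "\<exists>R0>0. \<forall>R\<ge>R0. ball_mass (conv (mollifier r) u) R \<le> ennreal (\<delta> * R ^ DIM('a))"
proof -
  \<comment> \<open>For R \<ge> r the enlarged radius R + r is at most 2 R; the divisor absorbs the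
    resulting factor 2^n.\<close>
  obtain R0 where R0: "R0 > 0" "\<And>R. R \<ge> R0 \<Longrightarrow> ball_mass u R \<le> ennreal (\<delta> / 2 ^ DIM('a) * R ^ DIM('a))"
    using u_average_small[of "\<delta> / 2 ^ DIM('a)"] \<delta> by auto
  show ?thesis
  proof (intro exI conjI allI impI)
    show "max R0 r > 0" using r by simp
    fix R assume R: "R \<ge> max R0 r"
    have "ball_mass (conv (mollifier r) u) R \<le> ball_mass u (R + r)"
      by (rule nn_integral_mollified_ball_le[OF r u_borel])
    also have "\<dots> \<le> ennreal (\<delta> / 2 ^ DIM('a) * (R + r) ^ DIM('a))" using R r by (intro R0) auto
    also have "\<dots> \<le> ennreal (\<delta> / 2 ^ DIM('a) * (2 * R) ^ DIM('a))"
      using R r \<delta> by (intro ennreal_leI mult_left_mono power_mono) auto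
    also have "\<delta> / 2 ^ DIM('a) * (2 * R) ^ DIM('a) = \<delta> * R ^ DIM('a)" by (simp add: power_mult_distrib)
    finally show "ball_mass (conv (mollifier r) u) R \<le> ennreal (\<delta> * R ^ DIM('a))" .
  qed
qed

lemma trace_inequality:
  fixes \<mu> :: "'a measure"
  assumes \<mu>: "locally_finite_borel \<mu>"
  shows "(\<integral>\<^sup>+x. ennreal \<bar>precise_rep u x\<bar> \<partial>\<mu>)
    \<le> ennreal (2 * (boxing_const DIM('a)))
     * growth_norm (real DIM('a) - 1) \<mu> * frac_variation \<alpha> f" (is "_ \<le> ?c * ?g * _")
proof -
  have sets [measurable_cong]: "sets \<mu> = sets borel" using \<mu> by (simp add: locally_finite_borel_def)
  define w where "w k = conv (mollifier (inverse (real (Suc k)))) u" for k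
  have bound: "w k \<in> borel_measurable borel \<and> (\<integral>\<^sup>+x. ennreal \<bar>w k x\<bar> \<partial>\<mu>) \<le> ?c * ?g * frac_variation \<alpha> f" for k
  proof -
    define r where "r = inverse (real (Suc k))"
    have r: "r > 0" by (simp add: r_def)
    obtain G where G: "continuous_on UNIV G" "\<And>x. (conv (mollifier r) u has_derivative (\<lambda>h. G x \<bullet> h)) (at x)"
      "(\<integral>\<^sup>+x. ennreal (norm (G x)) \<partial>lborel) \<le> frac_variation \<alpha> f"
      using mollified_gradient[OF r] by blast
    interpret C1_vanishing "conv (mollifier r) u" G
      by unfold_locales (use G mollified_vanishing[OF r] in auto)
    have "(\<integral>\<^sup>+x. ennreal \<bar>conv (mollifier r) u x\<bar> \<partial>\<mu>) \<le> ?c * ?g * (\<integral>\<^sup>+x. ennreal (norm (G x)) \<partial>lborel)"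
      by (rule trace_inequality[OF sets locally_finite_borel_sigma_finite[OF \<mu>]])
    also have "\<dots> \<le> ?c * ?g * frac_variation \<alpha> f" by (intro mult_left_mono G) simp
    finally show ?thesis using v_borel by (simp add: w_def r_def)
  qed
  then have [measurable]: "w k \<in> borel_measurable borel" for k by blast
  have "ennreal \<bar>precise_rep u x\<bar> \<le> liminf (\<lambda>k. ennreal \<bar>w k x\<bar>)" for x
  \<comment> \<open>Without a limit of the averages the representative is 0 and the bound is
    trivial, whatever the mollifications do at x.\<close>
  proof (cases "\<exists>l. (ball_average u x \<longlongrightarrow> l) (at_right 0)")
    case True
    then obtain l where l: "(ball_average u x \<longlongrightarrow> l) (at_right 0)" by blast
    then have "precise_rep u x = l" using True by (simp add: precise_rep_def tendsto_Lim)
    moreover have "(\<lambda>k. \<bar>w k x\<bar>) \<longlonglongrightarrow> \<bar>l\<bar>"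
      unfolding w_def by (intro tendsto_rabs mollified_tendsto_precise_rep u_locally_integrable l)
    then have "liminf (\<lambda>k. ennreal \<bar>w k x\<bar>) = ennreal \<bar>l\<bar>"
      by (intro lim_imp_Liminf tendsto_ennrealI) simp_all
    ultimately show ?thesis by simp
  qed (simp add: precise_rep_def)
  then have "(\<integral>\<^sup>+x. ennreal \<bar>precise_rep u x\<bar> \<partial>\<mu>) \<le> (\<integral>\<^sup>+x. liminf (\<lambda>k. ennreal \<bar>w k x\<bar>) \<partial>\<mu>)"
    by (intro nn_integral_mono)
  also have "\<dots> \<le> liminf (\<lambda>k. \<integral>\<^sup>+x. ennreal \<bar>w k x\<bar> \<partial>\<mu>)"
    by (rule nn_integral_liminf) measurable
  also have "\<dots> \<le> liminf (\<lambda>k. ?c * ?g * frac_variation \<alpha> f)"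
    using bound by (intro Liminf_mono always_eventually allI) blast
  also have "\<dots> = ?c * ?g * frac_variation \<alpha> f" by (simp add: Liminf_const)
  finally show ?thesis .
qed

end

section \<open>Passage to a Borel representative\<close>

lemma frac_div_borel:
  fixes \<phi> :: "'a::euclidean_space \<Rightarrow> 'a"
  assumes "continuous_on UNIV \<phi>"
  shows "frac_div \<alpha> \<phi> \<in> borel_measurable borel"
proof -
  have [measurable]: "\<phi> \<in> borel_measurable borel" using assms by (rule borel_measurable_continuous_onI)
  have "frac_div \<alpha> \<phi> = (\<lambda>x. frac_const DIM('a) \<alpha> *
    (\<integral>y. ((y - x) \<bullet> (\<phi> y - \<phi> x)) / norm (y - x) powr (real DIM('a) + \<alpha> + 1) \<partial>lborel))"
    unfolding frac_div_def[abs_def] by (intro ext arg_cong[where f="(*) _"] integral_completion) measurable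
  then show ?thesis by simp
qed

lemma frac_variation_cong_AE:
  fixes f g :: "'a::euclidean_space \<Rightarrow> real"
  assumes f: "f \<in> borel_measurable lebesgue" and g: "g \<in> borel_measurable lebesgue" and eq: "AE x in lebesgue. f x = g x"
  shows "frac_variation \<alpha> f = frac_variation \<alpha> g"
  unfolding frac_variation_def
proof (rule SUP_cong[OF refl])
  fix \<phi> :: "'a \<Rightarrow> 'a" assume "\<phi> \<in> {\<phi>. Cinf_c \<phi> \<and> (AE x in lebesgue. norm (\<phi> x) \<le> 1)}"
  then have "continuous_on UNIV \<phi>" using Ck_imp_continuous[of 0 \<phi>] by (auto simp: Cinf_c_def)
  then have m: "frac_div \<alpha> \<phi> \<in> borel_measurable lebesgue"
    using frac_div_borel by (intro measurable_completion) auto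
  have "(\<integral>x. f x * frac_div \<alpha> \<phi> x \<partial>lebesgue) = (\<integral>x. g x * frac_div \<alpha> \<phi> x \<partial>lebesgue)"
    by (rule integral_cong_AE) (use f g m eq in \<open>auto intro!: borel_measurable_times\<close>)
  then show "ennreal (\<integral>x. f x * frac_div \<alpha> \<phi> x \<partial>lebesgue) = ennreal (\<integral>x. g x * frac_div \<alpha> \<phi> x \<partial>lebesgue)" by simp
qed

lemma riesz_potential_cong_AE:
  fixes f g :: "'a::euclidean_space \<Rightarrow> real"
  assumes f: "f \<in> borel_measurable lebesgue" and g: "g \<in> borel_measurable lebesgue" and eq: "AE x in lebesgue. f x = g x"
  shows "riesz_potential s f = riesz_potential s g"
proof
  fix x :: 'a
  have m: "(\<lambda>y. norm (x - y) powr (real DIM('a) - s)) \<in> borel_measurable lebesgue"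
    by (intro measurable_completion) measurable
  have "(\<integral>y. f y / norm (x - y) powr (real DIM('a) - s) \<partial>lebesgue) = (\<integral>y. g y / norm (x - y) powr (real DIM('a) - s) \<partial>lebesgue)"
    by (rule integral_cong_AE) (use f g m eq in \<open>auto intro!: borel_measurable_divide\<close>)
  then show "riesz_potential s f x = riesz_potential s g x" by (simp add: riesz_potential_def)
qed

lemma BV_trace_inequality:
  fixes f :: "'a::euclidean_space \<Rightarrow> real" and \<mu> :: "'a measure"
  assumes \<alpha>: "0 < \<alpha>" "\<alpha> < 1" and p: "1 \<le> p" "p < real DIM('a) / (1 - \<alpha>)"
    and f: "f \<in> BV \<alpha> p" and \<mu>: "locally_finite_borel \<mu>"
  shows "(\<integral>\<^sup>+x. ennreal \<bar>precise_rep (riesz_potential (1 - \<alpha>) f) x\<bar> \<partial>\<mu>)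
    \<le> ennreal (2 * (boxing_const DIM('a)))
     * growth_norm (real DIM('a) - 1) \<mu> * frac_variation \<alpha> f"
proof -
  have fm: "f \<in> borel_measurable lebesgue" and fint: "integrable lebesgue (\<lambda>x. \<bar>f x\<bar> powr p)"
    using f by (auto simp: BV_def mem_Lp_def)
  \<comment> \<open>Members of \<open>BV\<close> are only Lebesgue measurable, while the product
    measure arguments ask for a Borel function. Neither side of the inequality changes when f is
    replaced by g.\<close>
  obtain g where g: "g \<in> borel_measurable lborel" "AE x in lborel. f x = g x"
    using completion_ex_borel_measurable_real[OF fm] by blast
  have [measurable]: "g \<in> borel_measurable borel" using g(1) by simp
  have gm: "g \<in> borel_measurable lebesgue" using g(1) by (rule measurable_completion)
  have eq: "AE x in lebesgue. f x = g x" using g(2) by (rule AE_completion)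
  have "(\<lambda>x. \<bar>g x\<bar> powr p) \<in> borel_measurable lebesgue" by (intro measurable_completion) measurable
  then have "integrable lebesgue (\<lambda>x. \<bar>g x\<bar> powr p)"
    by (rule integrable_cong_AE_imp[OF fint]) (use eq in \<open>auto elim: eventually_mono\<close>)
  then have gint: "integrable lborel (\<lambda>x. \<bar>g x\<bar> powr p)"
    by (subst (asm) integrable_completion) auto
  have n: "real DIM('a) \<ge> 1" using DIM_positive[where 'a='a] by linarith
  \<comment> \<open>The bound p (1 - \<alpha>) < n, in the form that the weight estimate takes for
    \<beta> = n - (1 - \<alpha>).\<close>
  have p': "p * (real DIM('a) - (real DIM('a) - (1 - \<alpha>))) < real DIM('a)"
    using p(2) \<alpha> by (simp add: field_simps)
  have pos: "0 < real DIM('a) - (1 - \<alpha>)" using n \<alpha> by linarith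
  interpret riesz_setting g \<alpha>
  proof
    show "(\<integral>\<^sup>+z. ennreal (\<bar>g z\<bar> * (1 + norm z) powr (-(real DIM('a) - (1 - \<alpha>)))) \<partial>lborel) < \<infinity>"
      by (rule nn_integral_Lp_weight_finite[OF _ p(1) p' pos gint]) measurable
  qed (use \<alpha> in auto)
  show ?thesis
    using trace_inequality[OF \<mu>] unfolding u_def
    by (simp only: riesz_potential_cong_AE[OF fm gm eq] frac_variation_cong_AE[OF fm gm eq])
qed

theorem theorem1p12:
  shows "\<exists>c::real. c > 0 \<and>
    (\<forall>\<alpha> p. 0 < \<alpha> \<and> \<alpha> < 1 \<and> 1 \<le> p \<and> p < real CARD('n::finite) / (1 - \<alpha>) \<longrightarrow>
      (\<forall>f :: real ^ 'n \<Rightarrow> real. \<forall>\<mu> :: (real ^ 'n) measure.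
        f \<in> BV \<alpha> p \<and> locally_finite_borel \<mu> \<longrightarrow>
        (\<integral>\<^sup>+x. ennreal \<bar>precise_rep (riesz_potential (1 - \<alpha>) f) x\<bar> \<partial>\<mu>)
          \<le> ennreal c * growth_norm (real CARD('n) - 1) \<mu> * frac_variation \<alpha> f))"
proof -
  \<comment> \<open>Chosen before \<alpha> and p, this is the boxing constant doubled for the two
    signs.\<close>
  define c :: real where "c = 2 * boxing_const CARD('n)"
  have dim: "DIM(real ^ 'n) = CARD('n)" by simp
  show ?thesis
  proof (intro exI[of _ c] conjI allI impI; (elim conjE)?)
    show "c > 0" unfolding c_def by (intro mult_pos_pos divide_pos_pos unit_ball_vol_pos) auto
  next
    fix \<alpha> p :: real and f :: "real ^ 'n \<Rightarrow> real" and \<mu> :: "(real ^ 'n) measure"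
    assume "0 < \<alpha>" "\<alpha> < 1" "1 \<le> p" "p < real CARD('n) / (1 - \<alpha>)" "f \<in> BV \<alpha> p" "locally_finite_borel \<mu>"
    then show "(\<integral>\<^sup>+x. ennreal \<bar>precise_rep (riesz_potential (1 - \<alpha>) f) x\<bar> \<partial>\<mu>)
        \<le> ennreal c * growth_norm (real CARD('n) - 1) \<mu> * frac_variation \<alpha> f"
      unfolding c_def by (rule BV_trace_inequality[where 'a="real ^ 'n", unfolded dim])
  qed
qed

end
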